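(* Let $d\ge1$, $\nu>0$, $c_V>0$. There exist constants $C,K,K'>0$ depending only on $d,\nu,c_V$ such that the following holds. Let $\lambda>0$ and let $V$ satisfy the standing assumptions of the context together with $$yV'(y)-V(y)\ge c_V\,y^2\qquad(y\ge0).$$ Let $h_0\in\mathcal{W}^{1,\infty}(\mathbb{R}^d)\cap L^1(\mathbb{R}^d)$, $h_0\not\equiv0$, and let $h$ be the solution of $\partial_th=\nu\Delta h+\lambda V(|\nabla h|)$ with initial condition $h_0$. Then for all $t\ge 0$, $$\|\nabla h_t\|_1\le K\,\max\big(J_\infty,J_\infty^{1+\frac1d}\big)\,(1+t)^{-1/2},$$ where $$J_\infty=\sup\Big(1,\ \frac{\|\nabla h_0\|_1}{\|h_0\|_1},\ \lambda\|\nabla h_0\|_\infty\big(1+K'\lambda\|h_0\|_\infty\big)\Big)\,\|h_0\|_1\,e^{C\lambda\|h_0\|_\infty}.$$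
   Context: Standing assumptions on $V$: $V$ is $C^2$; $V$ is isotropic, i.e. a function of $y=|\nabla h|$; $V$ is convex; $V(0)=0$ and $V(y)\ge0$ for $y\ge0$; $V(y)\le y^2$ for $y\ge0$. $\|\cdot\|_p$ is the $L^p(\mathbb{R}^d)$ norm; $\mathcal{W}^{1,\infty}$ is the space of bounded functions with bounded generalized gradient. For $h_0\in\mathcal{W}^{1,\infty}$, "the solution" is the unique global solution $h\in C([0,\infty)\times\mathbb{R}^d)\cap C^{1,2}((0,\infty)\times\mathbb{R}^d)$, bounded with bounded gradient; $h_t=h(t,\cdot)$. If $\|\nabla h_0\|_1=+\infty$ the right-hand side is $+\infty$. *)

theory Defs
  imports "HOL-Analysis.Analysis" "HOL-Probability.Essential_Supremum"
begin

section \<open>Norms and generalized gradients\<close>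

text \<open>The norms take values in \<^typ>\<open>ennreal\<close>, so that infinite norms are not lost.\<close>

definition norm_L1 :: "(real ^ 'n \<Rightarrow> 'b::real_normed_vector) \<Rightarrow> ennreal" where
  "norm_L1 f = (\<integral>\<^sup>+ x. ennreal (norm (f x)) \<partial>lebesgue)"

definition norm_Linf :: "(real ^ 'n \<Rightarrow> 'b::real_normed_vector) \<Rightarrow> ennreal" where
  "norm_Linf f = esssup lebesgue (\<lambda>x. ennreal (norm (f x)))"

text \<open>\<open>F is\<close> is the iterated partial derivative of \<open>f\<close> along the multi-index \<open>is\<close>.\<close>

definition smooth :: "(real ^ 'n \<Rightarrow> real) \<Rightarrow> bool" where
  "smooth f \<longleftrightarrow>
    (\<exists>F :: 'n list \<Rightarrow> real ^ 'n \<Rightarrow> real.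
       F [] = f \<and>
       (\<forall>is x. (F is has_derivative (\<lambda>v. \<Sum>i\<in>UNIV. v $ i * F (i # is) x)) (at x)))"

definition test_function :: "(real ^ 'n \<Rightarrow> real) \<Rightarrow> bool" where
  "test_function \<phi> \<longleftrightarrow> smooth \<phi> \<and> compact (closure {x. \<phi> x \<noteq> 0})"

definition locally_integrable :: "(real ^ 'n \<Rightarrow> 'b::euclidean_space) \<Rightarrow> bool" where
  "locally_integrable f \<longleftrightarrow> (\<forall>S. compact S \<longrightarrow> set_integrable lebesgue S f)"

definition has_weak_gradient ::
    "(real ^ 'n \<Rightarrow> real) \<Rightarrow> (real ^ 'n \<Rightarrow> real ^ 'n) \<Rightarrow> bool" where
  "has_weak_gradient f g \<longleftrightarrow>
    locally_integrable f \<and> locally_integrable g \<and>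
    (\<forall>\<phi> i. test_function \<phi> \<longrightarrow>
       (LINT x|lebesgue. f x * frechet_derivative \<phi> (at x) (axis i 1))
         = - (LINT x|lebesgue. g x $ i * \<phi> x))"

text \<open>The generalized gradient is unique up to a null set, so its \<open>L\<^sup>p\<close> norms do not depend on
  the choice made here.  For a \<open>C\<^sup>1\<close> function it is the classical gradient almost everywhere.\<close>

definition weak_grad :: "(real ^ 'n \<Rightarrow> real) \<Rightarrow> real ^ 'n \<Rightarrow> real ^ 'n" where
  "weak_grad f = (SOME g. has_weak_gradient f g)"

definition W1_inf :: "(real ^ 'n \<Rightarrow> real) set" where
  "W1_inf = {f. f \<in> borel_measurable lebesgue \<and> norm_Linf f < \<infinity> \<and>
                (\<exists>g. has_weak_gradient f g \<and> norm_Linf g < \<infinity>)}"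

section \<open>The nonlinearity\<close>

text \<open>The isotropic function \<open>V\<close> is represented by its profile on \<open>[0,\<infinity>)\<close>, the equation containing
  \<open>V (norm (\<nabla>h))\<close>.  Derivatives at \<open>0\<close> are one-sided.\<close>

abbreviation dV :: "(real \<Rightarrow> real) \<Rightarrow> real \<Rightarrow> real" where
  "dV V y \<equiv> vector_derivative V (at y within {0..})"

definition C2_halfline :: "(real \<Rightarrow> real) \<Rightarrow> bool" where
  "C2_halfline V \<longleftrightarrow>
    (\<exists>V1 V2.
       (\<forall>y\<ge>0. (V has_real_derivative V1 y) (at y within {0..})) \<and>
       (\<forall>y\<ge>0. (V1 has_real_derivative V2 y) (at y within {0..})) \<and>
       continuous_on {0..} V2)"

definition standing_assumptions :: "(real \<Rightarrow> real) \<Rightarrow> bool" where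
  "standing_assumptions V \<longleftrightarrow>
    C2_halfline V \<and> convex_on {0..} V \<and> V 0 = 0 \<and>
    (\<forall>y\<ge>0. 0 \<le> V y) \<and> (\<forall>y\<ge>0. V y \<le> y\<^sup>2)"

section \<open>Solutions of the Cauchy problem\<close>

text \<open>\<open>g\<close>, \<open>H\<close> and \<open>h'\<close> are the spatial gradient, the spatial Hessian and the time derivative of
  \<open>h\<close>; the Laplacian is the trace of \<open>H\<close>.  The initial datum is a class of functions modulo null
  sets, hence the initial condition holds almost everywhere.\<close>

definition is_solution ::
    "real \<Rightarrow> real \<Rightarrow> (real \<Rightarrow> real) \<Rightarrow> (real ^ 'n \<Rightarrow> real) \<Rightarrow> (real \<Rightarrow> real ^ 'n \<Rightarrow> real) \<Rightarrow> bool" where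
  "is_solution \<nu> lam V h0 h \<longleftrightarrow>
    continuous_on ({0..} \<times> UNIV) (\<lambda>(t, x). h t x) \<and>
    (AE x in lebesgue. h 0 x = h0 x) \<and>
    (\<exists>B. \<forall>t\<ge>0. \<forall>x. \<bar>h t x\<bar> \<le> B) \<and>
    (\<exists>(h' :: real \<Rightarrow> real ^ 'n \<Rightarrow> real) (g :: real \<Rightarrow> real ^ 'n \<Rightarrow> real ^ 'n)
       (H :: real \<Rightarrow> real ^ 'n \<Rightarrow> real ^ 'n ^ 'n).
       (\<forall>t>0. \<forall>x. ((\<lambda>s. h s x) has_real_derivative h' t x) (at t) \<and>
                  (h t has_derivative (\<lambda>v. g t x \<bullet> v)) (at x) \<and>
                  (g t has_derivative (\<lambda>v. H t x *v v)) (at x)) \<and>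
       continuous_on ({0<..} \<times> UNIV) (\<lambda>(t, x). h' t x) \<and>
       continuous_on ({0<..} \<times> UNIV) (\<lambda>(t, x). g t x) \<and>
       continuous_on ({0<..} \<times> UNIV) (\<lambda>(t, x). H t x) \<and>
       (\<exists>B. \<forall>t>0. \<forall>x. norm (g t x) \<le> B) \<and>
       (\<forall>t>0. \<forall>x. h' t x = \<nu> * trace (H t x) + lam * V (norm (g t x))))"

section \<open>The right-hand side\<close>

text \<open>Power with a positive exponent, \<open>\<infinity>\<close> being mapped to \<open>\<infinity>\<close>.\<close>

definition ennpow :: "ennreal \<Rightarrow> real \<Rightarrow> ennreal" where
  "ennpow x p = (if x = \<infinity> then \<infinity> else ennreal (enn2real x powr p))"

text \<open>In the exponential, \<open>enn2real\<close> is harmless: \<open>J_inf\<close> is only used for bounded \<open>h0\<close>.\<close>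

definition J_inf :: "real \<Rightarrow> real \<Rightarrow> real \<Rightarrow> (real ^ 'n \<Rightarrow> real) \<Rightarrow> ennreal" where
  "J_inf C K' lam h0 =
     Sup {1,
          norm_L1 (weak_grad h0) / norm_L1 h0,
          ennreal lam * norm_Linf (weak_grad h0) * (1 + ennreal (K' * lam) * norm_Linf h0)}
     * norm_L1 h0
     * ennreal (exp (C * lam * enn2real (norm_Linf h0)))"

end

theory Submission
  imports Defs "HOL-Probability.Distributions" "HOL-Real_Asymp.Real_Asymp"
begin

text \<open>
  Let \<open>M\<close> be the supremum norm and \<open>m\<close> the \<open>L\<^sup>1\<close> norm of \<open>h\<^sub>0\<close>.  As \<open>0 \<le> V(y) \<le> y\<^sup>2\<close>, the solution
  lies above the heat flow of \<open>h\<^sub>0\<close>, and \<open>exp (\<lambda> h / \<nu>) - 1\<close> lies below its own heat flow.  Hence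
  \<open>\<bar>h\<^sub>t\<bar>\<close> is at most \<open>exp (\<lambda> M / \<nu>)\<close> times the heat flow of \<open>\<bar>h\<^sub>0\<bar>\<close>, which controls the \<open>L\<^sup>1\<close> norm of \<open>h\<^sub>t\<close>;
  integrating the equation, the space-time integral of \<open>\<lambda> V(\<bar>\<nabla>h\<bar>)\<close> is at most \<open>2 m exp (\<lambda> M / \<nu>)\<close>.

  Doubling the variables in \<open>u = sqrt (M + \<delta> - h)\<close> shows that \<open>u\<close> has Lipschitz constant \<open>(4 c \<lambda> t)\<^bsup>-1/2\<^esup>\<close>,
  hence \<open>c \<lambda> t \<bar>\<nabla>h\<bar>\<^sup>2 \<le> 2 M\<close>: this is where \<open>y V'(y) - V(y) \<ge> c y\<^sup>2\<close> enters.  Doubling also replaces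
  Bernstein's method, for which \<open>h\<close> would need third derivatives.

  By Duhamel's formula the \<open>L\<^sup>1\<close> norm \<open>N(t)\<close> of \<open>\<nabla>h\<^sub>t\<close> obeys
  \<open>N(t) \<le> C m (t - s)\<^bsup>-1/2\<^esup> + C \<integral>\<^sub>s\<^sup>t (t - r)\<^bsup>-1/2\<^esup> v(r) dr\<close>, where \<open>v\<close>, the \<open>L\<^sup>1\<close> norm of \<open>\<lambda> V(\<bar>\<nabla>h\<bar>)\<close>, is at
  most \<open>\<lambda> sup \<bar>\<nabla>h\<bar> N\<close>.  Inserting this inequality once into itself turns the singular kernel into a
  bounded one, so that only the integral of \<open>v\<close> remains and Gronwall's lemma is not needed.  With
  \<open>s = t / 2\<close> and \<open>\<lambda> sup \<bar>\<nabla>h\<bar> = O(t\<^bsup>-1/2\<^esup>)\<close> this is the decay for \<open>t \<ge> 1\<close>; with \<open>s = 0\<close> and the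
  Lipschitz constant of \<open>h\<^sub>0\<close>, which the flow does not increase, it is the bound for \<open>t \<le> 1\<close>.
\<close>
section \<open>Translations and integration by parts\<close>

text \<open>The heat flow is written as an average of u (x + sqrt (2 \<nu> t) z) over a fixed
  Gaussian in z. A translation in x then becomes a translation of the Gaussian, so the factor (t -
  r)^(-1/2) comes with one number, a first absolute moment. The Duhamel integral is never
  differentiated: L^1 bounds are proved for difference quotients and reach the gradient by Fatou's
  lemma. L^1 norms live in \<open>ennreal\<close>. No norm of the gradient has to be known finite
  beforehand: the iteration ends in the total mass of the source, which nonnegativity of V controls,
  and nothing is absorbed into a left-hand side. The square root is chosen because h = M + \<delta>
  - u^2 turns the nonlinearity into \<lambda> V(2 u q) / (2 u), and the hypothesis on V says that
  V(y) / y - c y is nondecreasing. Comparing two values of u at the same q therefore gains 2 c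
  \<lambda> q^2 times their difference, and (4 c \<lambda> t)^(-1/2) solves L' = - 2 c \<lambda>
  L^3.\<close>

lemma nn_integral_shift:
  fixes F :: "'a::euclidean_space \<Rightarrow> ennreal"
  assumes [measurable]: "F \<in> borel_measurable borel"
  shows "(\<integral>\<^sup>+x. F (x + c) \<partial>lborel) = (\<integral>\<^sup>+x. F x \<partial>lborel)"
proof -
  have "(\<integral>\<^sup>+x. F x \<partial>lborel) = (\<integral>\<^sup>+x. F x \<partial>distr lborel borel ((+) c))"
    by (simp add: lborel_distr_plus)
  also have "\<dots> = (\<integral>\<^sup>+x. F (x + c) \<partial>lborel)"
    by (subst nn_integral_distr) (simp_all add: add.commute)
  finally show ?thesis by simp
qed

lemma lborel_integral_shift:
  fixes F :: "'a::euclidean_space \<Rightarrow> real"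
  assumes [measurable]: "F \<in> borel_measurable borel"
  shows "(LINT x|lborel. F (x + c)) = (LINT x|lborel. F x)"
proof -
  have "(LINT x|lborel. F x) = (LINT x|distr lborel borel ((+) c). F x)"
    by (simp add: lborel_distr_plus)
  also have "\<dots> = (LINT x|lborel. F (x + c))"
    by (subst integral_distr) (simp_all add: add.commute)
  finally show ?thesis by simp
qed

lemma integrable_compact_support:
  fixes F :: "'a::euclidean_space \<Rightarrow> real"
  assumes "continuous_on UNIV F" and "\<And>x. norm x > R \<Longrightarrow> F x = 0"
  shows "integrable lborel F"
proof -
  have "integrable lborel (\<lambda>x. indicator (cball 0 R) x *\<^sub>R F x)"
    by (rule borel_integrable_compact) (auto intro: continuous_on_subset[OF assms(1)])
  also have "(\<lambda>x. indicator (cball 0 R) x *\<^sub>R F x) = F"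
    using assms(2) by (auto simp: indicator_def fun_eq_iff not_le)
  finally show ?thesis .
qed

text \<open>Difference quotients in direction \<open>e\<close> integrate to 0 by translation
  invariance. By the mean value theorem they are bounded, live on a fixed ball and converge to the
  directional derivative.\<close>

lemma integral_directional_derivative_eq_0:
  fixes F :: "'a::euclidean_space \<Rightarrow> real"
  assumes der: "\<And>x. (F has_derivative F' x) (at x)"
    and cont: "continuous_on UNIV (\<lambda>x. F' x e)"
    and supp: "\<And>x. norm x > R \<Longrightarrow> F x = 0"
  shows "(LINT x|lborel. F' x e) = 0"
proof -
  have cF: "continuous_on UNIV F"
    using der by (meson continuous_on_eq_continuous_within has_derivative_continuous continuous_at_imp_continuous_on)
  have [measurable]: "F \<in> borel_measurable borel" using cF by (rule borel_measurable_continuous_onI)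
  have [measurable]: "(\<lambda>x. F' x e) \<in> borel_measurable borel" using cont by (rule borel_measurable_continuous_onI)
  define q where "q n x = (F (x + (1 / real (Suc n)) *\<^sub>R e) - F x) * real (Suc n)" for n x
  \<comment> \<open>The quotients live in the ball of radius \<open>\<bar>R\<bar> + norm e\<close>,
    and the intermediate points of the mean value theorem lie at most \<open>norm e\<close> further
    out.\<close>
  define K where "K = cball (0::'a) (\<bar>R\<bar> + 2 * norm e)"
  have "compact ((\<lambda>x. F' x e) ` K)"
    by (intro compact_continuous_image continuous_on_subset[OF cont]) (auto simp: K_def)
  then obtain D where D: "\<And>x. x \<in> K \<Longrightarrow> \<bar>F' x e\<bar> \<le> D"
    by (metis bounded_real compact_imp_bounded imageI)
  have mvt: "\<exists>\<theta>\<in>{0<..<h}. F (x + h *\<^sub>R e) - F x = h * F' (x + \<theta> *\<^sub>R e) e" if "h > 0" for x h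
  proof -
    have "((\<lambda>s. F (x + s *\<^sub>R e)) has_real_derivative F' (x + s *\<^sub>R e) e) (at s)" for s
    proof -
      have 1: "((\<lambda>s. x + s *\<^sub>R e) has_derivative (\<lambda>s. s *\<^sub>R e)) (at s)"
        by (auto intro!: derivative_eq_intros)
      have "((\<lambda>s. F (x + s *\<^sub>R e)) has_derivative (\<lambda>h. F' (x + s *\<^sub>R e) (h *\<^sub>R e))) (at s)"
        using has_derivative_compose[OF 1 der] by simp
      moreover have "(\<lambda>h. F' (x + s *\<^sub>R e) (h *\<^sub>R e)) = (*) (F' (x + s *\<^sub>R e) e)"
        using has_derivative_linear[OF der[of "x + s *\<^sub>R e"]] by (auto simp: linear_cmul mult.commute)
      ultimately show ?thesis unfolding has_field_derivative_def by simp
    qed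
    from MVT2[OF that this] obtain z where "z > 0" "z < h" "F (x + h *\<^sub>R e) - F (x + 0 *\<^sub>R e) = (h - 0) * F' (x + z *\<^sub>R e) e"
      by blast
    thus ?thesis by auto
  qed
  have q_eq: "\<exists>\<theta>\<in>{0<..<1}. q n x = F' (x + \<theta> *\<^sub>R e) e" for n x
  proof -
    obtain \<theta> where "\<theta> \<in> {0<..<1 / real (Suc n)}"
      "F (x + (1 / real (Suc n)) *\<^sub>R e) - F x = 1 / real (Suc n) * F' (x + \<theta> *\<^sub>R e) e"
      using mvt[of "1 / real (Suc n)" x] by auto
    moreover from this have "\<theta> < 1"
      by (smt (verit) greaterThanLessThan_iff divide_le_eq_1 of_nat_Suc of_nat_0_le_iff)
    ultimately show ?thesis by (intro bexI[of _ \<theta>]) (auto simp: q_def)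
  qed
  have lim: "(\<lambda>n. integral\<^sup>L lborel (q n)) \<longlonglongrightarrow> (LINT x|lborel. F' x e)"
  proof (rule integral_dominated_convergence[where w = "\<lambda>x. indicator (cball 0 (\<bar>R\<bar> + norm e)) x *\<^sub>R D"])
    show "integrable lborel (\<lambda>x. indicator (cball (0::'a) (\<bar>R\<bar> + norm e)) x *\<^sub>R D)"
      by (rule borel_integrable_compact) auto
    show "(\<lambda>x. F' x e) \<in> borel_measurable lborel" "\<And>n. q n \<in> borel_measurable lborel"
      unfolding q_def by measurable
    show "AE x in lborel. norm (q n x) \<le> indicator (cball 0 (\<bar>R\<bar> + norm e)) x *\<^sub>R D" for n
    proof (rule AE_I2)
      fix x
      show "norm (q n x) \<le> indicator (cball 0 (\<bar>R\<bar> + norm e)) x *\<^sub>R D"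
      proof (cases "norm x \<le> \<bar>R\<bar> + norm e")
        case True
        obtain \<theta> where \<theta>: "\<theta> \<in> {0<..<1}" "q n x = F' (x + \<theta> *\<^sub>R e) e" using q_eq by blast
        have "norm (\<theta> *\<^sub>R e) \<le> norm e" using \<theta>(1) by (simp add: mult_left_le_one_le)
        hence "x + \<theta> *\<^sub>R e \<in> K" using True norm_triangle_ineq[of x "\<theta> *\<^sub>R e"] by (simp add: K_def)
        thus ?thesis using True D \<theta>(2) by simp
      next
        case False
        have "norm ((1 / real (Suc n)) *\<^sub>R e) \<le> norm e" by (simp add: divide_le_eq mult_le_cancel_left1)
        hence "norm (x + (1 / real (Suc n)) *\<^sub>R e) > R"
          using False norm_diff_ineq[of x "(1 / real (Suc n)) *\<^sub>R e"] by linarith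
        moreover have "norm x > R" using False norm_ge_zero[of e] by linarith
        ultimately show ?thesis using supp False by (simp add: q_def)
      qed
    qed
    show "AE x in lborel. (\<lambda>n. q n x) \<longlonglongrightarrow> F' x e"
    proof (rule AE_I2)
      fix x
      have "\<exists>\<theta>. \<forall>n. \<theta> n \<in> {0<..<1 / real (Suc n)} \<and> q n x = F' (x + \<theta> n *\<^sub>R e) e"
      proof (rule choice, rule allI)
        fix n
        obtain \<theta> where "\<theta> \<in> {0<..<1 / real (Suc n)}"
          "F (x + (1 / real (Suc n)) *\<^sub>R e) - F x = 1 / real (Suc n) * F' (x + \<theta> *\<^sub>R e) e"
          using mvt[of "1 / real (Suc n)" x] by auto
        thus "\<exists>\<theta>. \<theta> \<in> {0<..<1 / real (Suc n)} \<and> q n x = F' (x + \<theta> *\<^sub>R e) e"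
          by (auto simp: q_def)
      qed
      then obtain \<theta> where \<theta>: "\<And>n. \<theta> n \<in> {0<..<1 / real (Suc n)}" "\<And>n. q n x = F' (x + \<theta> n *\<^sub>R e) e"
        by blast
      have "\<theta> \<longlonglongrightarrow> 0"
      proof (rule tendsto_sandwich[OF _ _ tendsto_const lim_1_over_n[THEN LIMSEQ_Suc]])
        show "\<forall>\<^sub>F n in sequentially. 0 \<le> \<theta> n" using \<theta>(1) by (auto intro!: always_eventually less_imp_le)
        show "\<forall>\<^sub>F n in sequentially. \<theta> n \<le> 1 / of_nat (Suc n)"
          using \<theta>(1) by (auto intro!: always_eventually less_imp_le)
      qed
      hence "(\<lambda>n. x + \<theta> n *\<^sub>R e) \<longlonglongrightarrow> x + 0 *\<^sub>R e" by (intro tendsto_intros)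
      hence "(\<lambda>n. F' (x + \<theta> n *\<^sub>R e) e) \<longlonglongrightarrow> F' (x + 0 *\<^sub>R e) e"
        using continuous_on_tendsto_compose[OF cont] by auto
      thus "(\<lambda>n. q n x) \<longlonglongrightarrow> F' x e" using \<theta>(2) by simp
    qed
  qed
  have intF: "integrable lborel F" by (rule integrable_compact_support[OF cF supp])
  have "integral\<^sup>L lborel (q n) = 0" for n
  proof -
    define c where "c = (1 / real (Suc n)) *\<^sub>R e"
    have "integrable lborel (\<lambda>x. F (x + c))"
    proof -
      have "integrable (distr lborel borel ((+) c)) F" using intF by (simp add: lborel_distr_plus)
      thus ?thesis by (subst (asm) integrable_distr_eq) (simp_all add: add.commute)
    qed
    hence "(LINT x|lborel. F (x + c) - F x) = 0"
      using intF lborel_integral_shift[of F c] by simp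
    thus ?thesis unfolding q_def c_def[symmetric] by simp
  qed
  with lim show ?thesis by (simp add: LIMSEQ_const_iff)
qed

section \<open>The standard Gaussian and its first absolute moments\<close>

definition gauss :: "real ^ 'n \<Rightarrow> real" where
  "gauss z = (\<Prod>b\<in>Basis. std_normal_density (z \<bullet> b))"

lemma gauss_pos: "gauss z > 0"
  unfolding gauss_def by (intro prod_pos) (simp add: normal_density_pos)

lemma gauss_nonneg [simp]: "gauss z \<ge> 0"
  using gauss_pos[of z] by simp

lemma gauss_eq: "gauss z = (1 / sqrt (2 * pi)) ^ CARD('n) * exp (- (z \<bullet> z) / 2)"
  for z :: "real ^ 'n"
proof -
  have "gauss z = (\<Prod>b\<in>(Basis::(real^'n) set). (1 / sqrt (2 * pi))) * (\<Prod>b\<in>Basis. exp (- (z \<bullet> b)\<^sup>2 / 2))"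
    unfolding gauss_def std_normal_density_def by (rule prod.distrib)
  also have "(\<Prod>b\<in>Basis. exp (- (z \<bullet> b)\<^sup>2 / 2)) = exp (\<Sum>b\<in>Basis. - (z \<bullet> b)\<^sup>2 / 2)"
    by (rule exp_sum[symmetric]) simp
  also have "(\<Sum>b\<in>Basis. - (z \<bullet> b)\<^sup>2 / 2) = - (z \<bullet> z) / 2"
    by (subst euclidean_inner[of z z]) (simp add: sum_negf sum_divide_distrib power2_eq_square)
  finally show ?thesis by simp
qed

lemma has_derivative_gauss: "(gauss has_derivative (\<lambda>v. - (gauss z * (z \<bullet> v)))) (at z)"
  for z :: "real ^ 'n"
proof -
  have "((\<lambda>z::real^'n. (1 / sqrt (2 * pi)) ^ CARD('n) * exp (- (z \<bullet> z) / 2)) has_derivative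
     (\<lambda>v. - (gauss z * (z \<bullet> v)))) (at z)"
    by (auto intro!: derivative_eq_intros simp: gauss_eq inner_commute fun_eq_iff)
  thus ?thesis by (simp add: gauss_eq[abs_def])
qed

lemma continuous_on_gauss [continuous_intros]:
  "continuous_on S f \<Longrightarrow> continuous_on S (\<lambda>x. gauss (f x))"
  unfolding gauss_eq by (intro continuous_intros) auto

lemma borel_measurable_gauss [measurable]: "gauss \<in> borel_measurable borel"
  by (intro borel_measurable_continuous_onI continuous_intros)

lemma nn_integral_gauss: "(\<integral>\<^sup>+z. ennreal (gauss (z::real^'n)) \<partial>lborel) = 1"
proof -
  have "(\<integral>\<^sup>+z. ennreal (gauss (z::real^'n)) \<partial>lborel)
      = (\<integral>\<^sup>+z. (\<Prod>b\<in>Basis. ennreal (std_normal_density ((z::real^'n) \<bullet> b))) \<partial>lborel)"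
    by (simp add: gauss_def prod_ennreal)
  also have "\<dots> = (\<Prod>b\<in>(Basis::(real^'n) set). (\<integral>\<^sup>+x. ennreal (std_normal_density x) \<partial>lborel))"
    by (rule nn_integral_lborel_prod) auto
  also have "(\<integral>\<^sup>+x. ennreal (std_normal_density x) \<partial>lborel) = 1"
    by (subst nn_integral_eq_integral) (auto simp: integrable_normal_density)
  finally show ?thesis by simp
qed

lemma integrable_gauss [simp]: "integrable lborel gauss"
  by (rule integrableI_nonneg) (simp_all add: nn_integral_gauss)

lemma integral_gauss: "(LINT z|lborel. gauss z) = 1"
  using nn_integral_gauss by (simp add: integral_eq_nn_integral)

text \<open>The i-th partial derivative of \<open>gauss\<close> is
  \<open>- (gauss z * z $ i)\<close>, so this is the L^1 norm of that derivative.\<close>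

abbreviation gauss_moment :: "'n::finite \<Rightarrow> ennreal" where
  "gauss_moment i \<equiv> (\<integral>\<^sup>+z. ennreal (gauss (z::real^'n) * \<bar>z $ i\<bar>) \<partial>lborel)"

text \<open>The integrand factors over the coordinates, the absolute value being attached to the
  single direction \<open>axis i 1\<close>. The integral is thus a product of one-dimensional normal
  moments of order 0 and 1.\<close>

lemma nn_integral_gauss_moment_finite:
  "gauss_moment i < \<infinity>"
  for i :: "'n::finite"
proof -
  let ?e = "axis i 1 :: real^'n"
  let ?f = "\<lambda>b x. ennreal (std_normal_density x * (if b = ?e then \<bar>x\<bar> else 1))"
  have eB: "?e \<in> Basis" by (simp add: axis_in_Basis_iff)
  have "ennreal (gauss z * \<bar>z $ i\<bar>) = (\<Prod>b\<in>Basis. ?f b (z \<bullet> b))" for z :: "real^'n"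
  proof -
    have "(\<Prod>b\<in>Basis. ?f b (z \<bullet> b)) = ennreal (\<Prod>b\<in>Basis. std_normal_density (z \<bullet> b) * (if b = ?e then \<bar>z \<bullet> b\<bar> else 1))"
      by (rule prod_ennreal) auto
    also have "(\<Prod>b\<in>Basis. std_normal_density (z \<bullet> b) * (if b = ?e then \<bar>z \<bullet> b\<bar> else 1))
        = gauss z * (\<Prod>b\<in>Basis. if b = ?e then \<bar>z \<bullet> b\<bar> else 1)"
      unfolding gauss_def by (rule prod.distrib)
    also have "(\<Prod>b\<in>Basis. if b = ?e then \<bar>z \<bullet> b\<bar> else 1) = \<bar>z \<bullet> ?e\<bar>"
      using eB by (simp add: prod.delta)
    finally show ?thesis by (simp add: inner_axis)
  qed
  hence "gauss_moment i
      = (\<integral>\<^sup>+z. (\<Prod>b\<in>Basis. ?f b ((z::real^'n) \<bullet> b)) \<partial>lborel)" by simp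
  also have "\<dots> = (\<Prod>b\<in>(Basis::(real^'n) set). (\<integral>\<^sup>+x. ?f b x \<partial>lborel))"
    by (rule nn_integral_lborel_prod) auto
  also have "\<dots> < top"
  proof -
    have "(\<integral>\<^sup>+x. ?f b x \<partial>lborel) \<noteq> top" for b
    proof (cases "b = ?e")
      case True
      have "integrable lborel (\<lambda>x. std_normal_density x * \<bar>x\<bar>)"
        using integrable_std_normal_moment_abs[of 1] by simp
      thus ?thesis using True by (auto simp: integrable_iff_bounded abs_mult less_top)
    next
      case False
      have "integrable lborel (\<lambda>x. std_normal_density x)" by (simp add: integrable_normal_density)
      thus ?thesis using False by (auto simp: integrable_iff_bounded less_top)
    qed
    thus ?thesis by (simp add: less_top[symmetric] ennreal_prod_eq_top)
  qed
  finally show ?thesis by simp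
qed

section \<open>Duhamel formula\<close>

text \<open>Squaring makes the positive part continuously differentiable, which is all the
  regularity that integration by parts asks of \<open>cutoff\<close>.\<close>

lemma has_real_derivative_max_0_square:
  "((\<lambda>s. (max 0 s)\<^sup>2) has_real_derivative 2 * max 0 s) (at (s::real))"
proof -
  consider "s > 0" | "s < 0" | "s = 0" by linarith
  thus ?thesis
  proof cases
    case 1
    have "((\<lambda>s. s\<^sup>2) has_real_derivative 2 * max 0 s) (at s)"
      using 1 by (auto intro!: derivative_eq_intros)
    thus ?thesis
      by (rule has_field_derivative_transform_within_open[where S = "{0<..}"]) (use 1 in auto)
  next
    case 2
    have "((\<lambda>s. 0) has_real_derivative 2 * max 0 s) (at s)"
      using 2 by (auto intro!: derivative_eq_intros)
    thus ?thesis
      by (rule has_field_derivative_transform_within_open[where S = "{..<0}"]) (use 2 in auto)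
  next
    case 3
    have "((\<lambda>h. (max 0 h)\<^sup>2 / h) \<longlongrightarrow> 0) (at (0::real))"
    proof (rule Lim_null_comparison)
      show "\<forall>\<^sub>F h in at (0::real). norm ((max 0 h)\<^sup>2 / h) \<le> \<bar>h\<bar>"
        by (rule always_eventually) (auto simp: max_def power2_eq_square)
      show "((\<lambda>h. \<bar>h\<bar>) \<longlongrightarrow> 0) (at (0::real))"
        by (auto intro!: tendsto_eq_intros)
    qed
    thus ?thesis using 3 by (simp add: DERIV_def)
  qed
qed

text \<open>The Hessian of \<open>u\<close> need not be bounded, hence the Gaussian is cut off before integrating by parts;
  the error only involves the gradient of \<open>u\<close>, which is bounded.\<close>

definition cutoff :: "real \<Rightarrow> real ^ 'n \<Rightarrow> real" where
  "cutoff R z = (max 0 (1 - (z \<bullet> z) / R\<^sup>2))\<^sup>2"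

definition cutoff_grad :: "real \<Rightarrow> real ^ 'n \<Rightarrow> real ^ 'n" where
  "cutoff_grad R z = (- (4 / R\<^sup>2) * max 0 (1 - (z \<bullet> z) / R\<^sup>2)) *\<^sub>R z"

lemma has_derivative_cutoff:
  "(cutoff R has_derivative (\<lambda>v. cutoff_grad R z \<bullet> v)) (at z)"
proof -
  have 1: "((\<lambda>z. 1 - (z \<bullet> z) / R\<^sup>2) has_derivative (\<lambda>v. - (2 * (z \<bullet> v) / R\<^sup>2))) (at z)"
    unfolding divide_inverse
    by (auto intro!: derivative_eq_intros simp: inner_commute fun_eq_iff)
  have "((\<lambda>s. (max 0 s)\<^sup>2) has_derivative (*) (2 * max 0 (1 - (z \<bullet> z) / R\<^sup>2))) (at (1 - (z \<bullet> z) / R\<^sup>2))"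
    using has_real_derivative_max_0_square by (simp add: has_field_derivative_def)
  from has_derivative_compose[OF 1 this] show ?thesis
    by (simp add: cutoff_def[abs_def] cutoff_grad_def mult_ac)
qed

lemma continuous_on_cutoff [continuous_intros]:
  "continuous_on S f \<Longrightarrow> continuous_on S (\<lambda>x. cutoff R (f x))"
  unfolding cutoff_def divide_inverse by (intro continuous_intros)

lemma continuous_on_cutoff_grad [continuous_intros]:
  "continuous_on S f \<Longrightarrow> continuous_on S (\<lambda>x. cutoff_grad R (f x))"
  unfolding cutoff_grad_def divide_inverse by (intro continuous_intros)

lemma cutoff_bounds: "0 \<le> cutoff R z" "cutoff R z \<le> 1"
proof -
  have "max 0 (1 - (z \<bullet> z) / R\<^sup>2) \<le> 1" by simp
  thus "cutoff R z \<le> 1" unfolding cutoff_def by (intro power_le_one) auto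
qed (simp add: cutoff_def)

lemma cutoff_eq_0: "R > 0 \<Longrightarrow> norm z > R \<Longrightarrow> cutoff R z = 0" "R > 0 \<Longrightarrow> norm z > R \<Longrightarrow> cutoff_grad R z = 0"
proof -
  assume "R > 0" "norm z > R"
  hence "R\<^sup>2 \<le> z \<bullet> z" by (simp add: power2_norm_eq_inner[symmetric] power_mono)
  hence "(z \<bullet> z) / R\<^sup>2 \<ge> 1" using \<open>R > 0\<close> by simp
  thus "cutoff R z = 0" "cutoff_grad R z = 0" by (simp_all add: cutoff_def cutoff_grad_def max_def)
qed

lemma norm_cutoff_grad_le:
  assumes "R > 0"
  shows "norm (cutoff_grad R z) \<le> 4 / R"
proof (cases "norm z > R")
  case True
  thus ?thesis using cutoff_eq_0(2)[OF assms True] assms by simp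
next
  case False
  have "norm (cutoff_grad R z) = 4 / R\<^sup>2 * max 0 (1 - (z \<bullet> z) / R\<^sup>2) * norm z"
    by (simp add: cutoff_grad_def abs_mult)
  also have "\<dots> \<le> 4 / R\<^sup>2 * 1 * R"
    using False assms by (intro mult_mono) auto
  finally show ?thesis using assms by (simp add: power2_eq_square)
qed

text \<open>Passes to gauge integrals over a fixed compact box, the setting in which the Leibniz
  rule and continuity in a parameter are applied.\<close>

lemma integral_cbox_eq_lborel:
  fixes F :: "'a::euclidean_space \<Rightarrow> real"
  assumes "continuous_on UNIV F" and supp: "\<And>x. norm x > R \<Longrightarrow> F x = 0"
  shows "integral (cbox (- (R *\<^sub>R One)) (R *\<^sub>R One)) F = (LINT x|lborel. F x)"
proof -
  let ?Q = "cbox (- (R *\<^sub>R One)) (R *\<^sub>R One) :: 'a set"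
  have "x \<in> ?Q" if "norm x \<le> R" for x
    using that Basis_le_norm[of _ x] by (force simp: mem_box abs_le_iff)
  hence "(\<lambda>x. if x \<in> ?Q then F x else 0) = F"
    using supp by (force simp: not_less)
  hence "integral ?Q F = integral UNIV F" using integral_restrict_UNIV[of ?Q F] by simp
  also have "\<dots> = (LINT x|lborel. F x)"
    by (intro integral_lborel integrable_compact_support[OF assms])
  finally show ?thesis .
qed

text \<open>Instantiated for \<open>h\<close> and for its exponential transform. Only
  \<open>u\<close>, its gradient and the source \<open>f\<close> are assumed bounded; the Hessian
  and the time derivative are merely continuous at positive times.\<close>

locale heat_source =
  fixes \<nu> B Bg Bf :: real
    and u ut f :: "real \<Rightarrow> real ^ 'n \<Rightarrow> real" and g :: "real \<Rightarrow> real ^ 'n \<Rightarrow> real ^ 'n"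
    and H :: "real \<Rightarrow> real ^ 'n \<Rightarrow> real ^ 'n ^ 'n"
  assumes nu: "\<nu> > 0"
    and cont_u: "continuous_on ({0..} \<times> UNIV) (\<lambda>(t, x). u t x)"
    and bdd_u: "\<And>t x. t \<ge> 0 \<Longrightarrow> \<bar>u t x\<bar> \<le> B"
    and ut: "\<And>t x. t > 0 \<Longrightarrow> ((\<lambda>s. u s x) has_real_derivative ut t x) (at t)"
    and gu: "\<And>t x. t > 0 \<Longrightarrow> (u t has_derivative (\<lambda>v. g t x \<bullet> v)) (at x)"
    and Hu: "\<And>t x. t > 0 \<Longrightarrow> (g t has_derivative (\<lambda>v. H t x *v v)) (at x)"
    and cont_ut: "continuous_on ({0<..} \<times> UNIV) (\<lambda>(t, x). ut t x)"
    and cont_g: "continuous_on ({0<..} \<times> UNIV) (\<lambda>(t, x). g t x)"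
    and cont_H: "continuous_on ({0<..} \<times> UNIV) (\<lambda>(t, x). H t x)"
    and bdd_g: "\<And>t x. t > 0 \<Longrightarrow> norm (g t x) \<le> Bg"
    and f: "\<And>t x. t > 0 \<Longrightarrow> ut t x = \<nu> * trace (H t x) + f t x"
    and bdd_f: "\<And>t x. t > 0 \<Longrightarrow> \<bar>f t x\<bar> \<le> Bf"
begin

lemma cont_trace: "continuous_on ({0<..} \<times> UNIV) (\<lambda>(t, x). trace (H t x))"
  unfolding trace_def case_prod_beta
  by (intro continuous_intros cont_H[unfolded case_prod_beta])

lemma cont_f: "continuous_on ({0<..} \<times> UNIV) (\<lambda>(t, x). f t x)"
proof -
  have "continuous_on ({0<..} \<times> UNIV) (\<lambda>p. ut (fst p) (snd p) - \<nu> * trace (H (fst p) (snd p)))"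
    by (intro continuous_intros cont_ut[unfolded case_prod_beta] cont_trace[unfolded case_prod_beta])
  also have "?this \<longleftrightarrow> ?thesis"
    by (rule continuous_on_cong) (auto simp: f)
  finally show ?thesis .
qed

lemma cont_u_pos: "continuous_on ({0<..} \<times> UNIV) (\<lambda>(t, x). u t x)"
  by (rule continuous_on_subset[OF cont_u]) auto

lemma slice_cont:
  fixes x :: "real ^ 'n"
  assumes "continuous_on ({0<..} \<times> UNIV) (\<lambda>(t, x). w t x)" "r > 0"
  shows "continuous_on UNIV (\<lambda>z. w r (x + c *\<^sub>R z))"
proof -
  have "continuous_on UNIV (\<lambda>z. (r, x + c *\<^sub>R z))" by (intro continuous_intros)
  moreover have "(\<lambda>z. (r, x + c *\<^sub>R z)) ` UNIV \<subseteq> {0<..} \<times> UNIV" using assms(2) by auto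
  ultimately show ?thesis using continuous_on_compose2[OF assms(1), of UNIV "\<lambda>z. (r, x + c *\<^sub>R z)"] by simp
qed

lemma path_cont:
  fixes x :: "real ^ 'n"
  assumes "continuous_on ({0<..} \<times> UNIV) (\<lambda>(t, x). w t x)"
  shows "continuous_on ({0<..} \<times> UNIV) (\<lambda>(r, z). w r (x + sqrt (2 * \<nu> * (t - r)) *\<^sub>R z))"
proof -
  have "continuous_on ({0<..} \<times> UNIV) (\<lambda>p. (fst p, x + sqrt (2 * \<nu> * (t - fst p)) *\<^sub>R snd p))"
    by (intro continuous_intros)
  moreover have "(\<lambda>p. (fst p, x + sqrt (2 * \<nu> * (t - fst p)) *\<^sub>R snd p)) ` ({0<..} \<times> UNIV) \<subseteq> {0<..} \<times> UNIV"
    by auto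
  ultimately show ?thesis
    using continuous_on_compose2[OF assms, of "{0<..} \<times> UNIV" "\<lambda>p. (fst p, x + sqrt (2 * \<nu> * (t - fst p)) *\<^sub>R snd p)"]
    by (simp add: case_prod_beta)
qed

text \<open>Joint differentiability is needed because Duhamel's formula follows \<open>u\<close>
  along curves on which time and space vary together.\<close>

lemma has_derivative_time_space:
  assumes "r > 0"
  shows "((\<lambda>(r, y). u r y) has_derivative (\<lambda>(h, v). ut r y * h + g r y \<bullet> v)) (at (r, y))"
proof -
  have "((\<lambda>(r, y). u r y) has_derivative (\<lambda>(h, v). ut r y * h + blinfun_inner_right (g r y) v))
      (at (r, y) within {0<..} \<times> UNIV)"
  proof (rule has_derivative_partialsI)
    show "((\<lambda>r. u r y) has_derivative (*) (ut r y)) (at r within {0<..})"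
      using ut[OF assms] by (auto simp: has_field_derivative_def intro: has_derivative_at_withinI)
    show "(u r has_derivative blinfun_apply (blinfun_inner_right (g r y))) (at y within UNIV)"
      if "r \<in> {0<..}" for r y using gu that by simp
    have "continuous_on ({0<..} \<times> UNIV) (\<lambda>(r, y). blinfun_inner_right (g r y))"
      unfolding case_prod_beta
      by (intro continuous_intros bounded_linear.continuous_on[OF bounded_linear_blinfun_inner_right]
          cont_g[unfolded case_prod_beta])
    thus "continuous (at (r, y) within {0<..} \<times> UNIV) (\<lambda>(r, y). blinfun_inner_right (g r y))"
      using assms by (simp add: continuous_on_eq_continuous_within)
  qed auto
  also have "at (r, y) within {0<..} \<times> UNIV = at (r, y)"
    using assms by (intro at_within_open open_Times) auto
  finally show ?thesis by simp
qed

lemma deriv_path: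
  assumes "0 < r" "r < t"
  shows "((\<lambda>r. u r (x + sqrt (2 * \<nu> * (t - r)) *\<^sub>R z)) has_real_derivative
     ut r (x + sqrt (2 * \<nu> * (t - r)) *\<^sub>R z)
       - \<nu> / sqrt (2 * \<nu> * (t - r)) * (g r (x + sqrt (2 * \<nu> * (t - r)) *\<^sub>R z) \<bullet> z)) (at r)"
proof -
  let ?a = "\<lambda>r. sqrt (2 * \<nu> * (t - r))"
  have a: "(?a has_real_derivative - (\<nu> / ?a r)) (at r)"
    using assms nu by (auto intro!: derivative_eq_intros simp: field_simps)
  have 1: "((\<lambda>r. (r, x + ?a r *\<^sub>R z)) has_derivative (\<lambda>h. (h, (- (\<nu> / ?a r) * h) *\<^sub>R z))) (at r)"
  proof -
    have "((\<lambda>r. x + ?a r *\<^sub>R z) has_derivative (\<lambda>h. (- (\<nu> / ?a r) * h) *\<^sub>R z)) (at r)"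
      using has_derivative_add[OF has_derivative_const[of x]
          has_derivative_scaleR_left[OF a[unfolded has_field_derivative_def], of z]] by simp
    from has_derivative_Pair[OF has_derivative_ident this] show ?thesis .
  qed
  have "((\<lambda>r. u r (x + ?a r *\<^sub>R z)) has_derivative
     (\<lambda>h. ut r (x + ?a r *\<^sub>R z) * h + g r (x + ?a r *\<^sub>R z) \<bullet> ((- (\<nu> / ?a r) * h) *\<^sub>R z))) (at r)"
    using has_derivative_compose[OF 1, OF has_derivative_time_space[OF assms(1)]] by simp
  thus ?thesis unfolding has_field_derivative_def
    by (rule has_derivative_eq_rhs) (auto simp: fun_eq_iff algebra_simps)
qed

text \<open>The heat flow for the remaining time \<open>t - r\<close>, applied to \<open>w r\<close>
  and truncated at radius \<open>R\<close>. For \<open>w = u\<close> it interpolates, up to the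
  truncation, between the heat flow of \<open>u 0\<close> at \<open>r = 0\<close> and
  \<open>u t x\<close> at \<open>r = t\<close>.\<close>

definition smeared :: "real ^ 'n \<Rightarrow> real \<Rightarrow> real \<Rightarrow> (real \<Rightarrow> real ^ 'n \<Rightarrow> real) \<Rightarrow> real \<Rightarrow> real" where
  "smeared x t R w r = (LINT z|lborel. gauss z * cutoff R z * w r (x + sqrt (2 * \<nu> * (t - r)) *\<^sub>R z))"

text \<open>The integrated derivative in direction i of \<open>gauss z * cutoff R z\<close> times
  the i-th component of the gradient is 0; summed over i, the second derivatives assemble to the
  trace.\<close>

lemma divergence:
  assumes "0 < r" "0 < R"
  shows "(LINT z|lborel. (gauss z *\<^sub>R cutoff_grad R z - (gauss z * cutoff R z) *\<^sub>R z) \<bullet> g r (x + c *\<^sub>R z)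
      + gauss z * cutoff R z * (c * trace (H r (x + c *\<^sub>R z)))) = 0"
proof -
  let ?\<psi> = "\<lambda>z::real^'n. gauss z * cutoff R z"
  let ?d\<psi> = "\<lambda>z::real^'n. gauss z *\<^sub>R cutoff_grad R z - (gauss z * cutoff R z) *\<^sub>R z"
  let ?D = "\<lambda>i z v. (?d\<psi> z \<bullet> v) * g r (x + c *\<^sub>R z) $ i + ?\<psi> z * (H r (x + c *\<^sub>R z) *v (c *\<^sub>R v)) $ i"
  have cg: "continuous_on UNIV (\<lambda>z. g r (x + c *\<^sub>R z))" by (rule slice_cont[OF cont_g assms(1)])
  have cH: "continuous_on UNIV (\<lambda>z. H r (x + c *\<^sub>R z))" by (rule slice_cont[OF cont_H assms(1)])
  have der: "((\<lambda>z. ?\<psi> z * g r (x + c *\<^sub>R z) $ i) has_derivative ?D i z) (at z)" for i z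
  proof -
    have 1: "((\<lambda>z. x + c *\<^sub>R z) has_derivative (\<lambda>v. c *\<^sub>R v)) (at z)"
      by (auto intro!: derivative_eq_intros)
    have 2: "((\<lambda>z. g r (x + c *\<^sub>R z)) has_derivative (\<lambda>v. H r (x + c *\<^sub>R z) *v (c *\<^sub>R v))) (at z)"
      using has_derivative_compose[OF 1, OF Hu[OF assms(1)]] by simp
    have 3: "((\<lambda>z. g r (x + c *\<^sub>R z) $ i) has_derivative (\<lambda>v. (H r (x + c *\<^sub>R z) *v (c *\<^sub>R v)) $ i)) (at z)"
      by (rule bounded_linear.has_derivative[OF bounded_linear_vec_nth 2])
    have 4: "(?\<psi> has_derivative (\<lambda>v. ?d\<psi> z \<bullet> v)) (at z)"
      by (rule has_derivative_eq_rhs[OF has_derivative_mult[OF has_derivative_gauss has_derivative_cutoff]])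
         (auto simp: fun_eq_iff inner_diff_left algebra_simps)
    show ?thesis
      by (rule has_derivative_eq_rhs[OF has_derivative_mult[OF 4 3]]) (auto simp: fun_eq_iff algebra_simps)
  qed
  have supp: "?\<psi> z * y = 0" "?d\<psi> z = 0" if "norm z > R" for z y
    using cutoff_eq_0[OF assms(2) that] by simp_all
  have cD: "continuous_on UNIV (\<lambda>z. ?D i z (axis i 1))" for i
    unfolding matrix_vector_mult_def vec_lambda_beta by (intro continuous_intros cg cH)
  have int: "integrable lborel (\<lambda>z. ?D i z (axis i 1))" for i
    by (rule integrable_compact_support[OF cD, of R]) (use supp in auto)
  have "(\<Sum>i\<in>UNIV. (LINT z|lborel. ?D i z (axis i 1))) = 0"
  proof (rule sum.neutral, rule ballI)
    fix i :: 'n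
    show "(LINT z|lborel. ?D i z (axis i 1)) = 0"
      by (rule integral_directional_derivative_eq_0[OF der cD, of R]) (use supp in auto)
  qed
  hence "(LINT z|lborel. (\<Sum>i\<in>UNIV. ?D i z (axis i 1))) = 0"
    using int by (subst Bochner_Integration.integral_sum) auto
  moreover have "(\<Sum>i\<in>UNIV. ?D i z (axis i 1)) =
     ?d\<psi> z \<bullet> g r (x + c *\<^sub>R z) + ?\<psi> z * (c * trace (H r (x + c *\<^sub>R z)))" for z
  proof -
    have "(\<Sum>i\<in>UNIV. ?D i z (axis i 1)) = (\<Sum>i\<in>UNIV. ?d\<psi> z $ i * g r (x + c *\<^sub>R z) $ i)
       + ?\<psi> z * (c * (\<Sum>i\<in>UNIV. (H r (x + c *\<^sub>R z) *v axis i 1) $ i))"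
      by (simp add: sum.distrib inner_axis matrix_vector_mult_scaleR sum_distrib_left mult_ac)
    also have "(\<Sum>i\<in>UNIV. ?d\<psi> z $ i * g r (x + c *\<^sub>R z) $ i) = ?d\<psi> z \<bullet> g r (x + c *\<^sub>R z)"
      by (simp add: inner_vec_def)
    also have "(\<Sum>i\<in>UNIV. (H r (x + c *\<^sub>R z) *v axis i 1) $ i) = trace (H r (x + c *\<^sub>R z))"
      by (simp add: trace_def matrix_vector_mul_component inner_axis)
    finally show ?thesis .
  qed
  ultimately show ?thesis by simp
qed

text \<open>Moving the point at which \<open>u\<close> is evaluated produces a first-order term in
  \<open>g \<bullet> z\<close>. By \<open>divergence\<close> it cancels \<nu> times the trace of the
  Hessian, and only the source and a term with \<open>cutoff_grad\<close> remain.\<close>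

lemma smeared_derivative:
  assumes r: "0 < r" "r < t" and R: "0 < R"
  shows "\<exists>D. (smeared x t R u has_real_derivative D) (at r) \<and>
     \<bar>D - smeared x t R f r\<bar> \<le> \<nu> / sqrt (2 * \<nu> * (t - r)) * (4 / R * Bg)"
proof -
  let ?a = "\<lambda>r. sqrt (2 * \<nu> * (t - r))"
  let ?\<psi> = "\<lambda>z::real^'n. gauss z * cutoff R z"
  let ?Q = "cbox (- (R *\<^sub>R One)) (R *\<^sub>R One) :: (real^'n) set"
  let ?fx = "\<lambda>r z. ?\<psi> z * (ut r (x + ?a r *\<^sub>R z) - \<nu> / ?a r * (g r (x + ?a r *\<^sub>R z) \<bullet> z))"
  have a0: "?a r > 0" using r nu by simp
  have cu: "continuous_on UNIV (\<lambda>z. ?\<psi> z * u q (x + ?a q *\<^sub>R z))" if "q > 0" for q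
  proof -
    note c = slice_cont[OF cont_u_pos that, of x "?a q"]
    show ?thesis by (rule continuous_on_mult[OF _ c]) (intro continuous_intros)
  qed
  note cf = slice_cont[OF cont_f r(1), of x "?a r"] and cg = slice_cont[OF cont_g r(1), of x "?a r"]
    and cut = slice_cont[OF cont_ut r(1), of x "?a r"] and ctr = slice_cont[OF cont_trace r(1), of x "?a r"]
  have leib: "((\<lambda>q. integral ?Q (\<lambda>z. ?\<psi> z * u q (x + ?a q *\<^sub>R z))) has_real_derivative integral ?Q (?fx r)) (at r within {0<..<t})"
  proof (rule leibniz_rule_field_derivative)
    show "((\<lambda>q. ?\<psi> z * u q (x + ?a q *\<^sub>R z)) has_real_derivative ?fx q z) (at q within {0<..<t})"
      if "q \<in> {0<..<t}" for q z
      by (rule has_field_derivative_at_within[OF DERIV_cmult[OF deriv_path]]) (use that in auto)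
    show "(\<lambda>z. ?\<psi> z * u q (x + ?a q *\<^sub>R z)) integrable_on ?Q" if "q \<in> {0<..<t}" for q
      by (intro integrable_continuous continuous_on_subset[OF cu]) (use that in auto)
    show "continuous_on ({0<..<t} \<times> ?Q) (\<lambda>(q, z). ?fx q z)"
    proof -
      have sub: "{0<..<t} \<times> ?Q \<subseteq> {0<..} \<times> UNIV" by auto
      note c1 = continuous_on_subset[OF path_cont[OF cont_ut, of x t, unfolded case_prod_beta] sub]
      note c2 = continuous_on_subset[OF path_cont[OF cont_g, of x t, unfolded case_prod_beta] sub]
      show ?thesis unfolding case_prod_beta using nu by (intro continuous_intros c1 c2) auto
    qed
  qed (use r in auto)
  have "(smeared x t R u has_real_derivative integral ?Q (?fx r)) (at r within {0<..<t})"
  proof (rule has_field_derivative_transform_within[OF leib zero_less_one])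
    show "r \<in> {0<..<t}" using r by simp
    fix q assume "q \<in> {0<..<t}"
    thus "integral ?Q (\<lambda>z. ?\<psi> z * u q (x + ?a q *\<^sub>R z)) = smeared x t R u q"
      unfolding smeared_def by (intro integral_cbox_eq_lborel cu) (auto simp: cutoff_eq_0[OF R])
  qed
  hence D: "(smeared x t R u has_real_derivative integral ?Q (?fx r)) (at r)"
    using r by (simp add: at_within_open[of r "{0<..<t}"])
  have cfx: "continuous_on UNIV (?fx r)"
    by (intro continuous_intros cut cg)
  have eq1: "integral ?Q (?fx r) = (LINT z|lborel. ?fx r z)"
    by (intro integral_cbox_eq_lborel cfx) (auto simp: cutoff_eq_0[OF R])
  let ?A = "\<lambda>z. ?\<psi> z * f r (x + ?a r *\<^sub>R z)"
  let ?E = "\<lambda>z. gauss z * (cutoff_grad R z \<bullet> g r (x + ?a r *\<^sub>R z))"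
  let ?Div = "\<lambda>z. (gauss z *\<^sub>R cutoff_grad R z - (gauss z * cutoff R z) *\<^sub>R z) \<bullet> g r (x + ?a r *\<^sub>R z)
      + gauss z * cutoff R z * (?a r * trace (H r (x + ?a r *\<^sub>R z)))"
  \<comment> \<open>\<open>?A\<close> is the source, \<open>?E\<close> the error of the cutoff, and
    \<open>?Div\<close> the divergence, whose integral is 0. The Hessian occurs in
    \<open>?Div\<close> only.\<close>
  have "?fx r z = ?A z - \<nu> / ?a r * ?E z + \<nu> / ?a r * ?Div z" for z
  proof -
    have alg: "p * ((n * T + F) - n / s * G) = p * F - n / s * E + n / s * (E - p * G + p * (s * T))"
      if "s > 0" for p n T F s G E :: real
      using that by (simp add: field_simps)
    have "?Div z = ?E z - ?\<psi> z * (g r (x + ?a r *\<^sub>R z) \<bullet> z)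
        + ?\<psi> z * (?a r * trace (H r (x + ?a r *\<^sub>R z)))"
      by (simp add: inner_diff_left inner_commute[of z])
    thus ?thesis unfolding f[OF r(1)] by (simp only: alg[OF a0])
  qed
  moreover have iA: "integrable lborel ?A"
    by (rule integrable_compact_support[of _ R]) (intro continuous_intros cf, simp add: cutoff_eq_0[OF R])
  moreover have iE: "integrable lborel ?E"
    by (rule integrable_compact_support[of _ R]) (intro continuous_intros cg, simp add: cutoff_eq_0[OF R])
  moreover have "integrable lborel ?Div"
    by (rule integrable_compact_support[of _ R])
       (intro continuous_intros cg ctr, simp add: cutoff_eq_0[OF R])
  ultimately have eq2: "(LINT z|lborel. ?fx r z) = smeared x t R f r - \<nu> / ?a r * (LINT z|lborel. ?E z)"
    using divergence[OF r(1) R, of x "?a r"] by (simp add: smeared_def)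
  have "\<bar>LINT z|lborel. ?E z\<bar> \<le> (LINT z|lborel. 4 / R * Bg * gauss (z::real^'n))"
  proof (rule order_trans[OF integral_abs_bound], rule integral_mono)
    show "\<bar>?E z\<bar> \<le> 4 / R * Bg * gauss z" for z
    proof -
      have "\<bar>cutoff_grad R z \<bullet> g r (x + ?a r *\<^sub>R z)\<bar> \<le> norm (cutoff_grad R z) * norm (g r (x + ?a r *\<^sub>R z))"
        by (rule Cauchy_Schwarz_ineq2)
      also have "\<dots> \<le> 4 / R * Bg"
        using norm_cutoff_grad_le[OF R] bdd_g[OF r(1)] R by (intro mult_mono) auto
      finally have "gauss z * \<bar>cutoff_grad R z \<bullet> g r (x + ?a r *\<^sub>R z)\<bar> \<le> gauss z * (4 / R * Bg)"
        by (intro mult_left_mono) auto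
      thus ?thesis by (simp add: abs_mult mult.commute)
    qed
  qed (use iE in auto)
  hence "\<bar>LINT z|lborel. ?E z\<bar> \<le> 4 / R * Bg" by (simp add: integral_gauss)
  hence "\<nu> / ?a r * \<bar>LINT z|lborel. ?E z\<bar> \<le> \<nu> / ?a r * (4 / R * Bg)"
    using nu a0 by (intro mult_left_mono) auto
  thus ?thesis using D a0 nu unfolding eq1 eq2 by (intro exI conjI) (auto simp: abs_mult)
qed

lemma continuous_on_smeared:
  assumes "0 < s" "t' < t" "0 < R"
  shows "continuous_on {s..t'} (smeared x t R f)"
proof -
  let ?a = "\<lambda>r. sqrt (2 * \<nu> * (t - r))"
  let ?Q = "cbox (- (R *\<^sub>R One)) (R *\<^sub>R One) :: (real^'n) set"
  have sub: "{s..t'} \<times> ?Q \<subseteq> {0<..} \<times> UNIV" using assms by auto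
  note c = continuous_on_subset[OF path_cont[OF cont_f, of x t, unfolded case_prod_beta] sub]
  have "continuous_on {s..t'} (\<lambda>r. integral ?Q (\<lambda>z. gauss z * cutoff R z * f r (x + ?a r *\<^sub>R z)))"
    by (rule integral_continuous_on_param) (unfold case_prod_beta, intro continuous_intros c)
  also have "?this \<longleftrightarrow> ?thesis"
  proof (rule continuous_on_cong[OF refl])
    fix r assume "r \<in> {s..t'}"
    hence r: "r > 0" using assms by simp
    note cf = slice_cont[OF cont_f r, of x "?a r"]
    show "integral ?Q (\<lambda>z. gauss z * cutoff R z * f r (x + ?a r *\<^sub>R z)) = smeared x t R f r"
      unfolding smeared_def
      by (rule integral_cbox_eq_lborel) (intro continuous_intros cf, simp add: cutoff_eq_0[OF assms(3)])
  qed
  finally show ?thesis .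
qed

text \<open>The error in \<open>smeared_derivative\<close> grows like the inverse root of
  \<open>t - r\<close>, so on the interval it is largest at \<open>t'\<close>; hence the stop before
  \<open>t\<close>.\<close>

lemma smeared_increment:
  assumes st: "0 < s" "s \<le> t'" "t' < t" and R: "0 < R"
  shows "\<bar>smeared x t R u t' - smeared x t R u s - (LINT r|lborel. indicator {s..t'} r * smeared x t R f r)\<bar>
     \<le> \<nu> / sqrt (2 * \<nu> * (t - t')) * (4 / R * Bg) * (t' - s)"
proof -
  have Bg0: "Bg \<ge> 0" using bdd_g[OF st(1)] norm_ge_zero order_trans by blast
  have "\<forall>r. \<exists>D. 0 < r \<longrightarrow> r < t \<longrightarrow> (smeared x t R u has_real_derivative D) (at r) \<and>
     \<bar>D - smeared x t R f r\<bar> \<le> \<nu> / sqrt (2 * \<nu> * (t - r)) * (4 / R * Bg)"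
    using smeared_derivative[OF _ _ R] by blast
  then obtain D where D: "\<And>r. 0 < r \<Longrightarrow> r < t \<Longrightarrow> (smeared x t R u has_real_derivative D r) (at r)"
    "\<And>r. 0 < r \<Longrightarrow> r < t \<Longrightarrow> \<bar>D r - smeared x t R f r\<bar> \<le> \<nu> / sqrt (2 * \<nu> * (t - r)) * (4 / R * Bg)"
    by metis
  have 1: "(D has_integral (smeared x t R u t' - smeared x t R u s)) {s..t'}"
  proof (rule fundamental_theorem_of_calculus[OF st(2)])
    fix r assume "r \<in> {s..t'}"
    thus "(smeared x t R u has_vector_derivative D r) (at r within {s..t'})"
      using D(1)[of r] st by (auto simp: has_real_derivative_iff_has_vector_derivative intro: has_vector_derivative_at_within)
  qed
  have cJ: "continuous_on {s..t'} (smeared x t R f)"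
    by (rule continuous_on_smeared[OF st(1,3) R])
  have 2: "(smeared x t R f has_integral integral {s..t'} (smeared x t R f)) {s..t'}"
    by (intro integrable_integral integrable_continuous_interval cJ)
  have "set_integrable lborel {s..t'} (smeared x t R f)"
    unfolding set_integrable_def by (rule borel_integrable_compact[OF compact_Icc cJ])
  from set_borel_integral_eq_integral(2)[OF this]
  have 3: "integral {s..t'} (smeared x t R f) = (LINT r|lborel. indicator {s..t'} r * smeared x t R f r)"
    by (simp add: set_lebesgue_integral_def)
  let ?e = "\<nu> / sqrt (2 * \<nu> * (t - t')) * (4 / R * Bg)"
  have "norm (smeared x t R u t' - smeared x t R u s - integral {s..t'} (smeared x t R f))
     \<le> ?e * measure lborel (cbox s t')"
  proof (rule has_integral_bound)
    show "0 \<le> ?e" using nu Bg0 R st by simp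
    show "((\<lambda>r. D r - smeared x t R f r) has_integral
        (smeared x t R u t' - smeared x t R u s - integral {s..t'} (smeared x t R f))) (cbox s t')"
      unfolding interval_cbox[symmetric] by (rule has_integral_diff[OF 1 2])
    fix r assume r: "r \<in> cbox s t'"
    have "\<nu> / sqrt (2 * \<nu> * (t - r)) \<le> \<nu> / sqrt (2 * \<nu> * (t - t'))"
      using r st nu by (intro divide_left_mono real_sqrt_le_mono mult_left_mono mult_pos_pos) auto
    hence "\<nu> / sqrt (2 * \<nu> * (t - r)) * (4 / R * Bg) \<le> ?e"
      using R Bg0 by (intro mult_right_mono) auto
    thus "norm (D r - smeared x t R f r) \<le> ?e" using D(2)[of r] r st by auto
  qed
  thus ?thesis using st unfolding 3 by simp
qed

lemma measurable_slice:
  assumes "continuous_on ({0<..} \<times> UNIV) (\<lambda>(t, x). w t x)" "r > 0"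
  shows "(\<lambda>z::real^'n. w r (x + c *\<^sub>R z)) \<in> borel_measurable borel"
  by (rule borel_measurable_continuous_onI[OF slice_cont[OF assms]])

lemma cutoff_LIMSEQ: "(\<lambda>k. cutoff ((real k + 3)\<^sup>2) z) \<longlonglongrightarrow> 1"
proof -
  have "(\<lambda>k. (z \<bullet> z) / ((real k + 3)\<^sup>2)\<^sup>2) \<longlonglongrightarrow> 0" by real_asymp
  hence "(\<lambda>k. (max 0 (1 - (z \<bullet> z) / ((real k + 3)\<^sup>2)\<^sup>2))\<^sup>2) \<longlonglongrightarrow> (max 0 (1 - 0))\<^sup>2"
    by (intro tendsto_intros)
  thus ?thesis by (simp add: cutoff_def)
qed

text \<open>The time \<open>r k\<close> may vary with \<open>k\<close>. This serves the two
  endpoints, where it tends to 0 or to \<open>t\<close>, as well as a fixed time inside the Duhamel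
  integral.\<close>

lemma smeared_LIMSEQ:
  assumes w: "\<And>k z. \<bar>w (r k) (x + sqrt (2 * \<nu> * (t - r k)) *\<^sub>R z)\<bar> \<le> M"
    and meas [measurable]: "\<And>k. (\<lambda>z::real^'n. w (r k) (x + sqrt (2 * \<nu> * (t - r k)) *\<^sub>R z)) \<in> borel_measurable borel"
    and lim: "\<And>z. (\<lambda>k. w (r k) (x + sqrt (2 * \<nu> * (t - r k)) *\<^sub>R z)) \<longlonglongrightarrow> l z"
  shows "(\<lambda>k. smeared x t ((real k + 3)\<^sup>2) w (r k)) \<longlonglongrightarrow> (LINT z|lborel. gauss z * l z)"
  unfolding smeared_def
proof (rule integral_dominated_convergence[where w = "\<lambda>z. gauss z * M"])
  have [measurable]: "l \<in> borel_measurable borel"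
    by (rule borel_measurable_LIMSEQ_metric[OF meas lim])
  show "(\<lambda>z. gauss z * l z) \<in> borel_measurable lborel" by measurable
  have [measurable]: "cutoff R \<in> borel_measurable borel" for R
    by (intro borel_measurable_continuous_onI continuous_intros)
  show "(\<lambda>z. gauss z * cutoff ((real k + 3)\<^sup>2) z * w (r k) (x + sqrt (2 * \<nu> * (t - r k)) *\<^sub>R z)) \<in> borel_measurable lborel" for k
    by measurable
  show "AE z in lborel. (\<lambda>k. gauss z * cutoff ((real k + 3)\<^sup>2) z * w (r k) (x + sqrt (2 * \<nu> * (t - r k)) *\<^sub>R z)) \<longlonglongrightarrow> gauss z * l z"
  proof (rule AE_I2)
    fix z
    have "(\<lambda>k. gauss z * cutoff ((real k + 3)\<^sup>2) z * w (r k) (x + sqrt (2 * \<nu> * (t - r k)) *\<^sub>R z)) \<longlonglongrightarrow> gauss z * 1 * l z"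
      by (intro tendsto_intros lim cutoff_LIMSEQ)
    thus "(\<lambda>k. gauss z * cutoff ((real k + 3)\<^sup>2) z * w (r k) (x + sqrt (2 * \<nu> * (t - r k)) *\<^sub>R z)) \<longlonglongrightarrow> gauss z * l z"
      by simp
  qed
  show "AE z in lborel. norm (gauss z * cutoff ((real k + 3)\<^sup>2) z * w (r k) (x + sqrt (2 * \<nu> * (t - r k)) *\<^sub>R z)) \<le> gauss z * M" for k
  proof (rule AE_I2)
    fix z
    have "cutoff ((real k + 3)\<^sup>2) z * \<bar>w (r k) (x + sqrt (2 * \<nu> * (t - r k)) *\<^sub>R z)\<bar> \<le> 1 * M"
      using w cutoff_bounds by (intro mult_mono) auto
    thus "norm (gauss z * cutoff ((real k + 3)\<^sup>2) z * w (r k) (x + sqrt (2 * \<nu> * (t - r k)) *\<^sub>R z)) \<le> gauss z * M"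
      using cutoff_bounds(1)[of "(real k + 3)\<^sup>2" z] by (simp add: abs_mult mult.assoc mult_left_mono)
  qed
qed simp

lemma duhamel:
  assumes t: "0 < t"
  shows "u t x = (LINT z|lborel. gauss z * u 0 (x + sqrt (2 * \<nu> * t) *\<^sub>R z))
    + (LINT r|lborel. indicator {0<..<t} r * (LINT z|lborel. gauss z * f r (x + sqrt (2 * \<nu> * (t - r)) *\<^sub>R z)))"
proof -
  \<comment> \<open>Starting at 3 keeps \<open>s k \<le> t / 3\<close> below \<open>t' k\<close>.
    The radius \<open>(n k)\<^sup>2\<close> outweighs the factor of order \<open>sqrt (n k)\<close>
    in the error at \<open>t' k\<close>.\<close>
  define n where "n k = real k + 3" for k :: nat
  define s where "s k = t / n k" for k
  define t' where "t' k = t - t / n k" for k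
  define R where "R k = (n k)\<^sup>2" for k
  have n: "n k \<ge> 3" for k by (simp add: n_def)
  have s0: "0 < s k" for k using n[of k] t by (simp add: s_def)
  have sle: "s k \<le> t / 3" for k using n[of k] t by (simp add: s_def field_simps)
  have st: "0 < s k" "s k \<le> t' k" "t' k < t" "0 < R k" "0 < t' k" for k
    using s0[of k] sle[of k] n[of k] t by (auto simp: t'_def s_def[symmetric] R_def)
  have s_lim: "s \<longlonglongrightarrow> 0" unfolding s_def n_def by real_asymp
  have t'_lim: "t' \<longlonglongrightarrow> t" unfolding t'_def n_def by real_asymp
  have Bg0: "Bg \<ge> 0" using bdd_g[OF t] norm_ge_zero order_trans by blast
  have lim_u: "(\<lambda>k. u (r k) (x + sqrt (2 * \<nu> * (t - r k)) *\<^sub>R z)) \<longlonglongrightarrow> u q (x + sqrt (2 * \<nu> * (t - q)) *\<^sub>R z)"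
    if "r \<longlonglongrightarrow> q" "\<And>k. r k > 0" "q \<ge> 0" for r q z
  proof -
    have "(\<lambda>k. (r k, x + sqrt (2 * \<nu> * (t - r k)) *\<^sub>R z)) \<longlonglongrightarrow> (q, x + sqrt (2 * \<nu> * (t - q)) *\<^sub>R z)"
      by (intro tendsto_intros that)
    from continuous_on_tendsto_compose[OF cont_u this] show ?thesis
      using that by (auto simp: less_imp_le)
  qed
  have A: "(\<lambda>k. smeared x t (R k) u (t' k)) \<longlonglongrightarrow> (LINT z|lborel. gauss z * u t (x + sqrt (2 * \<nu> * (t - t)) *\<^sub>R z))"
    unfolding R_def n_def
    by (rule smeared_LIMSEQ[where M = B])
       (use lim_u[OF t'_lim] st t bdd_u measurable_slice[OF cont_u_pos] in \<open>auto simp: less_imp_le\<close>)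
  have Bl: "(\<lambda>k. smeared x t (R k) u (s k)) \<longlonglongrightarrow> (LINT z|lborel. gauss z * u 0 (x + sqrt (2 * \<nu> * (t - 0)) *\<^sub>R z))"
    unfolding R_def n_def
    by (rule smeared_LIMSEQ[where M = B])
       (use lim_u[OF s_lim] st t bdd_u measurable_slice[OF cont_u_pos] in \<open>auto simp: less_imp_le\<close>)
  have u_t: "(LINT z|lborel. gauss z * u t (x + sqrt (2 * \<nu> * (t - t)) *\<^sub>R z)) = u t x"
    by (simp add: integral_gauss)
  let ?J = "\<lambda>r. LINT z|lborel. gauss z * f r (x + sqrt (2 * \<nu> * (t - r)) *\<^sub>R z)"
  have Jk_bound: "\<bar>smeared x t (R k) f r\<bar> \<le> Bf" if "r > 0" for k r
  proof -
    note c = slice_cont[OF cont_f that, of x "sqrt (2 * \<nu> * (t - r))"]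
    have "\<bar>smeared x t (R k) f r\<bar> \<le> (LINT z|lborel. Bf * gauss (z::real^'n))"
      unfolding smeared_def
    proof (rule order_trans[OF integral_abs_bound], rule integral_mono)
      have "integrable lborel (\<lambda>z. gauss z * cutoff (R k) z * f r (x + sqrt (2 * \<nu> * (t - r)) *\<^sub>R z))"
        by (rule integrable_compact_support[of _ "R k"]) (intro continuous_intros c, simp add: cutoff_eq_0[OF st(4)])
      thus "integrable lborel (\<lambda>z. \<bar>gauss z * cutoff (R k) z * f r (x + sqrt (2 * \<nu> * (t - r)) *\<^sub>R z)\<bar>)" by simp
      fix z
      have "cutoff (R k) z * \<bar>f r (x + sqrt (2 * \<nu> * (t - r)) *\<^sub>R z)\<bar> \<le> 1 * Bf"
        using bdd_f[OF that] cutoff_bounds by (intro mult_mono) auto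
      hence "gauss z * (cutoff (R k) z * \<bar>f r (x + sqrt (2 * \<nu> * (t - r)) *\<^sub>R z)\<bar>) \<le> gauss z * (1 * Bf)"
        by (intro mult_left_mono) auto
      thus "\<bar>gauss z * cutoff (R k) z * f r (x + sqrt (2 * \<nu> * (t - r)) *\<^sub>R z)\<bar> \<le> Bf * gauss z"
        using cutoff_bounds(1)[of "R k" z] by (simp add: abs_mult mult_ac)
    qed simp
    thus ?thesis by (simp add: integral_gauss)
  qed
  have J_lim: "(\<lambda>k. smeared x t (R k) f r) \<longlonglongrightarrow> ?J r" if "r > 0" for r
    unfolding R_def n_def
    by (rule smeared_LIMSEQ[where M = Bf and r = "\<lambda>_. r"])
       (use that bdd_f measurable_slice[OF cont_f] in auto)
  have ind_lim: "(\<lambda>k. indicator {s k..t' k} r * smeared x t (R k) f r) \<longlonglongrightarrow> indicator {0<..<t} r * ?J r" for r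
  proof (cases "0 < r \<and> r < t")
    case True
    have "\<forall>\<^sub>F k in sequentially. s k < r" "\<forall>\<^sub>F k in sequentially. r < t' k"
      using True order_tendstoD[OF s_lim] order_tendstoD[OF t'_lim] by auto
    hence "\<forall>\<^sub>F k in sequentially. smeared x t (R k) f r = indicator {s k..t' k} r * smeared x t (R k) f r"
      by eventually_elim simp
    from Lim_transform_eventually[OF J_lim this] True
    have "(\<lambda>k. indicator {s k..t' k} r * smeared x t (R k) f r) \<longlonglongrightarrow> ?J r" by simp
    thus ?thesis using True by simp
  next
    case False
    hence "indicator {s k..t' k} r = (0::real)" for k using st(1)[of k] st(3)[of k] by (auto simp: indicator_def)
    moreover have "indicator {0<..<t} r = (0::real)" using False by (auto simp: indicator_def)
    ultimately show ?thesis by simp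
  qed
  have mJk: "(\<lambda>r. indicator {s k..t' k} r * smeared x t (R k) f r) \<in> borel_measurable lborel" for k
  proof -
    have "continuous_on {s k..t' k} (smeared x t (R k) f)" by (rule continuous_on_smeared[OF st(1,3,4)])
    from borel_measurable_continuous_on_indicator[OF _ this] show ?thesis by simp
  qed
  have C: "(\<lambda>k. LINT r|lborel. indicator {s k..t' k} r * smeared x t (R k) f r)
      \<longlonglongrightarrow> (LINT r|lborel. indicator {0<..<t} r * ?J r)"
  proof (rule integral_dominated_convergence[where w = "\<lambda>r. indicator {0..t} r *\<^sub>R Bf"])
    show "(\<lambda>r. indicator {0<..<t} r * ?J r) \<in> borel_measurable lborel"
      by (rule borel_measurable_LIMSEQ_metric[OF mJk ind_lim])
    show "integrable lborel (\<lambda>r. indicator {0..t} r *\<^sub>R Bf)" by (rule borel_integrable_compact) auto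
    show "AE r in lborel. (\<lambda>k. indicator {s k..t' k} r * smeared x t (R k) f r) \<longlonglongrightarrow> indicator {0<..<t} r * ?J r"
      by (intro AE_I2 ind_lim)
    show "AE r in lborel. norm (indicator {s k..t' k} r * smeared x t (R k) f r) \<le> indicator {0..t} r *\<^sub>R Bf" for k
    proof (intro AE_I2)
      fix r
      have "Bf \<ge> 0" using Jk_bound[OF t, of k] by linarith
      thus "norm (indicator {s k..t' k} r * smeared x t (R k) f r) \<le> indicator {0..t} r *\<^sub>R Bf"
        using Jk_bound[of r k] st(1)[of k] st(3)[of k] by (auto simp: indicator_def)
    qed
  qed (rule mJk)
  have err: "(\<lambda>k. smeared x t (R k) u (t' k) - smeared x t (R k) u (s k)
      - (LINT r|lborel. indicator {s k..t' k} r * smeared x t (R k) f r)) \<longlonglongrightarrow> 0"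
  proof (rule Lim_null_comparison)
    show "\<forall>\<^sub>F k in sequentially. norm (smeared x t (R k) u (t' k) - smeared x t (R k) u (s k)
      - (LINT r|lborel. indicator {s k..t' k} r * smeared x t (R k) f r)) \<le> \<nu> / sqrt (2 * \<nu> * t) * 4 * Bg * t / n k"
    proof (intro always_eventually allI)
      fix k
      have "sqrt (n k) \<le> n k" using n[of k] by (simp add: real_sqrt_le_iff' real_le_lsqrt power2_eq_square)
      hence "\<nu> / sqrt (2 * \<nu> * (t - t' k)) \<le> \<nu> / sqrt (2 * \<nu> * t) * n k"
        using nu t n[of k] by (simp add: t'_def real_sqrt_mult real_sqrt_divide field_simps)
      hence "\<nu> / sqrt (2 * \<nu> * (t - t' k)) * (4 / R k * Bg) * (t' k - s k) \<le> \<nu> / sqrt (2 * \<nu> * t) * n k * (4 / R k * Bg) * t"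
        using nu t Bg0 st[of k] n[of k] by (intro mult_mono) auto
      also have "\<dots> = \<nu> / sqrt (2 * \<nu> * t) * 4 * Bg * t / n k"
        using n[of k] by (simp add: R_def power2_eq_square)
      finally show "norm (smeared x t (R k) u (t' k) - smeared x t (R k) u (s k)
        - (LINT r|lborel. indicator {s k..t' k} r * smeared x t (R k) f r)) \<le> \<nu> / sqrt (2 * \<nu> * t) * 4 * Bg * t / n k"
        using smeared_increment[OF st(1)[of k] st(2)[of k] st(3)[of k] st(4)[of k], of x] by simp
    qed
    show "(\<lambda>k. \<nu> / sqrt (2 * \<nu> * t) * 4 * Bg * t / n k) \<longlonglongrightarrow> 0"
      unfolding n_def by real_asymp
  qed
  have "(\<lambda>k. smeared x t (R k) u (t' k) - smeared x t (R k) u (s k)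
      - (LINT r|lborel. indicator {s k..t' k} r * smeared x t (R k) f r))
     \<longlonglongrightarrow> u t x - (LINT z|lborel. gauss z * u 0 (x + sqrt (2 * \<nu> * t) *\<^sub>R z)) - (LINT r|lborel. indicator {0<..<t} r * ?J r)"
    using tendsto_diff[OF tendsto_diff[OF A Bl] C] by (simp only: u_t diff_zero)
  from LIMSEQ_unique[OF this err] show ?thesis by simp
qed

end

section \<open>The fundamental lemma of the calculus of variations\<close>

text \<open>\<open>ennreal\<close> truncates at 0, so \<open>?P\<close> and \<open>?N\<close> have
  the positive and the negative part of \<open>k\<close> as densities. They agree on boxes, an
  intersection-stable generator, hence everywhere, and finite measures determine their densities
  almost everywhere.\<close>

lemma AE_eq_0_if_box_integrals_eq_0:
  fixes k :: "'a::euclidean_space \<Rightarrow> real"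
  assumes int: "integrable lborel k"
    and zero: "\<And>a b. (LINT x|lborel. indicator (box a b) x * k x) = 0"
  shows "AE x in lborel. k x = 0"
proof -
  have [measurable]: "k \<in> borel_measurable borel" using int by (auto dest: borel_measurable_integrable)
  let ?P = "density lborel (\<lambda>x. ennreal (k x))" and ?N = "density lborel (\<lambda>x. ennreal (- k x))"
  have fin: "(\<integral>\<^sup>+x. ennreal (k x) \<partial>lborel) \<noteq> \<infinity>"
  proof -
    have "(\<integral>\<^sup>+x. ennreal (k x) \<partial>lborel) \<le> (\<integral>\<^sup>+x. ennreal (norm (k x)) \<partial>lborel)"
      by (intro nn_integral_mono ennreal_leI) auto
    thus ?thesis using int by (auto simp: integrable_iff_bounded top_unique)
  qed
  have "?P = ?N"
  proof (rule measure_eqI_generator_eq)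
    let ?E = "range (\<lambda>(a, b). box a b::'a set)"
    show "Int_stable ?E"
      by (auto simp: Int_stable_def box_Int_box)
    show "?E \<subseteq> Pow UNIV" "sets ?P = sigma_sets UNIV ?E" "sets ?N = sigma_sets UNIV ?E"
      by (simp_all add: borel_eq_box sets_lborel)
    let ?A = "\<lambda>n::nat. box (- (real n *\<^sub>R One)) (real n *\<^sub>R One) :: 'a set"
    show "range ?A \<subseteq> ?E" "(\<Union>i. ?A i) = UNIV"
      unfolding UN_box_eq_UNIV by auto
    have "emeasure ?P (?A i) \<le> (\<integral>\<^sup>+x. ennreal (k x) \<partial>lborel)" for i
      by (subst emeasure_density) (auto intro!: nn_integral_mono simp: indicator_def)
    from neq_top_trans[OF _ this] fin show "emeasure ?P (?A i) \<noteq> \<infinity>" for i by simp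
    fix X assume "X \<in> ?E"
    then obtain a b where X: "X = box a b" by auto
    have int1: "integrable lborel (\<lambda>x. indicator X x * k x)"
      using integrable_mult_indicator[OF _ int, of X] by (simp add: X)
    define p where "p x = max 0 (indicator X x * k x)" for x
    define q where "q x = max 0 (- (indicator X x * k x))" for x
    have "integrable lborel p" "integrable lborel q"
      unfolding p_def q_def using int1 by (intro integrable_max; simp)+
    note pq = this
    have "(LINT x|lborel. p x - q x) = 0"
    proof -
      have "p x - q x = indicator X x * k x" for x by (auto simp: p_def q_def max_def)
      thus ?thesis using zero by (simp add: X)
    qed
    hence "integral\<^sup>L lborel p = integral\<^sup>L lborel q" using pq by simp
    moreover have "p x \<ge> 0" "q x \<ge> 0" for x by (simp_all add: p_def q_def)
    ultimately have "(\<integral>\<^sup>+x. ennreal (p x) \<partial>lborel) = (\<integral>\<^sup>+x. ennreal (q x) \<partial>lborel)"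
      using pq by (simp add: nn_integral_eq_integral)
    moreover have "ennreal (p x) = ennreal (k x) * indicator X x" "ennreal (q x) = ennreal (- k x) * indicator X x" for x
      by (auto simp: p_def q_def indicator_def max_def ennreal_neg)
    ultimately show "emeasure ?P X = emeasure ?N X"
      by (simp add: emeasure_density X)
  qed
  hence "AE x in lborel. ennreal (k x) = ennreal (- k x)"
    by (subst (asm) finite_density_unique) (use fin in auto)
  thus ?thesis
  proof eventually_elim
    case (elim x)
    show ?case
    proof (cases "k x \<ge> 0")
      case True
      hence "ennreal (k x) = 0" using elim by (simp add: ennreal_neg)
      thus ?thesis using True by simp
    next
      case False
      hence "ennreal (- k x) = 0" using elim by (simp add: ennreal_neg)
      thus ?thesis using False by (simp add: ennreal_eq_0_iff)
    qed
  qed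
qed

subsection \<open>Test functions\<close>

text \<open>The derivatives of \<open>exp (- 1 / x)\<close> on \<open>x > 0\<close> are \<open>p (1 / x) * exp (- 1 / x)\<close> with polynomials \<open>p\<close>.\<close>

definition flat :: "real poly \<Rightarrow> real \<Rightarrow> real" where
  "flat p x = (if x > 0 then poly p (1 / x) * exp (- (1 / x)) else 0)"

text \<open>For y = 1 / x one has dy/dx = - y^2, and the y-derivative of p(y) exp (- y) is (p' -
  p)(y) exp (- y).\<close>

definition flat_step :: "real poly \<Rightarrow> real poly" where
  "flat_step p = monom 1 2 * (p - pderiv p)"

lemma poly_over_exp_tendsto_0: "((\<lambda>y. poly p y / exp y) \<longlongrightarrow> 0) at_top" for p :: "real poly"
proof -
  have "((\<lambda>y. \<Sum>i\<le>degree p. coeff p i * (y ^ i / exp y)) \<longlongrightarrow> (\<Sum>i\<le>degree p. coeff p i * 0)) at_top"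
    by (intro tendsto_intros tendsto_power_div_exp_0)
  moreover have "(\<lambda>y. \<Sum>i\<le>degree p. coeff p i * (y ^ i / exp y)) = (\<lambda>y. poly p y / exp y)"
    by (simp add: poly_altdef sum_divide_distrib)
  ultimately show ?thesis by simp
qed

text \<open>Gives the derivative 0 at the origin. Division by \<open>h\<close> multiplies the
  polynomial in 1 / h by its variable, which is \<open>pCons 0 p\<close>, and the exponential still
  wins.\<close>

lemma flat_over_id_tendsto_0: "((\<lambda>h. flat p h / h) \<longlongrightarrow> 0) (at 0)"
proof -
  have 1: "((\<lambda>h. poly (pCons 0 p) (inverse h) / exp (inverse h)) \<longlongrightarrow> 0) (at_right 0)"
    by (rule filterlim_compose[OF poly_over_exp_tendsto_0 filterlim_inverse_at_top_right])
  have "((\<lambda>h. flat p h / h) \<longlongrightarrow> 0) (at_right 0)"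
    by (rule Lim_transform_eventually[OF 1])
       (auto simp: eventually_at_filter flat_def exp_minus field_simps)
  moreover have "((\<lambda>h. flat p h / h) \<longlongrightarrow> 0) (at_left 0)"
    by (rule Lim_transform_eventually[OF tendsto_const]) (auto simp: eventually_at_filter flat_def)
  ultimately show ?thesis by (simp add: filterlim_split_at)
qed

lemma has_real_derivative_flat: "(flat p has_real_derivative flat (flat_step p) x) (at x)"
proof -
  consider "x > 0" | "x < 0" | "x = 0" by linarith
  thus ?thesis
  proof cases
    case 1
    have "((\<lambda>x. poly p (1 / x) * exp (- (1 / x))) has_real_derivative flat (flat_step p) x) (at x)"
      using 1 by (auto intro!: derivative_eq_intros poly_DERIV[THEN DERIV_chain2]
          simp: flat_def flat_step_def poly_monom power2_eq_square field_simps)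
    thus ?thesis
      by (rule has_field_derivative_transform_within_open[where S = "{0<..}"]) (use 1 in \<open>auto simp: flat_def\<close>)
  next
    case 2
    have "((\<lambda>x. 0) has_real_derivative flat (flat_step p) x) (at x)"
      using 2 by (auto simp: flat_def)
    thus ?thesis
      by (rule has_field_derivative_transform_within_open[where S = "{..<0}"]) (use 2 in \<open>auto simp: flat_def\<close>)
  next
    case 3
    thus ?thesis using flat_over_id_tendsto_0[of p] by (simp add: DERIV_def flat_def)
  qed
qed

text \<open>As in \<open>smooth\<close>, all derivatives are demanded as one family of witnesses, so
  that products are treated by exhibiting such a family.\<close>

definition smooth1 :: "(real \<Rightarrow> real) \<Rightarrow> bool" where
  "smooth1 f \<longleftrightarrow> (\<exists>E :: nat \<Rightarrow> real \<Rightarrow> real. E 0 = f \<and> (\<forall>n x. (E n has_real_derivative E (Suc n) x) (at x)))"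

lemma smooth1_flat_affine: "smooth1 (\<lambda>t. flat p (c * t + d))"
  unfolding smooth1_def
proof (intro exI conjI allI)
  let ?E = "\<lambda>n t. c ^ n * flat ((flat_step ^^ n) p) (c * t + d)"
  show "?E 0 = (\<lambda>t. flat p (c * t + d))" by simp
  fix n t
  have "((\<lambda>t. flat ((flat_step ^^ n) p) (c * t + d)) has_real_derivative
      flat (flat_step ((flat_step ^^ n) p)) (c * t + d) * c) (at t)"
    by (rule DERIV_chain2[OF has_real_derivative_flat]) (auto intro!: derivative_eq_intros)
  from DERIV_cmult[OF this, of "c ^ n"] show "(?E n has_real_derivative ?E (Suc n) t) (at t)"
    by (simp add: mult_ac)
qed

text \<open>The summands of the \<open>n\<close>-th derivative of a product are generated recursively, which avoids the
  binomial coefficients of the Leibniz rule.\<close>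

primrec leibniz_sum :: "(nat \<Rightarrow> real \<Rightarrow> real) \<Rightarrow> (nat \<Rightarrow> real \<Rightarrow> real) \<Rightarrow> nat \<Rightarrow> nat \<Rightarrow> nat \<Rightarrow> real \<Rightarrow> real" where
  "leibniz_sum A B 0 i j t = A i t * B j t"
| "leibniz_sum A B (Suc n) i j t = leibniz_sum A B n (Suc i) j t + leibniz_sum A B n i (Suc j) t"

lemma smooth1_mult:
  assumes "smooth1 f" "smooth1 g"
  shows "smooth1 (\<lambda>t. f t * g t)"
proof -
  obtain A B where A: "A 0 = f" "\<And>n x. (A n has_real_derivative A (Suc n) x) (at x)"
    and B: "B 0 = g" "\<And>n x. (B n has_real_derivative B (Suc n) x) (at x)"
    using assms unfolding smooth1_def by auto
  have "(leibniz_sum A B n i j has_real_derivative leibniz_sum A B (Suc n) i j t) (at t)" for n i j t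
  proof (induction n arbitrary: i j)
    case 0
    have "((\<lambda>t. A i t * B j t) has_real_derivative A (Suc i) t * B j t + B (Suc j) t * A i t) (at t)"
      by (rule DERIV_mult[OF A(2) B(2)])
    thus ?case by (simp add: mult.commute[of "B (Suc j) t"])
  next
    case (Suc n)
    show ?case using DERIV_add[OF Suc[of "Suc i" j] Suc[of i "Suc j"]] by simp
  qed
  moreover have "leibniz_sum A B 0 0 0 = (\<lambda>t. f t * g t)" by (simp add: A B fun_eq_iff)
  ultimately show ?thesis unfolding smooth1_def by (intro exI[of _ "\<lambda>n. leibniz_sum A B n 0 0"]) auto
qed

text \<open>The iterated derivative along \<open>is\<close> differentiates the factor
  \<open>i\<close> as often as \<open>i\<close> occurs in \<open>is\<close>; this is the
  \<open>count_list\<close> in \<open>?F\<close>.\<close>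

lemma smooth_prod:
  fixes s :: "'n::finite \<Rightarrow> real \<Rightarrow> real"
  assumes "\<And>i. smooth1 (s i)"
  shows "smooth (\<lambda>x::real^'n. \<Prod>i\<in>UNIV. s i (x $ i))"
proof -
  obtain E where E: "\<And>i. E i 0 = s i" "\<And>i n t. (E i n has_real_derivative E i (Suc n) t) (at t)"
    using assms unfolding smooth1_def by metis
  let ?F = "\<lambda>is (x::real^'n). \<Prod>i\<in>UNIV. E i (count_list is i) (x $ i)"
  have "(?F is has_derivative (\<lambda>v. \<Sum>i\<in>UNIV. v $ i * ?F (i # is) x)) (at x)" for "is" x
  proof -
    have 1: "((\<lambda>x. E i (count_list is i) (x $ i)) has_derivative (\<lambda>v. E i (Suc (count_list is i)) (x $ i) * v $ i)) (at x)" for i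
      by (rule has_derivative_compose[OF bounded_linear.has_derivative[OF bounded_linear_vec_nth has_derivative_ident]
          E(2)[unfolded has_field_derivative_def]])
    have 2: "?F (i # is) x = E i (Suc (count_list is i)) (x $ i) * (\<Prod>j\<in>UNIV - {i}. E j (count_list is j) (x $ j))" for i
      by (subst prod.remove[of UNIV i]) (auto intro!: prod.cong)
    show ?thesis
      by (rule has_derivative_eq_rhs[OF has_derivative_prod[OF 1]]) (simp only: 2, simp add: mult_ac)
  qed
  thus ?thesis unfolding smooth_def by (intro exI[of _ ?F]) (auto simp: E(1))
qed

text \<open>For y > 0 the value exp (- 1 / (k y)) tends to 1 as k grows, while the flat function is
  0 for y \<le> 0. Two rescaled flat functions per coordinate therefore approximate the indicator
  from below.\<close>

lemma box_indicator_limit: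
  fixes a b :: "real ^ 'n"
  obtains \<phi> :: "nat \<Rightarrow> real ^ 'n \<Rightarrow> real" where "\<And>k. test_function (\<phi> k)"
    "\<And>k x. 0 \<le> \<phi> k x" "\<And>k x. \<phi> k x \<le> indicator (box a b) x"
    "\<And>x. (\<lambda>k. \<phi> k x) \<longlonglongrightarrow> indicator (box a b) x"
proof
  define s where "s k i t = flat 1 (real (Suc k) * t + - (real (Suc k) * a $ i)) * flat 1 (- real (Suc k) * t + real (Suc k) * b $ i)"
    for k and i :: 'n and t :: real
  define \<phi> where "\<phi> k x = (\<Prod>i\<in>UNIV. s k i (x $ i))" for k and x :: "real^'n"
  have flat1: "flat 1 y = (if y > 0 then exp (- (1 / y)) else 0)" for y by (simp add: flat_def)
  have s01: "0 \<le> s k i t" "s k i t \<le> 1" for k i t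
    by (auto simp: s_def flat1 intro!: mult_le_one)
  show nn: "0 \<le> \<phi> k x" for k x by (auto simp: \<phi>_def intro!: prod_nonneg s01)
  have s_out: "s k i t = 0" if "\<not> (a $ i < t \<and> t < b $ i)" for k i t
  proof -
    have "(0 < real (Suc k) * t + - (real (Suc k) * a $ i)) \<longleftrightarrow> a $ i < t"
      "(0 < - real (Suc k) * t + real (Suc k) * b $ i) \<longleftrightarrow> t < b $ i"
      by (simp_all add: mult_less_cancel_left_pos del: of_nat_Suc)
    thus ?thesis using that by (auto simp: s_def flat1)
  qed
  have out: "\<phi> k x = 0" if "x \<notin> box a b" for k x
    using that s_out unfolding \<phi>_def mem_box_cart by (auto intro!: prod_zero)
  show "\<phi> k x \<le> indicator (box a b) x" for k x
  proof (cases "x \<in> box a b")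
    case True
    thus ?thesis by (auto simp: \<phi>_def intro!: prod_le_1 s01)
  qed (simp add: out)
  show "test_function (\<phi> k)" for k
    unfolding test_function_def
  proof
    have "smooth1 (s k i)" for i unfolding s_def[abs_def] by (intro smooth1_mult smooth1_flat_affine)
    thus "smooth (\<phi> k)" unfolding \<phi>_def[abs_def] by (rule smooth_prod)
    have "{x. \<phi> k x \<noteq> 0} \<subseteq> box a b" using out by auto
    hence "bounded {x. \<phi> k x \<noteq> 0}" using bounded_box bounded_subset by blast
    thus "compact (closure {x. \<phi> k x \<noteq> 0})" by (simp add: compact_closure)
  qed
  show "(\<lambda>k. \<phi> k x) \<longlonglongrightarrow> indicator (box a b) x" for x
  proof (cases "x \<in> box a b")
    case False
    thus ?thesis by (simp add: out)
  next
    case True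
    hence ab: "a $ i < x $ i" "x $ i < b $ i" for i by (auto simp: mem_box_cart)
    have "(\<lambda>k. s k i (x $ i)) \<longlonglongrightarrow> 1" for i
    proof -
      have pos: "c > 0 \<Longrightarrow> (\<lambda>k. exp (- (1 / (real (Suc k) * c)))) \<longlonglongrightarrow> 1" for c :: real
        by real_asymp
      have "s k i (x $ i) = exp (- (1 / (real (Suc k) * (x $ i - a $ i)))) * exp (- (1 / (real (Suc k) * (b $ i - x $ i))))" for k
        unfolding s_def flat1 using ab by (simp add: mult_less_cancel_left_pos algebra_simps del: of_nat_Suc)
      thus ?thesis using tendsto_mult[OF pos pos, of "x $ i - a $ i" "b $ i - x $ i"] ab by simp
    qed
    hence "(\<lambda>k. \<phi> k x) \<longlonglongrightarrow> (\<Prod>i\<in>(UNIV::'n set). 1)" unfolding \<phi>_def by (intro tendsto_prod)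
    thus ?thesis using True by simp
  qed
qed

lemma test_functionE:
  fixes \<phi> :: "real ^ 'n \<Rightarrow> real"
  assumes "test_function \<phi>"
  obtains D R where "R > 0"
    "\<And>x. (\<phi> has_derivative (\<lambda>v. \<Sum>i\<in>UNIV. v $ i * D i x)) (at x)"
    "\<And>i. continuous_on UNIV (D i)" "continuous_on UNIV \<phi>"
    "\<And>x. norm x > R \<Longrightarrow> \<phi> x = 0" "\<And>i x. norm x > R \<Longrightarrow> D i x = 0"
    "\<And>i x. frechet_derivative \<phi> (at x) (axis i 1) = D i x"
proof -
  obtain F where F: "F [] = \<phi>" "\<And>is x. (F is has_derivative (\<lambda>v. \<Sum>i\<in>UNIV. v $ i * F (i # is) x)) (at x)"
    using assms unfolding test_function_def smooth_def by blast
  have "bounded {x. \<phi> x \<noteq> 0}"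
    using assms unfolding test_function_def by (intro bounded_subset[OF compact_imp_bounded closure_subset]) simp
  then obtain R where R: "R > 0" "\<And>x. \<phi> x \<noteq> 0 \<Longrightarrow> norm x \<le> R"
    by (auto simp: bounded_pos)
  have c: "continuous_on UNIV (F is)" for "is"
    using F(2) by (meson has_derivative_continuous continuous_at_imp_continuous_on)
  define D where "D i = F [i]" for i
  have der: "(\<phi> has_derivative (\<lambda>v. \<Sum>i\<in>UNIV. v $ i * D i x)) (at x)" for x
    using F(2)[of "[]" x] by (simp add: F(1) D_def)
  have axis_sum: "(\<Sum>j\<in>UNIV. axis i 1 $ j * D j x) = D i x" for i x
    by (simp add: axis_def if_distrib[of "\<lambda>t. t * _"] cong: if_cong)
  have fd: "frechet_derivative \<phi> (at x) (axis i 1) = D i x" for i x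
    by (simp add: frechet_derivative_at[OF der, symmetric] axis_sum)
  have zero: "D i x = 0" if "norm x > R" for i x
  proof -
    have "open {x::real^'n. norm x > R}" by (intro open_Collect_less continuous_intros)
    moreover have "x' \<in> {x. norm x > R} \<Longrightarrow> 0 = \<phi> x'" for x' using R(2) by force
    ultimately have "(\<phi> has_derivative (\<lambda>v. 0)) (at x)"
      using that by (intro has_derivative_transform_within_open[OF has_derivative_const, of "{x. norm x > R}"]) auto
    from has_derivative_unique[OF this der[of x]] have "(\<Sum>j\<in>UNIV. axis i 1 $ j * D j x) = 0"
      by (rule fun_cong[symmetric])
    thus ?thesis by (simp add: axis_sum)
  qed
  show ?thesis
  proof (rule that[OF R(1) der _ _ _ zero fd])
    show "continuous_on UNIV (D i)" for i by (simp add: D_def c)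
    show "continuous_on UNIV \<phi>" using c[of "[]"] F(1) by simp
    show "\<phi> x = 0" if "norm x > R" for x using R(2)[of x] that by force
  qed
qed

section \<open>Local integrability, weak gradients and their uniqueness\<close>

lemma integrable_lebesgue_if_lborel: "integrable lborel f \<Longrightarrow> integrable lebesgue f"
  for f :: "'a::euclidean_space \<Rightarrow> 'b::{banach, second_countable_topology}"
  by (subst integrable_completion) auto

lemma locally_integrable_if_continuous:
  assumes "continuous_on UNIV f"
  shows "locally_integrable f"
  unfolding locally_integrable_def set_integrable_def
  by (intro allI impI integrable_lebesgue_if_lborel borel_integrable_compact continuous_on_subset[OF assms]) auto

lemma locally_integrable_component:
  assumes "locally_integrable (g :: real ^ 'n \<Rightarrow> real ^ 'm)"
  shows "locally_integrable (\<lambda>x. g x $ i)"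
  unfolding locally_integrable_def set_integrable_def
proof (intro allI impI)
  fix S :: "(real^'n) set" assume "compact S"
  hence "integrable lebesgue (\<lambda>x. indicator S x *\<^sub>R g x)"
    using assms unfolding locally_integrable_def set_integrable_def by blast
  from integrable_bounded_linear[OF bounded_linear_vec_nth this, of i]
  show "integrable lebesgue (\<lambda>x. indicator S x *\<^sub>R g x $ i)" by simp
qed

lemma locally_integrable_measurable:
  assumes "locally_integrable (f :: real ^ 'n \<Rightarrow> real)"
  shows "f \<in> borel_measurable lebesgue"
proof (rule borel_measurable_LIMSEQ_metric)
  fix m :: nat
  show "(\<lambda>x. indicator (cball 0 (real m)) x *\<^sub>R f x) \<in> borel_measurable lebesgue"
    using assms unfolding locally_integrable_def set_integrable_def
    by (intro borel_measurable_integrable) auto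
next
  fix x :: "real^'n"
  obtain N :: nat where "norm x \<le> real N" using real_arch_simple by blast
  hence "\<forall>\<^sub>F m in sequentially. f x = indicator (cball 0 (real m)) x *\<^sub>R f x"
    by (auto simp: eventually_sequentially intro!: exI[of _ N] split: split_indicator)
  thus "(\<lambda>m. indicator (cball 0 (real m)) x *\<^sub>R f x) \<longlonglongrightarrow> f x"
    by (rule Lim_transform_eventually[OF tendsto_const])
qed

lemma borel_representative:
  assumes "f \<in> borel_measurable lebesgue"
  obtains f' :: "'a::euclidean_space \<Rightarrow> real" where "f' \<in> borel_measurable borel" "AE x in lborel. f x = f' x"
  using completion_ex_borel_measurable_real[OF assms] by auto

text \<open>Test functions approximating box indicators turn the hypothesis into vanishing box
  integrals. As \<open>k\<close> is only locally integrable, this is done on each large box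
  \<open>?Q m\<close> separately, and for a Borel representative \<open>k'\<close>.\<close>

lemma fundamental_lemma_of_calculus_of_variations:
  fixes k :: "real ^ 'n \<Rightarrow> real"
  assumes li: "locally_integrable k"
    and zero: "\<And>\<phi>. test_function \<phi> \<Longrightarrow> (LINT x|lebesgue. k x * \<phi> x) = 0"
  shows "AE x in lborel. k x = 0"
proof -
  have km: "k \<in> borel_measurable lebesgue" by (rule locally_integrable_measurable[OF li])
  obtain k' where k'[measurable]: "k' \<in> borel_measurable borel" and ae: "AE x in lborel. k x = k' x"
    using borel_representative[OF km] by blast
  let ?Q = "\<lambda>m::nat. box (- (real m *\<^sub>R One)) (real m *\<^sub>R One) :: (real^'n) set"
  have "AE x in lborel. indicator (?Q m) x * k' x = 0" for m
  proof (rule AE_eq_0_if_box_integrals_eq_0)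
    let ?C = "cbox (- (real m *\<^sub>R One)) (real m *\<^sub>R One) :: (real^'n) set"
    have "integrable lebesgue (\<lambda>x. indicator ?C x *\<^sub>R k x)"
      using li unfolding locally_integrable_def set_integrable_def by auto
    hence "integrable lebesgue (\<lambda>x. indicator ?C x *\<^sub>R k' x)"
      by (rule integrable_cong_AE_imp) (use ae in \<open>auto simp: AE_completion_iff intro!: measurable_completion\<close>)
    hence intC: "integrable lborel (\<lambda>x. indicator ?C x *\<^sub>R k' x)"
      by (subst (asm) integrable_completion) auto
    have "integrable lborel (\<lambda>x. indicator (?Q m) x *\<^sub>R (indicator ?C x *\<^sub>R k' x))"
      by (rule integrable_mult_indicator[OF _ intC]) auto
    also have "(\<lambda>x. indicator (?Q m) x *\<^sub>R (indicator ?C x *\<^sub>R k' x)) = (\<lambda>x. indicator (?Q m) x * k' x)"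
      using box_subset_cbox[of "- (real m *\<^sub>R One)" "real m *\<^sub>R One :: real^'n"] by (auto simp: indicator_def fun_eq_iff)
    finally show "integrable lborel (\<lambda>x. indicator (?Q m) x * k' x)" .
    fix a b :: "real^'n"
    obtain a' b' where ab: "box a b \<inter> ?Q m = box a' b'" using box_Int_box by blast
    obtain \<phi> where \<phi>: "\<And>k. test_function (\<phi> k)" "\<And>k x. 0 \<le> \<phi> k x" "\<And>k x. \<phi> k x \<le> indicator (box a' b') x"
      "\<And>x. (\<lambda>k. \<phi> k x) \<longlonglongrightarrow> indicator (box a' b') x"
      using box_indicator_limit[of a' b'] by blast
    have \<phi>m[measurable]: "\<phi> j \<in> borel_measurable borel" for j
      using test_functionE[OF \<phi>(1)[of j]] by (metis borel_measurable_continuous_onI)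
    have "(\<lambda>j. LINT x|lborel. k' x * \<phi> j x) \<longlonglongrightarrow> (LINT x|lborel. indicator (box a b) x * (indicator (?Q m) x * k' x))"
    proof (rule integral_dominated_convergence[OF _ _ integrable_abs[OF intC]])
      show "AE x in lborel. (\<lambda>j. k' x * \<phi> j x) \<longlonglongrightarrow> indicator (box a b) x * (indicator (?Q m) x * k' x)"
      proof (rule AE_I2)
        fix x
        have "(\<lambda>j. k' x * \<phi> j x) \<longlonglongrightarrow> k' x * indicator (box a' b') x" by (intro tendsto_intros \<phi>)
        also have "k' x * indicator (box a' b') x = indicator (box a b) x * (indicator (?Q m) x * k' x)"
          unfolding ab[symmetric] by (simp add: indicator_inter_arith)
        finally show "(\<lambda>j. k' x * \<phi> j x) \<longlonglongrightarrow> indicator (box a b) x * (indicator (?Q m) x * k' x)" .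
      qed
      show "AE x in lborel. norm (k' x * \<phi> j x) \<le> \<bar>indicator ?C x *\<^sub>R k' x\<bar>" for j
      proof (rule AE_I2)
        fix x
        have "\<phi> j x \<le> indicator ?C x"
        proof -
          have "box a' b' \<subseteq> ?C" using ab box_subset_cbox by blast
          hence "indicator (box a' b') x \<le> (indicator ?C x :: real)" by (auto simp: indicator_def)
          thus ?thesis using \<phi>(3)[of j x] by linarith
        qed
        thus "norm (k' x * \<phi> j x) \<le> \<bar>indicator ?C x *\<^sub>R k' x\<bar>"
          using \<phi>(2)[of j x] mult_right_mono[of "\<phi> j x" "indicator ?C x" "\<bar>k' x\<bar>"] by (simp add: abs_mult mult.commute)
      qed
    qed auto
    moreover have "(LINT x|lborel. k' x * \<phi> j x) = 0" for j
    proof -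
      have "(LINT x|lborel. k' x * \<phi> j x) = (LINT x|lebesgue. k' x * \<phi> j x)"
        by (subst integral_completion) auto
      also have "\<dots> = (LINT x|lebesgue. k x * \<phi> j x)"
      proof (rule integral_cong_AE)
        note [measurable] = km
        have [measurable]: "\<phi> j \<in> borel_measurable lebesgue" "k' \<in> borel_measurable lebesgue"
          using \<phi>m k' by (auto intro: measurable_completion)
        show "(\<lambda>x. k' x * \<phi> j x) \<in> borel_measurable lebesgue" "(\<lambda>x. k x * \<phi> j x) \<in> borel_measurable lebesgue"
          by measurable
        show "AE x in lebesgue. k' x * \<phi> j x = k x * \<phi> j x"
          unfolding AE_completion_iff using ae by eventually_elim simp
      qed
      finally show ?thesis using zero[OF \<phi>(1)] by simp
    qed
    ultimately show "(LINT x|lborel. indicator (box a b) x * (indicator (?Q m) x * k' x)) = 0"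
      by (simp add: LIMSEQ_const_iff)
  qed
  hence "AE x in lborel. \<forall>m. indicator (?Q m) x * k' x = 0" by (subst AE_all_countable) blast
  with ae show ?thesis
  proof eventually_elim
    case (elim x)
    have "x \<in> (\<Union>m. ?Q m)" unfolding UN_box_eq_UNIV by simp
    then obtain m where "x \<in> ?Q m" by blast
    hence "k' x = 0" using elim(2)[rule_format, of m] by simp
    thus ?case using elim(1) by simp
  qed
qed

lemma integrable_locally_integrable_times:
  fixes k :: "real ^ 'n \<Rightarrow> real"
  assumes li: "locally_integrable k" and cont: "continuous_on UNIV \<phi>" and supp: "\<And>x. norm x > R \<Longrightarrow> \<phi> x = 0"
  shows "integrable lebesgue (\<lambda>x. k x * \<phi> x)"
proof -
  have [measurable]: "k \<in> borel_measurable lebesgue" by (rule locally_integrable_measurable[OF li])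
  have [measurable]: "\<phi> \<in> borel_measurable lebesgue"
    by (intro measurable_completion) (simp add: borel_measurable_continuous_onI[OF cont])
  have "compact (\<phi> ` cball 0 R)" by (intro compact_continuous_image continuous_on_subset[OF cont]) auto
  then obtain C where C: "\<And>x. x \<in> cball 0 R \<Longrightarrow> \<bar>\<phi> x\<bar> \<le> C"
    by (metis bounded_real compact_imp_bounded imageI)
  have "integrable lebesgue (\<lambda>x. indicator (cball 0 R) x *\<^sub>R k x)"
    using li unfolding locally_integrable_def set_integrable_def by auto
  hence "integrable lebesgue (\<lambda>x. C * (indicator (cball 0 R) x *\<^sub>R k x))" by simp
  thus ?thesis
  proof (rule Bochner_Integration.integrable_bound)
    show "AE x in lebesgue. norm (k x * \<phi> x) \<le> norm (C * (indicator (cball 0 R) x *\<^sub>R k x))"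
    proof (rule AE_I2)
      fix x
      show "norm (k x * \<phi> x) \<le> norm (C * (indicator (cball 0 R) x *\<^sub>R k x))"
      proof (cases "x \<in> cball 0 R")
        case True
        have "\<bar>\<phi> x\<bar> \<le> \<bar>C\<bar>" using C[OF True] by linarith
        thus ?thesis using True by (simp add: abs_mult mult.commute[of "\<bar>k x\<bar>"] mult_right_mono)
      next
        case False
        thus ?thesis using supp[of x] by simp
      qed
    qed
  qed measurable
qed

lemma has_weak_gradient_unique:
  fixes f :: "real ^ 'n \<Rightarrow> real"
  assumes "has_weak_gradient f g" "has_weak_gradient f g'"
  shows "AE x in lborel. g x = g' x"
proof -
  have "AE x in lborel. g x $ i - g' x $ i = 0" for i
  proof (rule fundamental_lemma_of_calculus_of_variations)
    have l: "locally_integrable (\<lambda>x. g x $ i)" "locally_integrable (\<lambda>x. g' x $ i)"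
      using assms unfolding has_weak_gradient_def by (auto intro: locally_integrable_component)
    show "locally_integrable (\<lambda>x. g x $ i - g' x $ i)"
      using l unfolding locally_integrable_def set_integrable_def
      by (auto simp: algebra_simps intro!: Bochner_Integration.integrable_diff)
    fix \<phi> :: "real^'n \<Rightarrow> real" assume \<phi>: "test_function \<phi>"
    obtain R where R: "continuous_on UNIV \<phi>" "\<And>x. norm x > R \<Longrightarrow> \<phi> x = 0"
      using test_functionE[OF \<phi>] by metis
    have "(LINT x|lebesgue. g x $ i * \<phi> x) = (LINT x|lebesgue. g' x $ i * \<phi> x)"
    proof -
      have "(LINT x|lebesgue. f x * frechet_derivative \<phi> (at x) (axis i 1)) = - (LINT x|lebesgue. g x $ i * \<phi> x)"
        "(LINT x|lebesgue. f x * frechet_derivative \<phi> (at x) (axis i 1)) = - (LINT x|lebesgue. g' x $ i * \<phi> x)"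
        using assms \<phi> by (simp_all add: has_weak_gradient_def)
      thus ?thesis by linarith
    qed
    thus "(LINT x|lebesgue. (g x $ i - g' x $ i) * \<phi> x) = 0"
      using integrable_locally_integrable_times[OF l(1) R] integrable_locally_integrable_times[OF l(2) R]
      by (simp add: left_diff_distrib)
  qed
  hence "AE x in lborel. \<forall>i\<in>UNIV. g x $ i - g' x $ i = 0" by (subst AE_finite_all) auto
  thus ?thesis by eventually_elim (simp add: vec_eq_iff)
qed

lemma has_weak_gradient_if_C1:
  fixes f :: "real ^ 'n \<Rightarrow> real"
  assumes der: "\<And>x. (f has_derivative (\<lambda>v. g x \<bullet> v)) (at x)" and cg: "continuous_on UNIV g"
  shows "has_weak_gradient f g"
  unfolding has_weak_gradient_def
proof (intro conjI allI impI)
  have cf: "continuous_on UNIV f"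
    using der by (meson has_derivative_continuous continuous_at_imp_continuous_on)
  show "locally_integrable f" "locally_integrable g"
    by (rule locally_integrable_if_continuous; fact)+
  fix \<phi> :: "real^'n \<Rightarrow> real" and i assume "test_function \<phi>"
  then obtain D R where D: "\<And>x. (\<phi> has_derivative (\<lambda>v. \<Sum>i\<in>UNIV. v $ i * D i x)) (at x)"
    "\<And>i. continuous_on UNIV (D i)" "continuous_on UNIV \<phi>"
    "\<And>x. norm x > R \<Longrightarrow> \<phi> x = 0" "\<And>i x. norm x > R \<Longrightarrow> D i x = 0"
    "\<And>i x. frechet_derivative \<phi> (at x) (axis i 1) = D i x"
    by (rule test_functionE) blast
  have axis_sum: "(\<Sum>j\<in>UNIV. axis i 1 $ j * D j x) = D i x" for x
    by (simp add: axis_def if_distrib[of "\<lambda>t. t * _"] cong: if_cong)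
  let ?F = "\<lambda>x v. f x * (\<Sum>i\<in>UNIV. v $ i * D i x) + (g x \<bullet> v) * \<phi> x"
  have F_axis: "?F x (axis i 1) = f x * D i x + g x $ i * \<phi> x" for x
    by (simp add: axis_sum inner_axis)
  have "(LINT x|lborel. ?F x (axis i 1)) = 0"
  proof (rule integral_directional_derivative_eq_0[where F = "\<lambda>x. f x * \<phi> x"])
    show "((\<lambda>x. f x * \<phi> x) has_derivative ?F x) (at x)" for x
      by (rule has_derivative_mult[OF der D(1)])
    show "continuous_on UNIV (\<lambda>x. ?F x (axis i 1))"
      unfolding F_axis by (intro continuous_intros cf cg D)
    show "f x * \<phi> x = 0" if "norm x > R" for x using D(4)[OF that] by simp
  qed
  moreover have i1: "integrable lborel (\<lambda>x. f x * D i x)"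
    by (rule integrable_compact_support[of _ R]) (intro continuous_intros cf D, simp add: D)
  moreover have i2: "integrable lborel (\<lambda>x. g x $ i * \<phi> x)"
    by (rule integrable_compact_support[of _ R]) (intro continuous_intros cg D, simp add: D)
  ultimately have "(LINT x|lborel. f x * D i x) = - (LINT x|lborel. g x $ i * \<phi> x)"
    by (simp add: F_axis)
  thus "(LINT x|lebesgue. f x * frechet_derivative \<phi> (at x) (axis i 1)) = - (LINT x|lebesgue. g x $ i * \<phi> x)"
    using i1 i2 by (simp add: D(6) integral_completion borel_measurable_integrable)
qed

lemma weak_grad_AE:
  assumes "has_weak_gradient f g"
  shows "AE x in lborel. weak_grad f x = g x" "has_weak_gradient f (weak_grad f)"
proof -
  show w: "has_weak_gradient f (weak_grad f)"
    unfolding weak_grad_def using someI[of "has_weak_gradient f", OF assms] .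
  show "AE x in lborel. weak_grad f x = g x" by (rule has_weak_gradient_unique[OF w assms])
qed

lemma norm_L1_weak_grad:
  assumes "has_weak_gradient f g"
  shows "norm_L1 (weak_grad f) = (\<integral>\<^sup>+x. ennreal (norm (g x)) \<partial>lborel)"
  unfolding norm_L1_def nn_integral_completion
  by (rule nn_integral_cong_AE) (use weak_grad_AE(1)[OF assms] in eventually_elim, simp)

text \<open>Functions that agree almost everywhere have the same predicate of weak gradients, so the
  choice operator picks literally the same function. This lets the continuous \<open>h 0\<close>
  stand for the datum \<open>h0\<close>.\<close>

lemma weak_grad_cong:
  fixes f f' :: "real ^ 'n \<Rightarrow> real"
  assumes "AE x in lebesgue. f x = f' x"
  shows "has_weak_gradient f = has_weak_gradient f'" "weak_grad f = weak_grad f'"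
proof -
  have imp: "has_weak_gradient f' g" if "has_weak_gradient f g" and ae: "AE x in lebesgue. f x = f' x" for f f' :: "real ^ 'n \<Rightarrow> real" and g
  proof -
    have li: "locally_integrable f" using that by (simp add: has_weak_gradient_def)
    have fm[measurable]: "f \<in> borel_measurable lebesgue" by (rule locally_integrable_measurable[OF li])
    have f'm[measurable]: "f' \<in> borel_measurable lebesgue"
      by (rule borel_measurable_AE[OF fm ae])
    have "locally_integrable f'"
      unfolding locally_integrable_def set_integrable_def
    proof (intro allI impI)
      fix S :: "(real^'n) set" assume S: "compact S"
      hence int: "integrable lebesgue (\<lambda>x. indicator S x *\<^sub>R f x)"
        using li unfolding locally_integrable_def set_integrable_def by blast
      have ae': "AE x in lebesgue. indicator S x *\<^sub>R f x = indicator S x *\<^sub>R f' x"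
        using ae by eventually_elim simp
      show "integrable lebesgue (\<lambda>x. indicator S x *\<^sub>R f' x)"
        by (rule integrable_cong_AE_imp[OF int borel_measurable_AE[OF borel_measurable_integrable[OF int] ae'] ae'])
    qed
    moreover have "(LINT x|lebesgue. f' x * frechet_derivative \<phi> (at x) (axis i 1))
        = (LINT x|lebesgue. f x * frechet_derivative \<phi> (at x) (axis i 1))" if "test_function \<phi>" for \<phi> i
    proof (rule integral_cong_AE)
      obtain D where D: "continuous_on UNIV (D i)" "\<And>x. frechet_derivative \<phi> (at x) (axis i 1) = D i x"
        using test_functionE[OF \<open>test_function \<phi>\<close>] by metis
      have [measurable]: "D i \<in> borel_measurable lebesgue"
        by (intro measurable_completion) (simp add: borel_measurable_continuous_onI[OF D(1)])
      show "(\<lambda>x. f' x * frechet_derivative \<phi> (at x) (axis i 1)) \<in> borel_measurable lebesgue"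
        "(\<lambda>x. f x * frechet_derivative \<phi> (at x) (axis i 1)) \<in> borel_measurable lebesgue"
        unfolding D(2) by measurable
      show "AE x in lebesgue. f' x * frechet_derivative \<phi> (at x) (axis i 1) = f x * frechet_derivative \<phi> (at x) (axis i 1)"
        using ae by eventually_elim simp
    qed
    ultimately show ?thesis using that(1) unfolding has_weak_gradient_def by simp
  qed
  have "AE x in lebesgue. f' x = f x" using assms by eventually_elim simp
  with imp assms show "has_weak_gradient f = has_weak_gradient f'" by blast
  thus "weak_grad f = weak_grad f'" by (simp add: weak_grad_def)
qed

section \<open>Difference quotients of weakly differentiable functions\<close>

lemma locally_integrable_diff:
  fixes f g :: "real ^ 'n \<Rightarrow> 'b::euclidean_space"
  assumes "locally_integrable f" "locally_integrable g"
  shows "locally_integrable (\<lambda>x. f x - g x)"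
  using assms unfolding locally_integrable_def by (auto intro: set_integral_diff(1))

lemma smooth_shift:
  assumes "smooth (f :: real ^ 'n \<Rightarrow> real)"
  shows "smooth (\<lambda>x. f (x + c))"
proof -
  obtain F where F: "F [] = f" "\<And>is x. (F is has_derivative (\<lambda>v. \<Sum>i\<in>UNIV. v $ i * F (i # is) x)) (at x)"
    using assms unfolding smooth_def by blast
  have "((\<lambda>x. F is (x + c)) has_derivative (\<lambda>v. \<Sum>i\<in>UNIV. v $ i * F (i # is) (x + c))) (at x)" for "is" x
  proof -
    have "((\<lambda>x. x + c) has_derivative (\<lambda>v. v)) (at x)" by (auto intro!: derivative_eq_intros)
    from has_derivative_compose[OF this, OF F(2)] show ?thesis by simp
  qed
  thus ?thesis unfolding smooth_def by (intro exI[of _ "\<lambda>is x. F is (x + c)"]) (simp add: F(1))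
qed

lemma test_function_shift:
  assumes "test_function (\<phi> :: real ^ 'n \<Rightarrow> real)"
  shows "test_function (\<lambda>x. \<phi> (x + c))"
  unfolding test_function_def
proof
  show "smooth (\<lambda>x. \<phi> (x + c))" using assms by (auto simp: test_function_def intro: smooth_shift)
  obtain R where R: "\<And>x. norm x > R \<Longrightarrow> \<phi> x = 0" using test_functionE[OF assms] by metis
  have "norm x \<le> R + norm c" if "\<phi> (x + c) \<noteq> 0" for x
  proof -
    have "norm (x + c) \<le> R" using R[of "x + c"] that by force
    thus ?thesis using norm_diff_ineq[of x c] by linarith
  qed
  hence "bounded {x. \<phi> (x + c) \<noteq> 0}" by (intro boundedI[of _ "R + norm c"]) auto
  thus "compact (closure {x. \<phi> (x + c) \<noteq> 0})" by simp
qed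

lemma continuous_AE_le_imp_le:
  fixes k :: "'a::euclidean_space \<Rightarrow> real"
  assumes "continuous_on UNIV k" and "AE x in lborel. k x \<le> c"
  shows "k x \<le> c"
proof (rule ccontr)
  assume "\<not> k x \<le> c"
  have op: "open {x. k x > c}" by (intro open_Collect_less continuous_intros assms)
  have "AE x in lebesgue. x \<notin> {x. k x > c}"
    using AE_completion[OF assms(2)] by eventually_elim auto
  hence "{x. k x > c} \<in> null_sets lebesgue"
    using op by (subst (asm) AE_iff_null_sets[symmetric]) (auto intro: borel_open sets_completionI_sets)
  hence "negligible {x. k x > c}" by (simp add: negligible_iff_null_sets)
  moreover have "{x. k x > c} \<noteq> {}" using \<open>\<not> k x \<le> c\<close> by (auto simp: not_le)
  ultimately show False using open_not_negligible[OF op] by blast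
qed

text \<open>The Borel representative \<open>G'\<close> of the i-th component makes
  \<open>G' (x + \<theta> *\<^sub>R axis i 1)\<close> jointly measurable in \<open>\<theta>\<close>
  and \<open>x\<close>, as Fubini's theorem demands.\<close>

locale weak_difference =
  fixes f :: "real ^ 'n \<Rightarrow> real" and G :: "real ^ 'n \<Rightarrow> real ^ 'n" and G' :: "real ^ 'n \<Rightarrow> real"
    and i :: 'n and \<epsilon> :: real
  assumes weak: "has_weak_gradient f G" and cont: "continuous_on UNIV f"
    and G'[measurable]: "G' \<in> borel_measurable borel" and ae: "AE x in lborel. G x $ i = G' x"
    and eps: "\<epsilon> > 0"
begin

text \<open>What the fundamental theorem of calculus predicts for the increment of \<open>f\<close>
  over the step \<open>\<epsilon>\<close> along the i-th axis.\<close>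

definition avg :: "real ^ 'n \<Rightarrow> real" where
  "avg x = (LINT \<theta>|lborel. indicator {0..\<epsilon>} \<theta> * G' (x + \<theta> *\<^sub>R axis i 1))"

lemma borel_measurable_avg [measurable]: "avg \<in> borel_measurable borel"
  unfolding avg_def by measurable

lemma nn_integral_cball_finite: "(\<integral>\<^sup>+x. indicator (cball 0 R) x * ennreal \<bar>G' x\<bar> \<partial>lborel) < \<infinity>"
proof -
  have "locally_integrable (\<lambda>x. G x $ i)"
    using weak by (auto simp: has_weak_gradient_def intro: locally_integrable_component)
  hence "integrable lebesgue (\<lambda>x. indicator (cball 0 R) x *\<^sub>R (G x $ i))"
    unfolding locally_integrable_def set_integrable_def by auto
  hence "(\<integral>\<^sup>+x. ennreal (norm (indicator (cball 0 R) x *\<^sub>R (G x $ i))) \<partial>lebesgue) < \<infinity>"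
    by (simp add: integrable_iff_bounded)
  also have "(\<integral>\<^sup>+x. ennreal (norm (indicator (cball 0 R) x *\<^sub>R (G x $ i))) \<partial>lebesgue)
      = (\<integral>\<^sup>+x. indicator (cball 0 R) x * ennreal \<bar>G' x\<bar> \<partial>lborel)"
    unfolding nn_integral_completion
    by (rule nn_integral_cong_AE) (use ae in eventually_elim, auto simp: indicator_def)
  finally show ?thesis .
qed

text \<open>Local integrability suffices: for \<open>\<theta>\<close> between 0 and
  \<open>\<epsilon>\<close> the translated support of \<open>\<psi>\<close> stays in the ball of
  radius \<open>R + \<epsilon>\<close>.\<close>

lemma integrable_product:
  assumes [measurable]: "\<psi> \<in> borel_measurable borel" and C: "\<And>x. \<bar>\<psi> x\<bar> \<le> C" and supp: "\<And>x. norm x > R \<Longrightarrow> \<psi> x = 0"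
  shows "integrable (lborel \<Otimes>\<^sub>M lborel) (\<lambda>(\<theta>, x). indicator {0..\<epsilon>} \<theta> * G' (x + \<theta> *\<^sub>R axis i 1) * \<psi> x)"
proof (rule integrableI_bounded)
  let ?h = "\<lambda>\<theta> x. indicator {0..\<epsilon>} \<theta> * G' (x + \<theta> *\<^sub>R axis i 1) * \<psi> x"
  show "(\<lambda>(\<theta>, x). ?h \<theta> x) \<in> borel_measurable (lborel \<Otimes>\<^sub>M lborel)" by measurable
  have C0: "C \<ge> 0" using C[of 0] by linarith
  have ball_meas [measurable]: "cball (0::real^'n) (R + \<epsilon>) \<in> sets borel" by simp
  define K where "K = (\<integral>\<^sup>+x. indicator (cball 0 (R + \<epsilon>)) x * ennreal \<bar>G' x\<bar> \<partial>lborel)"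
  have K: "K < \<infinity>" unfolding K_def by (rule nn_integral_cball_finite)
  have inner: "(\<integral>\<^sup>+x. ennreal (norm (?h \<theta> x)) \<partial>lborel) \<le> indicator {0..\<epsilon>} \<theta> * (ennreal C * K)" for \<theta>
  proof (cases "\<theta> \<in> {0..\<epsilon>}")
    case True
    have "(\<integral>\<^sup>+x. ennreal (norm (?h \<theta> x)) \<partial>lborel)
       \<le> (\<integral>\<^sup>+x. ennreal C * (indicator (cball 0 (R + \<epsilon>)) (x + \<theta> *\<^sub>R axis i 1) * ennreal \<bar>G' (x + \<theta> *\<^sub>R axis i 1)\<bar>) \<partial>lborel)"
    proof (rule nn_integral_mono)
      fix x
      show "ennreal (norm (?h \<theta> x)) \<le> ennreal C * (indicator (cball 0 (R + \<epsilon>)) (x + \<theta> *\<^sub>R axis i 1) * ennreal \<bar>G' (x + \<theta> *\<^sub>R axis i 1)\<bar>)"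
      proof (cases "norm x > R")
        case True
        thus ?thesis using supp by simp
      next
        case False
        have "norm (x + \<theta> *\<^sub>R axis i 1) \<le> R + \<epsilon>"
          using False \<open>\<theta> \<in> {0..\<epsilon>}\<close> norm_triangle_ineq[of x "\<theta> *\<^sub>R axis i 1"] by (simp add: norm_axis_1)
        moreover have "norm (?h \<theta> x) \<le> C * \<bar>G' (x + \<theta> *\<^sub>R axis i 1)\<bar>"
          using C[of x] C0 \<open>\<theta> \<in> {0..\<epsilon>}\<close> by (simp add: abs_mult mult.commute[of _ "\<bar>\<psi> x\<bar>"] mult_right_mono)
        ultimately show ?thesis using C0 by (simp add: ennreal_mult[symmetric] ennreal_leI)
      qed
    qed
    also have "\<dots> = ennreal C * K"
    proof -
      have "(\<integral>\<^sup>+x. ennreal C * (indicator (cball 0 (R + \<epsilon>)) (x + \<theta> *\<^sub>R axis i 1) * ennreal \<bar>G' (x + \<theta> *\<^sub>R axis i 1)\<bar>) \<partial>lborel)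
         = (\<integral>\<^sup>+x. ennreal C * (indicator (cball 0 (R + \<epsilon>)) x * ennreal \<bar>G' x\<bar>) \<partial>lborel)"
        by (rule nn_integral_shift[of "\<lambda>x. ennreal C * (indicator (cball 0 (R + \<epsilon>)) x * ennreal \<bar>G' x\<bar>)"])
           (intro borel_measurable_times_ennreal borel_measurable_indicator ball_meas; measurable)
      thus ?thesis by (simp add: nn_integral_cmult K_def)
    qed
    finally show ?thesis using True by simp
  qed simp
  have "(\<integral>\<^sup>+p. ennreal (norm (case p of (\<theta>, x) \<Rightarrow> ?h \<theta> x)) \<partial>(lborel \<Otimes>\<^sub>M lborel))
      = (\<integral>\<^sup>+\<theta>. (\<integral>\<^sup>+x. ennreal (norm (?h \<theta> x)) \<partial>lborel) \<partial>lborel)"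
    by (subst lborel.nn_integral_fst[symmetric]) (simp_all, measurable)
  also have "\<dots> \<le> (\<integral>\<^sup>+\<theta>. indicator {0..\<epsilon>} \<theta> * (ennreal C * K) \<partial>lborel)"
    by (intro nn_integral_mono inner)
  also have "\<dots> = ennreal \<epsilon> * (ennreal C * K)"
    using eps by (simp add: nn_integral_multc)
  also have "\<dots> < \<infinity>" using K by (simp add: ennreal_mult_less_top)
  finally show "(\<integral>\<^sup>+p. ennreal (norm (case p of (\<theta>, x) \<Rightarrow> ?h \<theta> x)) \<partial>(lborel \<Otimes>\<^sub>M lborel)) < \<infinity>" .
qed

lemma avg_times:
  assumes "\<psi> \<in> borel_measurable borel" "\<And>x. \<bar>\<psi> x\<bar> \<le> C" "\<And>x. norm x > R \<Longrightarrow> \<psi> x = 0"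
  shows "integrable lborel (\<lambda>x. avg x * \<psi> x)"
    "(LINT x|lborel. avg x * \<psi> x) = (LINT \<theta>|lborel. indicator {0..\<epsilon>} \<theta> * (LINT x|lborel. G' (x + \<theta> *\<^sub>R axis i 1) * \<psi> x))"
proof -
  let ?h = "\<lambda>\<theta> x. indicator {0..\<epsilon>} \<theta> * G' (x + \<theta> *\<^sub>R axis i 1) * \<psi> x"
  have int: "integrable (lborel \<Otimes>\<^sub>M lborel) (case_prod ?h)" by (rule integrable_product[OF assms])

  show "integrable lborel (\<lambda>x. avg x * \<psi> x)"
    using lborel_pair.integrable_snd[OF int] by (simp add: avg_def)
  have "(LINT x|lborel. avg x * \<psi> x) = (LINT \<theta>|lborel. LINT x|lborel. ?h \<theta> x)"
    using lborel_pair.Fubini_integral[OF int] by (simp add: avg_def)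
  thus "(LINT x|lborel. avg x * \<psi> x) = (LINT \<theta>|lborel. indicator {0..\<epsilon>} \<theta> * (LINT x|lborel. G' (x + \<theta> *\<^sub>R axis i 1) * \<psi> x))"
    by (simp add: mult.assoc)
qed

lemma locally_integrable_avg: "locally_integrable avg"
  unfolding locally_integrable_def set_integrable_def
proof (intro allI impI)
  fix S :: "(real^'n) set" assume S: "compact S"
  then obtain R where R: "\<And>x. x \<in> S \<Longrightarrow> norm x \<le> R" using compact_imp_bounded bounded_iff by metis
  have "integrable lborel (\<lambda>x. avg x * indicator S x)"
  proof (rule avg_times(1)[where C = 1 and R = R])
    show "(indicator S :: real^'n \<Rightarrow> real) \<in> borel_measurable borel"
      using S by (intro borel_measurable_indicator borel_compact)
    show "\<bar>indicator S x :: real\<bar> \<le> 1" for x by (auto simp: indicator_def)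
    show "(indicator S x :: real) = 0" if "norm x > R" for x using R[of x] that by (force simp: indicator_def)
  qed
  thus "integrable lebesgue (\<lambda>x. indicator S x *\<^sub>R avg x)"
    by (intro integrable_lebesgue_if_lborel) (simp add: mult.commute)
qed

text \<open>With the translation put on the test function, \<open>\<Psi> \<theta>\<close> is
  differentiable in \<open>\<theta>\<close>. The definition of the weak gradient identifies its
  derivative with \<open>\<rho> \<theta>\<close>, and integrating from 0 to
  \<open>\<epsilon>\<close> gives the claim.\<close>

lemma avg_test:
  assumes \<phi>: "test_function \<phi>"
  shows "(LINT \<theta>|lborel. indicator {0..\<epsilon>} \<theta> * (LINT x|lborel. G' (x + \<theta> *\<^sub>R axis i 1) * \<phi> x))
     = (LINT x|lborel. f (x + \<epsilon> *\<^sub>R axis i 1) * \<phi> x) - (LINT x|lborel. f x * \<phi> x)"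
proof -
  obtain D R where R: "R > 0" and D: "\<And>x. (\<phi> has_derivative (\<lambda>v. \<Sum>i\<in>UNIV. v $ i * D i x)) (at x)"
    "\<And>i. continuous_on UNIV (D i)" "continuous_on UNIV \<phi>"
    "\<And>x. norm x > R \<Longrightarrow> \<phi> x = 0" "\<And>i x. norm x > R \<Longrightarrow> D i x = 0"
    by (rule test_functionE[OF \<phi>]) blast
  let ?e = "axis i 1 :: real^'n"
  have axis_sum: "(\<Sum>j\<in>UNIV. ?e $ j * D j x) = D i x" for x
    by (simp add: axis_def if_distrib[of "\<lambda>t. t * _"] cong: if_cong)
  have [measurable]: "f \<in> borel_measurable borel" "\<phi> \<in> borel_measurable borel"
    by (simp_all add: borel_measurable_continuous_onI cont D)
  define \<rho> where "\<rho> \<theta> = (LINT x|lborel. G' (x + \<theta> *\<^sub>R ?e) * \<phi> x)" for \<theta>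
  define \<Psi> where "\<Psi> \<theta> = (LINT y|lborel. f y * \<phi> (y - \<theta> *\<^sub>R ?e))" for \<theta>
  let ?R = "R + \<epsilon>"
  let ?Q = "cbox (- (?R *\<^sub>R One)) (?R *\<^sub>R One) :: (real^'n) set"
  have far: "norm (y - \<theta> *\<^sub>R ?e) > R" if "norm y > ?R" "\<theta> \<in> {0..\<epsilon>}" for y \<theta>
    using that norm_triangle_sub[of y "\<theta> *\<^sub>R ?e"] by (simp add: norm_axis_1)
  have cD: "continuous_on S (\<lambda>p. D i (k p))" if "continuous_on S k" for S :: "'z::topological_space set" and k
    by (rule continuous_on_compose2[OF D(2) that]) auto
  have c\<phi>: "continuous_on S (\<lambda>p. \<phi> (k p))" if "continuous_on S k" for S :: "'z::topological_space set" and k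
    by (rule continuous_on_compose2[OF D(3) that]) auto
  have cf: "continuous_on S (\<lambda>p. f (k p))" if "continuous_on S k" for S :: "'z::topological_space set" and k
    by (rule continuous_on_compose2[OF cont that]) auto
  have \<rho>_eq: "\<rho> \<theta> = integral ?Q (\<lambda>y. - (f y * D i (y - \<theta> *\<^sub>R ?e)))" if \<theta>: "\<theta> \<in> {0..\<epsilon>}" for \<theta>
  proof -
    have t: "test_function (\<lambda>y. \<phi> (y + - (\<theta> *\<^sub>R ?e)))" by (rule test_function_shift[OF \<phi>])
    have fd: "frechet_derivative (\<lambda>y. \<phi> (y + - (\<theta> *\<^sub>R ?e))) (at y) ?e = D i (y - \<theta> *\<^sub>R ?e)" for y
    proof -
      have "((\<lambda>y. y + - (\<theta> *\<^sub>R ?e)) has_derivative (\<lambda>v. v)) (at y)" by (auto intro!: derivative_eq_intros)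
      from has_derivative_compose[OF this, OF D(1)]
      have "((\<lambda>y. \<phi> (y + - (\<theta> *\<^sub>R ?e))) has_derivative (\<lambda>v. \<Sum>i\<in>UNIV. v $ i * D i (y - \<theta> *\<^sub>R ?e))) (at y)" by simp
      thus ?thesis by (simp add: frechet_derivative_at[symmetric] axis_sum)
    qed
    have "\<rho> \<theta> = (LINT x|lborel. G' (x + \<theta> *\<^sub>R ?e) * \<phi> ((x + \<theta> *\<^sub>R ?e) + - (\<theta> *\<^sub>R ?e)))"
      by (simp add: \<rho>_def)
    also have "\<dots> = (LINT y|lborel. G' y * \<phi> (y + - (\<theta> *\<^sub>R ?e)))"
      by (rule lborel_integral_shift[of "\<lambda>y. G' y * \<phi> (y + - (\<theta> *\<^sub>R ?e))"]) measurable
    also have "\<dots> = (LINT y|lebesgue. G' y * \<phi> (y + - (\<theta> *\<^sub>R ?e)))"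
      by (subst integral_completion) auto
    also have "\<dots> = (LINT y|lebesgue. G y $ i * \<phi> (y + - (\<theta> *\<^sub>R ?e)))"
    proof (rule integral_cong_AE)
      have "locally_integrable (\<lambda>x. G x $ i)"
        using weak by (auto simp: has_weak_gradient_def intro: locally_integrable_component)
      note [measurable] = locally_integrable_measurable[OF this]
      have [measurable]: "(\<lambda>y. \<phi> (y + - (\<theta> *\<^sub>R ?e))) \<in> borel_measurable lebesgue" "G' \<in> borel_measurable lebesgue"
        by (intro measurable_completion; measurable)+
      show "(\<lambda>y. G' y * \<phi> (y + - (\<theta> *\<^sub>R ?e))) \<in> borel_measurable lebesgue"
        "(\<lambda>y. G y $ i * \<phi> (y + - (\<theta> *\<^sub>R ?e))) \<in> borel_measurable lebesgue" by measurable
      show "AE y in lebesgue. G' y * \<phi> (y + - (\<theta> *\<^sub>R ?e)) = G y $ i * \<phi> (y + - (\<theta> *\<^sub>R ?e))"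
        unfolding AE_completion_iff using ae by eventually_elim simp
    qed
    also have "\<dots> = - (LINT y|lebesgue. f y * D i (y - \<theta> *\<^sub>R ?e))"
      using weak t unfolding has_weak_gradient_def fd[symmetric] by simp
    also have "(LINT y|lebesgue. f y * D i (y - \<theta> *\<^sub>R ?e)) = (LINT y|lborel. f y * D i (y - \<theta> *\<^sub>R ?e))"
      by (subst integral_completion) (auto intro!: borel_measurable_continuous_onI continuous_intros cont cD)
    finally have "\<rho> \<theta> = (LINT y|lborel. - (f y * D i (y - \<theta> *\<^sub>R ?e)))" by simp
    also have "\<dots> = integral ?Q (\<lambda>y. - (f y * D i (y - \<theta> *\<^sub>R ?e)))"
      by (rule integral_cbox_eq_lborel[symmetric])
         (intro continuous_intros cont cD, use D(5) far[OF _ \<theta>] in simp)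
    finally show ?thesis .
  qed
  have \<Psi>_eq: "\<Psi> \<theta> = integral ?Q (\<lambda>y. f y * \<phi> (y - \<theta> *\<^sub>R ?e))" if \<theta>: "\<theta> \<in> {0..\<epsilon>}" for \<theta>
    unfolding \<Psi>_def
    by (rule integral_cbox_eq_lborel[symmetric])
       (intro continuous_intros cont c\<phi>, use D(4) far[OF _ \<theta>] in simp)
  have der: "(\<Psi> has_real_derivative \<rho> \<theta>) (at \<theta> within {0..\<epsilon>})" if \<theta>: "\<theta> \<in> {0..\<epsilon>}" for \<theta>
  proof -
    have "((\<lambda>\<theta>. integral ?Q (\<lambda>y. f y * \<phi> (y - \<theta> *\<^sub>R ?e))) has_real_derivative
        integral ?Q (\<lambda>y. - (f y * D i (y - \<theta> *\<^sub>R ?e)))) (at \<theta> within {0..\<epsilon>})"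
    proof (rule leibniz_rule_field_derivative[where fx = "\<lambda>\<theta> y. - (f y * D i (y - \<theta> *\<^sub>R ?e))"])
      fix \<theta> y
      have 1: "((\<lambda>\<theta>. y - \<theta> *\<^sub>R ?e) has_derivative (\<lambda>h. - (h *\<^sub>R ?e))) (at \<theta>)"
        by (auto intro!: derivative_eq_intros)
      have "((\<lambda>\<theta>. \<phi> (y - \<theta> *\<^sub>R ?e)) has_derivative (\<lambda>h. \<Sum>j\<in>UNIV. (- (h *\<^sub>R ?e)) $ j * D j (y - \<theta> *\<^sub>R ?e))) (at \<theta>)"
        by (rule has_derivative_compose[OF 1, OF D(1)])
      moreover have "(\<lambda>h. \<Sum>j\<in>UNIV. (- (h *\<^sub>R ?e)) $ j * D j (y - \<theta> *\<^sub>R ?e)) = (\<lambda>h. - D i (y - \<theta> *\<^sub>R ?e) * h)"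
      proof
        fix h
        have "(\<Sum>j\<in>UNIV. (- (h *\<^sub>R ?e)) $ j * D j (y - \<theta> *\<^sub>R ?e)) = - h * (\<Sum>j\<in>UNIV. ?e $ j * D j (y - \<theta> *\<^sub>R ?e))"
          by (simp add: sum_distrib_left sum_negf mult_ac)
        thus "(\<Sum>j\<in>UNIV. (- (h *\<^sub>R ?e)) $ j * D j (y - \<theta> *\<^sub>R ?e)) = - D i (y - \<theta> *\<^sub>R ?e) * h"
          by (simp add: axis_sum)
      qed
      ultimately have "((\<lambda>\<theta>. \<phi> (y - \<theta> *\<^sub>R ?e)) has_real_derivative - D i (y - \<theta> *\<^sub>R ?e)) (at \<theta>)"
        unfolding has_field_derivative_def by (simp only:)
      from has_field_derivative_at_within[OF DERIV_cmult[OF this, of "f y"]]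
      show "((\<lambda>\<theta>. f y * \<phi> (y - \<theta> *\<^sub>R ?e)) has_real_derivative - (f y * D i (y - \<theta> *\<^sub>R ?e))) (at \<theta> within {0..\<epsilon>})"
        by simp
    next
      fix \<theta>
      show "(\<lambda>y. f y * \<phi> (y - \<theta> *\<^sub>R ?e)) integrable_on ?Q"
        by (intro integrable_continuous continuous_intros c\<phi> continuous_on_subset[OF cont]) auto
    next
      show "continuous_on ({0..\<epsilon>} \<times> ?Q) (\<lambda>(\<theta>, y). - (f y * D i (y - \<theta> *\<^sub>R ?e)))"
        unfolding case_prod_beta by (intro continuous_intros cf cD)
    qed (use \<theta> in auto)
    hence "((\<lambda>\<theta>. integral ?Q (\<lambda>y. f y * \<phi> (y - \<theta> *\<^sub>R ?e))) has_real_derivative \<rho> \<theta>) (at \<theta> within {0..\<epsilon>})"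
      by (simp only: \<rho>_eq[OF \<theta>])
    thus ?thesis
      by (rule has_field_derivative_transform_within[OF _ zero_less_one \<theta>]) (simp add: \<Psi>_eq)
  qed
  have ftc: "(\<rho> has_integral (\<Psi> \<epsilon> - \<Psi> 0)) {0..\<epsilon>}"
    by (rule fundamental_theorem_of_calculus)
       (use eps der in \<open>auto simp: has_real_derivative_iff_has_vector_derivative\<close>)
  have c\<rho>: "continuous_on {0..\<epsilon>} \<rho>"
  proof -
    have "continuous_on {0..\<epsilon>} (\<lambda>\<theta>. integral ?Q (\<lambda>y. - (f y * D i (y - \<theta> *\<^sub>R ?e))))"
      by (rule integral_continuous_on_param) (unfold case_prod_beta, intro continuous_intros cf cD)
    also have "?this \<longleftrightarrow> ?thesis" by (rule continuous_on_cong) (auto simp: \<rho>_eq)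
    finally show ?thesis .
  qed
  have "set_integrable lborel {0..\<epsilon>} \<rho>"
    unfolding set_integrable_def by (rule borel_integrable_compact[OF compact_Icc c\<rho>])
  from set_borel_integral_eq_integral(2)[OF this]
  have "(LINT \<theta>|lborel. indicator {0..\<epsilon>} \<theta> * \<rho> \<theta>) = \<Psi> \<epsilon> - \<Psi> 0"
    using integral_unique[OF ftc] by (simp add: set_lebesgue_integral_def)
  moreover have "\<Psi> \<epsilon> = (LINT x|lborel. f (x + \<epsilon> *\<^sub>R ?e) * \<phi> x)"
    using lborel_integral_shift[of "\<lambda>y. f y * \<phi> (y - \<epsilon> *\<^sub>R ?e)" "\<epsilon> *\<^sub>R ?e"] by (simp add: \<Psi>_def)
  moreover have "\<Psi> 0 = (LINT x|lborel. f x * \<phi> x)" by (simp add: \<Psi>_def)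
  ultimately show ?thesis by (simp add: \<rho>_def)
qed

lemma difference_eq_avg: "AE x in lborel. f (x + \<epsilon> *\<^sub>R axis i 1) - f x = avg x"
proof -
  have cs: "continuous_on UNIV (\<lambda>x. f (x + \<epsilon> *\<^sub>R axis i 1))"
    by (rule continuous_on_compose2[OF cont]) (auto intro!: continuous_intros)
  have [measurable]: "f \<in> borel_measurable borel"
    by (simp add: borel_measurable_continuous_onI cont)
  have "AE x in lborel. (f (x + \<epsilon> *\<^sub>R axis i 1) - f x) - avg x = 0"
  proof (rule fundamental_lemma_of_calculus_of_variations)
    have "locally_integrable (\<lambda>x. f (x + \<epsilon> *\<^sub>R axis i 1) - f x)"
      by (intro locally_integrable_if_continuous continuous_intros cs cont)
    thus "locally_integrable (\<lambda>x. (f (x + \<epsilon> *\<^sub>R axis i 1) - f x) - avg x)"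
      using locally_integrable_avg by (rule locally_integrable_diff)
    fix \<phi> :: "real^'n \<Rightarrow> real" assume \<phi>: "test_function \<phi>"
    obtain R where R: "continuous_on UNIV \<phi>" "\<And>x. norm x > R \<Longrightarrow> \<phi> x = 0"
      using test_functionE[OF \<phi>] by metis
    have [measurable]: "\<phi> \<in> borel_measurable borel" by (rule borel_measurable_continuous_onI[OF R(1)])
    have "compact (\<phi> ` cball 0 R)" by (intro compact_continuous_image continuous_on_subset[OF R(1)]) auto
    then obtain C where C: "\<And>x. x \<in> cball 0 R \<Longrightarrow> \<bar>\<phi> x\<bar> \<le> C"
      by (metis bounded_real compact_imp_bounded imageI)
    have C': "\<bar>\<phi> x\<bar> \<le> \<bar>C\<bar>" for x using C[of x] R(2)[of x] by (cases "norm x > R") auto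
    have i1: "integrable lborel (\<lambda>x. f (x + \<epsilon> *\<^sub>R axis i 1) * \<phi> x)"
      by (rule integrable_compact_support[of _ R]) (intro continuous_intros cs R, simp add: R)
    have i2: "integrable lborel (\<lambda>x. f x * \<phi> x)"
      by (rule integrable_compact_support[of _ R]) (intro continuous_intros cont R, simp add: R)
    have i3: "integrable lborel (\<lambda>x. avg x * \<phi> x)" by (rule avg_times(1)[OF _ C' R(2)]) simp
    have "(LINT x|lborel. avg x * \<phi> x) = (LINT x|lborel. f (x + \<epsilon> *\<^sub>R axis i 1) * \<phi> x) - (LINT x|lborel. f x * \<phi> x)"
      using avg_times(2)[OF _ C' R(2)] avg_test[OF \<phi>] by simp
    hence "(LINT x|lborel. ((f (x + \<epsilon> *\<^sub>R axis i 1) - f x) - avg x) * \<phi> x) = 0"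
      using i1 i2 i3 by (simp add: left_diff_distrib)
    thus "(LINT x|lebesgue. ((f (x + \<epsilon> *\<^sub>R axis i 1) - f x) - avg x) * \<phi> x) = 0"
      by (subst integral_completion) auto
  qed
  thus ?thesis by eventually_elim simp
qed

end

text \<open>The increment is \<open>avg\<close>. Exchanging the integrals leaves, for each
  \<open>\<theta>\<close>, the norm of a translate of \<open>G'\<close>, which does not depend on
  \<open>\<theta>\<close>.\<close>

lemma nn_integral_difference_le:
  fixes f :: "real ^ 'n \<Rightarrow> real"
  assumes weak: "has_weak_gradient f G" and cont: "continuous_on UNIV f" and eps: "\<epsilon> > 0"
  shows "(\<integral>\<^sup>+x. ennreal \<bar>f (x + \<epsilon> *\<^sub>R axis i 1) - f x\<bar> \<partial>lborel) \<le> ennreal \<epsilon> * norm_L1 G"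
proof -
  have "locally_integrable (\<lambda>x. G x $ i)"
    using weak by (auto simp: has_weak_gradient_def intro: locally_integrable_component)
  then obtain G' where G'[measurable]: "G' \<in> borel_measurable borel" and ae: "AE x in lborel. G x $ i = G' x"
    using borel_representative[OF locally_integrable_measurable] by blast
  interpret weak_difference f G G' i \<epsilon>
    by standard (use weak cont eps G' ae in auto)
  have "(\<integral>\<^sup>+x. ennreal \<bar>f (x + \<epsilon> *\<^sub>R axis i 1) - f x\<bar> \<partial>lborel) = (\<integral>\<^sup>+x. ennreal \<bar>avg x\<bar> \<partial>lborel)"
    by (rule nn_integral_cong_AE) (use difference_eq_avg in eventually_elim, simp)
  also have "\<dots> \<le> (\<integral>\<^sup>+x. \<integral>\<^sup>+\<theta>. indicator {0..\<epsilon>} \<theta> * ennreal \<bar>G' (x + \<theta> *\<^sub>R axis i 1)\<bar> \<partial>lborel \<partial>lborel)"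
  proof (rule nn_integral_mono)
    fix x
    have "ennreal \<bar>avg x\<bar> \<le> (\<integral>\<^sup>+\<theta>. ennreal (norm (indicator {0..\<epsilon>} \<theta> * G' (x + \<theta> *\<^sub>R axis i 1))) \<partial>lborel)"
    proof (cases "integrable lborel (\<lambda>\<theta>. indicator {0..\<epsilon>} \<theta> * G' (x + \<theta> *\<^sub>R axis i 1))")
      case True
      thus ?thesis using integral_norm_bound_ennreal[OF True] by (simp add: avg_def)
    next
      \<comment> \<open>The Bochner integral of a non-integrable function is 0, so the bound is
        trivial on such a line.\<close>
      case False
      thus ?thesis by (simp add: avg_def not_integrable_integral_eq)
    qed
    also have "\<dots> = (\<integral>\<^sup>+\<theta>. indicator {0..\<epsilon>} \<theta> * ennreal \<bar>G' (x + \<theta> *\<^sub>R axis i 1)\<bar> \<partial>lborel)"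
      by (intro nn_integral_cong) (auto simp: indicator_def)
    finally show "ennreal \<bar>avg x\<bar> \<le> \<dots>" .
  qed
  also have "\<dots> = (\<integral>\<^sup>+\<theta>. \<integral>\<^sup>+x. indicator {0..\<epsilon>} \<theta> * ennreal \<bar>G' (x + \<theta> *\<^sub>R axis i 1)\<bar> \<partial>lborel \<partial>lborel)"
    by (rule lborel_pair.Fubini') measurable
  also have "\<dots> = (\<integral>\<^sup>+\<theta>. indicator {0..\<epsilon>} \<theta> * (\<integral>\<^sup>+x. ennreal \<bar>G' x\<bar> \<partial>lborel) \<partial>lborel)"
  proof (rule nn_integral_cong)
    fix \<theta>
    have "(\<integral>\<^sup>+x. ennreal \<bar>G' (x + \<theta> *\<^sub>R axis i 1)\<bar> \<partial>lborel) = (\<integral>\<^sup>+x. ennreal \<bar>G' x\<bar> \<partial>lborel)"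
      by (rule nn_integral_shift) measurable
    thus "(\<integral>\<^sup>+x. indicator {0..\<epsilon>} \<theta> * ennreal \<bar>G' (x + \<theta> *\<^sub>R axis i 1)\<bar> \<partial>lborel) = indicator {0..\<epsilon>} \<theta> * (\<integral>\<^sup>+x. ennreal \<bar>G' x\<bar> \<partial>lborel)"
      by (simp add: nn_integral_cmult)
  qed
  also have "\<dots> = ennreal \<epsilon> * (\<integral>\<^sup>+x. ennreal \<bar>G' x\<bar> \<partial>lborel)"
    using eps by (simp add: nn_integral_multc)
  also have "(\<integral>\<^sup>+x. ennreal \<bar>G' x\<bar> \<partial>lborel) \<le> norm_L1 G"
    unfolding norm_L1_def nn_integral_completion
  proof (rule nn_integral_mono_AE)
    show "AE x in lborel. ennreal \<bar>G' x\<bar> \<le> ennreal (norm (G x))"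
      using ae
    proof eventually_elim
      case (elim x)
      thus ?case using component_le_norm_cart[of "G x" i] by (simp add: ennreal_leI)
    qed
  qed
  finally show ?thesis by (simp add: mult_left_mono)
qed

lemma difference_le:
  fixes f :: "real ^ 'n \<Rightarrow> real"
  assumes weak: "has_weak_gradient f G" and cont: "continuous_on UNIV f"
    and M: "AE x in lborel. norm (G x) \<le> M"
  shows "\<bar>f (x + \<epsilon> *\<^sub>R axis i 1) - f x\<bar> \<le> M * \<bar>\<epsilon>\<bar>"
proof -
  have M0: "M \<ge> 0"
  proof (rule continuous_AE_le_imp_le[where k = "\<lambda>x::real^'n. 0"])
    show "AE x in (lborel :: (real^'n) measure). 0 \<le> M"
      by (rule eventually_mono[OF M]) (use norm_ge_zero order_trans in blast)
    show "continuous_on UNIV (\<lambda>x::real^'n. 0::real)" by simp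
  qed
  have pos: "\<bar>f (x + \<epsilon> *\<^sub>R axis i 1) - f x\<bar> \<le> M * \<epsilon>" if eps: "\<epsilon> > 0" for x \<epsilon>
  proof -
    have "locally_integrable (\<lambda>x. G x $ i)"
      using weak by (auto simp: has_weak_gradient_def intro: locally_integrable_component)
    then obtain G0 where G0[measurable]: "G0 \<in> borel_measurable borel" and ae0: "AE x in lborel. G x $ i = G0 x"
      using borel_representative[OF locally_integrable_measurable] by blast
    \<comment> \<open>Clamping to the range from \<open>- M\<close> to \<open>M\<close> makes
      \<open>avg\<close> bounded at every point; continuity of \<open>f\<close> then removes the
      exceptional null set.\<close>
    define G' where "G' x = max (- M) (min M (G0 x))" for x
    have [measurable]: "G' \<in> borel_measurable borel" unfolding G'_def by measurable
    have bd: "\<bar>G' x\<bar> \<le> M" for x using M0 by (auto simp: G'_def)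
    have ae: "AE x in lborel. G x $ i = G' x"
      using ae0 M
    proof eventually_elim
      case (elim x)
      have "\<bar>G x $ i\<bar> \<le> M" using component_le_norm_cart[of "G x" i] elim by linarith
      thus ?case using elim by (auto simp: G'_def)
    qed
    interpret weak_difference f G G' i \<epsilon>
      by standard (use weak cont eps ae in auto)
    have avg: "\<bar>avg x\<bar> \<le> M * \<epsilon>" for x
    proof -
      have i1: "integrable lborel (\<lambda>\<theta>::real. indicator {0..\<epsilon>} \<theta> *\<^sub>R M)" by (rule borel_integrable_compact) auto
      have b: "norm (indicator {0..\<epsilon>} \<theta> * G' (x + \<theta> *\<^sub>R axis i 1)) \<le> indicator {0..\<epsilon>} \<theta> *\<^sub>R M" for \<theta>
        using bd by (auto simp: indicator_def)
      have i2: "integrable lborel (\<lambda>\<theta>. indicator {0..\<epsilon>} \<theta> * G' (x + \<theta> *\<^sub>R axis i 1))"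
        by (rule Bochner_Integration.integrable_bound[OF i1]) (use b M0 in \<open>auto simp: indicator_def\<close>)
      have "\<bar>avg x\<bar> \<le> (LINT \<theta>|lborel. indicator {0..\<epsilon>} \<theta> *\<^sub>R M)"
        unfolding avg_def by (rule order_trans[OF integral_abs_bound integral_mono]) (use i1 i2 b in auto)
      also have "\<dots> = M * \<epsilon>" using eps by simp
      finally show ?thesis .
    qed
    show ?thesis
    proof (rule continuous_AE_le_imp_le[where k = "\<lambda>x. \<bar>f (x + \<epsilon> *\<^sub>R axis i 1) - f x\<bar>"])
      show "continuous_on UNIV (\<lambda>x. \<bar>f (x + \<epsilon> *\<^sub>R axis i 1) - f x\<bar>)"
        by (intro continuous_intros cont continuous_on_compose2[OF cont]) auto
      show "AE x in lborel. \<bar>f (x + \<epsilon> *\<^sub>R axis i 1) - f x\<bar> \<le> M * \<epsilon>"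
        using difference_eq_avg by eventually_elim (simp add: avg)
    qed
  qed
  consider "\<epsilon> > 0" | "\<epsilon> = 0" | "\<epsilon> < 0" by linarith
  thus ?thesis
  proof cases
    case 1 thus ?thesis using pos by simp
  next
    case 2 thus ?thesis by simp
  next
    case 3
    thus ?thesis using pos[of "- \<epsilon>" "x + \<epsilon> *\<^sub>R axis i 1"] by (simp add: abs_minus_commute)
  qed
qed

text \<open>The path from \<open>y\<close> to \<open>x\<close> changes one coordinate at a time, and
  each of these steps has length at most \<open>dist x y\<close>.\<close>

lemma lipschitz_if_coordinate_differences:
  fixes f :: "real ^ 'n \<Rightarrow> real"
  assumes "\<And>x i \<epsilon>. \<bar>f (x + \<epsilon> *\<^sub>R axis i 1) - f x\<bar> \<le> M * \<bar>\<epsilon>\<bar>" and "M \<ge> 0"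
  shows "\<bar>f x - f y\<bar> \<le> real CARD('n) * M * dist x y"
proof -
  have "\<bar>f (y + (\<Sum>i\<in>A. (x - y) $ i *\<^sub>R axis i 1)) - f y\<bar> \<le> real (card A) * (M * dist x y)" for A :: "'n set"
  proof (induction A rule: infinite_finite_induct)
    case (insert j A)
    let ?p = "y + (\<Sum>i\<in>A. (x - y) $ i *\<^sub>R axis i 1)"
    have "\<bar>f (?p + (x - y) $ j *\<^sub>R axis j 1) - f ?p\<bar> \<le> M * \<bar>(x - y) $ j\<bar>" by (rule assms(1))
    also have "\<dots> \<le> M * dist x y"
      using component_le_norm_cart[of "x - y" j] assms(2) by (simp add: dist_norm mult_left_mono)
    finally have "\<bar>f (?p + (x - y) $ j *\<^sub>R axis j 1) - f y\<bar> \<le> real (card A) * (M * dist x y) + M * dist x y"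
      using insert.IH by linarith
    thus ?case using insert.hyps by (simp add: algebra_simps)
  qed auto
  from this[of UNIV] show ?thesis
    using basis_expansion[of "x - y"] by (simp add: scalar_mult_eq_scaleR mult.assoc)
qed

section \<open>Maximum principle by doubling of variables\<close>

text \<open>Only earlier times are compared, because the maximum may sit at the end of the time
  interval.\<close>

lemma left_derivative_nonneg_at_max:
  fixes f :: "real \<Rightarrow> real"
  assumes "(f has_real_derivative D) (at b within {a..b})" and "a < b"
    and "\<And>r. r \<in> {a..b} \<Longrightarrow> f r \<le> f b"
  shows "D \<ge> 0"
proof (rule ccontr)
  assume "\<not> D \<ge> 0"
  then obtain d where d: "d > 0" "\<And>h. h > 0 \<Longrightarrow> b - h \<in> {a..b} \<Longrightarrow> h < d \<Longrightarrow> f b < f (b - h)"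
    using has_real_derivative_neg_dec_left[OF assms(1)] by auto
  define h where "h = min (d/2) (b - a)"
  have "h > 0" "b - h \<in> {a..b}" "h < d" using d assms(2) by (auto simp: h_def min_def)
  with d(2)[of h] assms(3)[of "b - h"] show False by force
qed

text \<open>\<open>f'\<close> is differentiable at 0 only. If \<open>D\<close> were positive,
  \<open>f'\<close> would be positive just to the right of 0 and \<open>f\<close> would exceed its
  maximum there.\<close>

lemma second_derivative_nonpos_at_max:
  fixes f :: "real \<Rightarrow> real"
  assumes f: "\<And>s. (f has_real_derivative f' s) (at s)"
    and f': "(f' has_real_derivative D) (at 0)"
    and mx: "\<And>s. f s \<le> f 0"
  shows "D \<le> 0"
proof (rule ccontr)
  assume "\<not> D \<le> 0"
  hence "D > 0" by simp
  have f0: "f' 0 = 0"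
    using DERIV_local_max[OF f[of 0], of 1] mx by auto
  obtain d where d: "d > 0" "\<And>h. h > 0 \<Longrightarrow> h < d \<Longrightarrow> f' 0 < f' (0 + h)"
    using has_real_derivative_pos_inc_right[OF f'] \<open>D > 0\<close> by auto
  have "\<exists>z>0. z < d/2 \<and> f (d/2) - f 0 = (d/2 - 0) * f' z"
    by (rule MVT2) (use d f in auto)
  then obtain z where z: "z > 0" "z < d/2" "f (d/2) - f 0 = d/2 * f' z" by auto
  have "f' z > 0" using d(2)[of z] z f0 by simp
  hence "f (d/2) - f 0 > 0" unfolding z(3) using d(1) by simp
  with mx[of "d/2"] show False by simp
qed

lemma has_real_derivative_along_line:
  fixes f :: "'a::real_normed_vector \<Rightarrow> real"
  assumes "\<And>x. (f has_derivative D x) (at x)"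
  shows "((\<lambda>s. f (x + s *\<^sub>R e)) has_real_derivative D (x + s *\<^sub>R e) e) (at s)"
proof -
  have 1: "((\<lambda>s. x + s *\<^sub>R e) has_derivative (\<lambda>s. s *\<^sub>R e)) (at s)"
    by (auto intro!: derivative_eq_intros)
  have der: "((\<lambda>s. f (x + s *\<^sub>R e)) has_derivative (\<lambda>h. D (x + s *\<^sub>R e) (h *\<^sub>R e))) (at s)"
    using has_derivative_compose[OF 1 assms] by simp
  have "linear (D (x + s *\<^sub>R e))"
    using assms has_derivative_linear by blast
  hence "(\<lambda>h. D (x + s *\<^sub>R e) (h *\<^sub>R e)) = (*) (D (x + s *\<^sub>R e) e)"
    by (auto simp: linear_cmul mult.commute)
  with der show ?thesis
    unfolding has_field_derivative_def by simp
qed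

lemma has_derivative_norm_diff:
  fixes x c :: "'a::real_inner"
  assumes "x \<noteq> c"
  shows "((\<lambda>x. norm (x - c)) has_derivative (\<lambda>v. sgn (x - c) \<bullet> v)) (at x)"
proof -
  have "((\<lambda>x. x - c) has_derivative (\<lambda>v. v)) (at x)"
    by (auto intro!: derivative_eq_intros)
  moreover have "(norm has_derivative (\<lambda>v. v \<bullet> sgn (x - c))) (at (x - c))"
    by (rule has_derivative_norm) (use assms in simp)
  ultimately have "((\<lambda>x. norm (x - c)) has_derivative (\<lambda>v. v \<bullet> sgn (x - c))) (at x)"
    by (rule has_derivative_compose)
  thus ?thesis by (subst inner_commute)
qed

lemma trace_eq_sum_axis: "trace A = (\<Sum>i\<in>UNIV. (A *v axis i 1) $ i)" for A :: "real ^ 'n ^ 'n"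
  by (simp add: trace_def matrix_vector_mul_component inner_axis column_def)

lemma inner_axis_1 [simp]: "(x::real^'n) \<bullet> axis i 1 = x $ i"
  by (simp add: inner_axis)

text \<open>Suppose the penalized function \<open>\<Phi>\<close> has a positive maximum at (t0, x0,
  y0). Then t0 > s and x0 \<noteq> y0, both gradients equal \<open>L t0\<close> times the same unit
  vector up to the penalty, and the Laplacians at the two points are ordered up to the penalty.
  \<open>Fmono\<close> says that \<open>L\<close> falls no faster than the nonlinearity permits, so
  subtracting the equations at the two points contradicts the sign of the time derivative.\<close>

lemma doubling_of_variables:
  fixes u ut :: "real \<Rightarrow> real ^ 'n \<Rightarrow> real" and g :: "real \<Rightarrow> real ^ 'n \<Rightarrow> real ^ 'n"
    and H :: "real \<Rightarrow> real ^ 'n \<Rightarrow> real ^ 'n ^ 'n" and F :: "real \<Rightarrow> real \<Rightarrow> real"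
  assumes nu: "\<nu> \<ge> 0" and sT: "s \<le> T"
    and cont: "continuous_on ({s..T} \<times> UNIV) (\<lambda>(t, x). u t x)"
    and bdd: "\<And>t x. t \<in> {s..T} \<Longrightarrow> \<bar>u t x\<bar> \<le> B"
    and uA: "\<And>t x. t \<in> {s..T} \<Longrightarrow> u t x \<in> A"
    and L: "\<And>t. t \<in> {s..T} \<Longrightarrow> (L has_real_derivative L' t) (at t within {s..T})"
    and Ll: "l > 0" "\<And>t. t \<in> {s..T} \<Longrightarrow> l \<le> L t \<and> L t \<le> Q"
    and L': "\<And>t. t \<in> {s..T} \<Longrightarrow> L' t \<le> 0"
    and ut: "\<And>t x. s < t \<Longrightarrow> t \<le> T \<Longrightarrow> ((\<lambda>r. u r x) has_real_derivative ut t x) (at t)"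
    and gu: "\<And>t x. s < t \<Longrightarrow> t \<le> T \<Longrightarrow> (u t has_derivative (\<lambda>v. g t x \<bullet> v)) (at x)"
    and Hu: "\<And>t x. s < t \<Longrightarrow> t \<le> T \<Longrightarrow> (g t has_derivative (\<lambda>v. H t x *v v)) (at x)"
    and gQ: "\<And>t x. s < t \<Longrightarrow> t \<le> T \<Longrightarrow> norm (g t x) \<le> Q"
    and pde: "\<And>t x. s < t \<Longrightarrow> t \<le> T \<Longrightarrow> ut t x = \<nu> * trace (H t x) + F (u t x) (norm (g t x))"
    and Flip: "\<And>a p q. a \<in> A \<Longrightarrow> p \<in> {0..Q} \<Longrightarrow> q \<in> {0..Q} \<Longrightarrow> \<bar>F a p - F a q\<bar> \<le> \<Lambda> * \<bar>p - q\<bar>"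
    and Fmono: "\<And>t a b. s < t \<Longrightarrow> t \<le> T \<Longrightarrow> a \<in> A \<Longrightarrow> b \<in> A \<Longrightarrow> b < a \<Longrightarrow>
                   F a (L t) - F b (L t) \<le> L' t / L t * (a - b)"
    and init: "\<And>x y. u s x - u s y \<le> L s * dist x y"
    and t: "t \<in> {s..T}"
  shows "u t x - u t y \<le> L t * dist x y"
proof -
  have B0: "B \<ge> 0" using bdd[OF t, of x] by linarith
  have Lam: "\<Lambda> \<ge> 0"
  proof -
    have "Q > 0" using Ll(1) Ll(2)[OF t] by linarith
    hence "0 \<le> \<Lambda> * Q" using Flip[OF uA[OF t], of 0 Q] by (auto intro: order_trans[OF abs_ge_zero])
    thus ?thesis using \<open>Q > 0\<close> by (simp add: zero_le_mult_iff)
  qed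
  \<comment> \<open>The three terms pay for the Laplacian of the penalty, for the change that the
    penalty causes in the norm of the gradient, and for strictness.\<close>
  define \<kappa> where "\<kappa> \<eta> = 2 * \<nu> * real CARD('n) * \<eta> + 2 * \<Lambda> * sqrt (2 * B * \<eta>) + \<eta>" for \<eta>
  have main: "u t x - u t y \<le> L t * dist x y + \<eta> * (norm x)\<^sup>2 + \<kappa> \<eta> * (t - s)"
    if \<eta>: "\<eta> > 0" for \<eta>
  proof (rule ccontr)
    assume neg: "\<not> ?thesis"
    define \<Phi> where "\<Phi> = (\<lambda>(t, x, y). u t x - u t y - L t * dist x y - \<eta> * (norm x)\<^sup>2 - \<kappa> \<eta> * (t - s))"
    have \<kappa>0: "\<kappa> \<eta> \<ge> 0" using \<eta> nu Lam B0 by (auto simp: \<kappa>_def)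
    \<comment> \<open>Where \<open>\<Phi>\<close> is positive, both \<eta> |x|^2 and l |x - y| are
      at most \<open>2 * B\<close>; this confines the maximum to a compact set.\<close>
    define r1 where "r1 = sqrt (2 * B / \<eta>)"
    define r2 where "r2 = r1 + 2 * B / l"
    have region: "x' \<in> cball 0 r1 \<and> y' \<in> cball 0 r2" if "t' \<in> {s..T}" "\<Phi> (t', x', y') > 0" for t' x' y'
    proof -
      have 1: "u t' x' - u t' y' \<le> 2 * B" using bdd[OF that(1), of x'] bdd[OF that(1), of y'] by linarith
      have 2: "L t' * dist x' y' \<ge> l * dist x' y'" using Ll(2)[OF that(1)] by (simp add: mult_right_mono)
      have l0: "l * dist x' y' \<ge> 0" using Ll(1) by simp
      have 3: "\<kappa> \<eta> * (t' - s) \<ge> 0" using \<kappa>0 that by simp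
      have e0: "\<eta> * (norm x')\<^sup>2 \<ge> 0" using \<eta> by simp
      have s: "u t' x' - u t' y' > L t' * dist x' y' + \<eta> * (norm x')\<^sup>2 + \<kappa> \<eta> * (t' - s)"
        using that(2) by (simp add: \<Phi>_def)
      have "\<eta> * (norm x')\<^sup>2 \<le> 2 * B" using s 1 2 3 l0 by linarith
      hence "(norm x')\<^sup>2 \<le> 2 * B / \<eta>" using \<eta> by (simp add: field_simps)
      hence nx: "norm x' \<le> r1" unfolding r1_def by (rule real_le_rsqrt)
      have "l * dist x' y' \<le> 2 * B" using s 1 2 3 e0 by linarith
      hence "dist x' y' \<le> 2 * B / l" using Ll(1) by (simp add: field_simps)
      moreover have "norm y' \<le> norm x' + dist x' y'"
        by (metis dist_commute dist_norm norm_triangle_sub)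
      ultimately show ?thesis using nx by (simp add: r2_def)
    qed
    define K where "K = {s..T} \<times> cball (0::real^'n) r1 \<times> cball (0::real^'n) r2"
    have "compact K" unfolding K_def by (intro compact_Times compact_cball compact_Icc)
    moreover have inK: "(t, x, y) \<in> K"
      using region[OF t, of x y] neg t by (auto simp: K_def \<Phi>_def)
    moreover have "continuous_on K \<Phi>"
    proof -
      have 1: "continuous_on K (\<lambda>p. u (fst p) (fst (snd p)))"
        by (rule continuous_on_compose2[OF cont, where f = "\<lambda>p. (fst p, fst (snd p))", simplified])
          (auto simp: K_def intro!: continuous_intros)
      have 2: "continuous_on K (\<lambda>p. u (fst p) (snd (snd p)))"
        by (rule continuous_on_compose2[OF cont, where f = "\<lambda>p. (fst p, snd (snd p))", simplified])
          (auto simp: K_def intro!: continuous_intros)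
      have "continuous_on {s..T} L"
        using L by (meson DERIV_continuous continuous_on_eq_continuous_within)
      hence 3: "continuous_on K (\<lambda>p. L (fst p))"
        by (rule continuous_on_compose2) (auto simp: K_def intro!: continuous_intros)
      show ?thesis unfolding \<Phi>_def case_prod_beta
        by (intro continuous_intros 1 2 3)
    qed
    ultimately obtain p where p: "p \<in> K" "\<And>q. q \<in> K \<Longrightarrow> \<Phi> q \<le> \<Phi> p"
      using continuous_attains_sup[of K \<Phi>] by (metis empty_iff)
    obtain t0 x0 y0 where p_eq: "p = (t0, x0, y0)" by (cases p)
    have pos: "\<Phi> (t0, x0, y0) > 0"
      using p(2)[OF inK] neg by (simp add: p_eq) (simp add: \<Phi>_def)
    have t0: "t0 \<in> {s..T}" using p(1) by (simp add: p_eq K_def)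
    have mx: "\<Phi> (t', x', y') \<le> \<Phi> (t0, x0, y0)" if "t' \<in> {s..T}" for t' x' y'
    proof (cases "\<Phi> (t', x', y') > 0")
      case True
      with region[OF that True] that have "(t', x', y') \<in> K" by (simp add: K_def)
      thus ?thesis using p(2) by (simp add: p_eq)
    qed (use pos in linarith)
    have "t0 \<noteq> s"
    proof
      assume "t0 = s"
      hence "\<Phi> (t0, x0, y0) \<le> - (\<eta> * (norm x0)\<^sup>2)" using init[of x0 y0] by (simp add: \<Phi>_def)
      with pos \<eta> show False by (smt (verit) mult_nonneg_nonneg zero_le_power2)
    qed
    with t0 have st0: "s < t0" "t0 \<le> T" by auto
    define a b where "a = u t0 x0" and "b = u t0 y0"
    define L0 where "L0 = L t0"
    have L0: "L0 \<ge> l" "L0 \<le> Q" using Ll(2)[OF t0] by (auto simp: L0_def)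
    have e0: "\<eta> * (norm x0)\<^sup>2 \<ge> 0" using \<eta> by simp
    have k0: "\<kappa> \<eta> * (t0 - s) \<ge> 0" using \<kappa>0 t0 by simp
    have ab: "a - b > L0 * dist x0 y0 + \<eta> * (norm x0)\<^sup>2"
      using pos k0 by (simp add: \<Phi>_def a_def b_def L0_def)
    have ab0: "a - b > L0 * dist x0 y0" using ab e0 by linarith
    have "a > b" using ab0 L0 Ll(1) by (smt (verit) mult_nonneg_nonneg zero_le_dist)
    hence ne: "x0 \<noteq> y0" by (auto simp: a_def b_def)
    have dpos: "dist x0 y0 > 0" using ne by simp
    have aA: "a \<in> A" "b \<in> A" using uA[OF t0] by (auto simp: a_def b_def)
    define e where "e = (x0 - y0) /\<^sub>R norm (x0 - y0)"
    have ne1: "norm e = 1" using ne by (simp add: e_def)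
    have gx: "g t0 x0 = L0 *\<^sub>R e + (2 * \<eta>) *\<^sub>R x0"
    proof -
      have D: "((\<lambda>x. \<Phi> (t0, x, y0)) has_derivative (\<lambda>v. g t0 x0 \<bullet> v - L0 * (e \<bullet> v) - \<eta> * (2 * (x0 \<bullet> v)))) (at x0)"
        unfolding \<Phi>_def dist_norm prod.case
        by (rule has_derivative_eq_rhs, (rule has_derivative_diff has_derivative_mult_right gu[OF st0] has_derivative_norm_diff[OF ne] has_derivative_sqnorm_at has_derivative_const)+)
           (simp add: L0_def e_def sgn_div_norm fun_eq_iff)
      have "(\<lambda>v. g t0 x0 \<bullet> v - L0 * (e \<bullet> v) - \<eta> * (2 * (x0 \<bullet> v))) = (\<lambda>v. 0)"
        by (rule has_derivative_local_max[OF D]) (use mx[OF t0] in auto)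
      hence "(g t0 x0 - L0 *\<^sub>R e - (2 * \<eta>) *\<^sub>R x0) \<bullet> v = 0" for v
        by (simp add: fun_eq_iff inner_diff_left algebra_simps)
      hence "g t0 x0 - L0 *\<^sub>R e - (2 * \<eta>) *\<^sub>R x0 = 0" by (metis inner_eq_zero_iff)
      thus ?thesis by (simp add: algebra_simps)
    qed
    have gy: "g t0 y0 = L0 *\<^sub>R e"
    proof -
      have nd: "((\<lambda>y. norm (x0 - y)) has_derivative (\<lambda>v. sgn (y0 - x0) \<bullet> v)) (at y0)"
        unfolding norm_minus_commute[of x0] by (rule has_derivative_norm_diff) (use ne in simp)
      have se: "sgn (y0 - x0) = - e" by (simp add: e_def sgn_div_norm norm_minus_commute scaleR_diff_right)
      have D: "((\<lambda>y. \<Phi> (t0, x0, y)) has_derivative (\<lambda>v. - (g t0 y0 \<bullet> v) + L0 * (e \<bullet> v))) (at y0)"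
        unfolding \<Phi>_def dist_norm prod.case
        by (rule has_derivative_eq_rhs, (rule has_derivative_diff has_derivative_mult_right gu[OF st0] nd has_derivative_const)+)
           (simp add: L0_def se fun_eq_iff)
      have "(\<lambda>v. - (g t0 y0 \<bullet> v) + L0 * (e \<bullet> v)) = (\<lambda>v. 0)"
        by (rule has_derivative_local_max[OF D]) (use mx[OF t0] in auto)
      hence "(g t0 y0 - L0 *\<^sub>R e) \<bullet> v = 0" for v
        by (simp add: fun_eq_iff inner_diff_left algebra_simps)
      hence "g t0 y0 - L0 *\<^sub>R e = 0" by (metis inner_eq_zero_iff)
      thus ?thesis by simp
    qed
    have time: "ut t0 x0 - ut t0 y0 - L' t0 * dist x0 y0 - \<kappa> \<eta> \<ge> 0"
    proof (rule left_derivative_nonneg_at_max[where a = s and b = t0 and f = "\<lambda>r. \<Phi> (r, x0, y0)"])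
      have "(L has_real_derivative L' t0) (at t0 within {s..t0})"
        using L[OF t0] by (rule DERIV_subset) (use st0 in auto)
      thus "((\<lambda>r. \<Phi> (r, x0, y0)) has_real_derivative ut t0 x0 - ut t0 y0 - L' t0 * dist x0 y0 - \<kappa> \<eta>) (at t0 within {s..t0})"
        unfolding \<Phi>_def
        by (auto intro!: derivative_eq_intros has_field_derivative_at_within[OF ut[OF st0]])
      show "\<Phi> (r, x0, y0) \<le> \<Phi> (t0, x0, y0)" if "r \<in> {s..t0}" for r
        using mx[of r x0 y0] that st0 by auto
    qed (use st0 in simp)
    \<comment> \<open>Both points are shifted by the same vector, so \<open>dist\<close> drops out
      and no second derivative of the norm appears.\<close>
    have lap1: "(H t0 x0 *v axis i 1) $ i - (H t0 y0 *v axis i 1) $ i - 2 * \<eta> \<le> 0" for i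
    proof -
      let ?e = "axis i 1 :: real^'n"
      let ?w = "\<lambda>s. u t0 (x0 + s *\<^sub>R ?e) - u t0 (y0 + s *\<^sub>R ?e) - \<eta> * ((x0 + s *\<^sub>R ?e) \<bullet> (x0 + s *\<^sub>R ?e))"
      let ?w' = "\<lambda>s. g t0 (x0 + s *\<^sub>R ?e) \<bullet> ?e - g t0 (y0 + s *\<^sub>R ?e) \<bullet> ?e - \<eta> * (2 * (x0 $ i + s))"
      have 1: "(?w has_real_derivative ?w' s) (at s)" for s
      proof -
        have "((\<lambda>s. (x0 + s *\<^sub>R ?e) \<bullet> (x0 + s *\<^sub>R ?e)) has_real_derivative 2 * (x0 $ i + s)) (at s)"
        proof -
          have "(x0 + s *\<^sub>R f) \<bullet> (x0 + s *\<^sub>R f) = x0 \<bullet> x0 + 2 * s * (x0 \<bullet> f) + s * s * (f \<bullet> f)" for s f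
            by (simp add: inner_add_left inner_add_right inner_commute[of f x0] algebra_simps)
          from this[of _ ?e]
          have "(\<lambda>s. (x0 + s *\<^sub>R ?e) \<bullet> (x0 + s *\<^sub>R ?e)) = (\<lambda>s. x0 \<bullet> x0 + 2 * s * x0 $ i + s * s)"
            by simp
          thus ?thesis by (auto intro!: derivative_eq_intros)
        qed
        moreover have "((\<lambda>s. u t0 (z + s *\<^sub>R ?e)) has_real_derivative g t0 (z + s *\<^sub>R ?e) \<bullet> ?e) (at s)" for z
          by (rule has_real_derivative_along_line[OF gu[OF st0]])
        ultimately show ?thesis by (intro DERIV_diff DERIV_cmult)
      qed
      have gi: "((\<lambda>s. g t0 (z + s *\<^sub>R ?e) \<bullet> ?e) has_real_derivative (H t0 z *v ?e) $ i) (at 0)" for z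
      proof -
        have "((\<lambda>x. g t0 x \<bullet> ?e) has_derivative (\<lambda>v. (H t0 x *v v) \<bullet> ?e)) (at x)" for x
          by (rule has_derivative_inner_left[OF Hu[OF st0]])
        from has_real_derivative_along_line[where s = 0 and x = z and e = ?e, OF this]
        show ?thesis by simp
      qed
      have "((\<lambda>s. \<eta> * (2 * (x0 $ i + s))) has_real_derivative 2 * \<eta>) (at 0)"
        by (auto intro!: derivative_eq_intros)
      hence 2: "(?w' has_real_derivative ((H t0 x0 *v ?e) $ i - (H t0 y0 *v ?e) $ i - 2 * \<eta>)) (at 0)"
        by (intro DERIV_diff gi)
      have 3: "?w s \<le> ?w 0" for s
        using mx[OF t0, of "x0 + s *\<^sub>R ?e" "y0 + s *\<^sub>R ?e"]
        by (simp add: \<Phi>_def dist_norm power2_norm_eq_inner)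
      show ?thesis by (rule second_derivative_nonpos_at_max[OF 1 2 3])
    qed
    have lap: "trace (H t0 x0) - trace (H t0 y0) \<le> 2 * \<eta> * real CARD('n)"
    proof -
      have "trace (H t0 x0) - trace (H t0 y0) = (\<Sum>i\<in>UNIV. (H t0 x0 *v axis i 1) $ i - (H t0 y0 *v axis i 1) $ i)"
        by (simp add: trace_eq_sum_axis sum_subtractf)
      also have "\<dots> \<le> (\<Sum>i\<in>(UNIV::'n set). 2 * \<eta>)"
        using lap1 by (intro sum_mono) (simp add: algebra_simps)
      finally show ?thesis by (simp add: mult.commute)
    qed
    define q where "q = norm (g t0 x0)"
    \<comment> \<open>The penalty moves the gradient by 2 \<eta> |x0|, and \<eta> |x0|^2 \<le> 2 B
      bounds this by a quantity that vanishes with \<eta>.\<close>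
    have qL: "\<bar>q - L0\<bar> \<le> 2 * sqrt (2 * B * \<eta>)"
    proof -
      have "\<bar>q - L0\<bar> \<le> norm (g t0 x0 - L0 *\<^sub>R e)"
        using norm_triangle_ineq3[of "g t0 x0" "L0 *\<^sub>R e"] ne1 L0 Ll(1) by (simp add: q_def)
      also have "\<dots> = 2 * (\<eta> * norm x0)" using \<eta> by (simp add: gx)
      also have "\<eta> * norm x0 \<le> sqrt (2 * B * \<eta>)"
      proof (rule real_le_rsqrt)
        have "\<eta> * (norm x0)\<^sup>2 \<le> 2 * B"
        proof -
          have "a - b \<le> 2 * B" using bdd[OF t0, of x0] bdd[OF t0, of y0] unfolding a_def b_def by linarith
          moreover have "L0 * dist x0 y0 \<ge> 0" using L0 Ll by simp
          ultimately show ?thesis using ab by linarith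
        qed
        hence "\<eta> * (\<eta> * (norm x0)\<^sup>2) \<le> \<eta> * (2 * B)" using \<eta> by (simp add: mult_left_mono)
        thus "(\<eta> * norm x0)\<^sup>2 \<le> 2 * B * \<eta>" by (simp add: power2_eq_square algebra_simps)
      qed
      finally show ?thesis by simp
    qed
    have qr: "q \<in> {0..Q}" "L0 \<in> {0..Q}" using gQ[OF st0] L0 Ll(1) by (auto simp: q_def)
    have F1: "F a q \<le> F a L0 + \<Lambda> * (2 * sqrt (2 * B * \<eta>))"
    proof -
      have "\<bar>F a q - F a L0\<bar> \<le> \<Lambda> * (2 * sqrt (2 * B * \<eta>))"
        using Flip[OF aA(1) qr] mult_left_mono[OF qL Lam] by linarith
      thus ?thesis by linarith
    qed
    have F2: "F a L0 - F b L0 \<le> L' t0 / L0 * (a - b)"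
      using Fmono[OF st0 aA \<open>a > b\<close>] by (simp add: L0_def)
    \<comment> \<open>\<open>L'\<close> is nonpositive, so the lower bound
      \<open>a - b > L0 * dist x0 y0\<close> turns into an upper bound.\<close>
    have F3: "L' t0 / L0 * (a - b) \<le> L' t0 * dist x0 y0"
    proof -
      have "L' t0 / L0 \<le> 0" using L'[OF t0] L0 Ll(1) by (simp add: divide_nonpos_pos)
      hence "L' t0 / L0 * (a - b) \<le> L' t0 / L0 * (L0 * dist x0 y0)"
        using ab0 by (intro mult_left_mono_neg) auto
      thus ?thesis using L0 Ll(1) by simp
    qed
    have "ut t0 x0 - ut t0 y0 = \<nu> * (trace (H t0 x0) - trace (H t0 y0)) + F a q - F b L0"
      using pde[OF st0, of x0] pde[OF st0, of y0] ne1 L0 Ll(1)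
      by (simp add: gy q_def a_def b_def algebra_simps)
    moreover have "\<nu> * (trace (H t0 x0) - trace (H t0 y0)) \<le> \<nu> * (2 * \<eta> * real CARD('n))"
      using lap nu by (rule mult_left_mono)
    ultimately have "\<kappa> \<eta> \<le> \<nu> * (2 * \<eta> * real CARD('n)) + \<Lambda> * (2 * sqrt (2 * B * \<eta>))"
      using time F1 F2 F3 by linarith
    thus False using \<eta> by (simp add: \<kappa>_def algebra_simps)
  qed
  have "((\<lambda>\<eta>. L t * dist x y + \<eta> * (norm x)\<^sup>2 + \<kappa> \<eta> * (t - s)) \<longlongrightarrow>
          L t * dist x y + 0 * (norm x)\<^sup>2 + (2 * \<nu> * real CARD('n) * 0 + 2 * \<Lambda> * sqrt (2 * B * 0) + 0) * (t - s)) (at_right 0)"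
    unfolding \<kappa>_def by (intro tendsto_intros)
  hence lim: "((\<lambda>\<eta>. L t * dist x y + \<eta> * (norm x)\<^sup>2 + \<kappa> \<eta> * (t - s)) \<longlongrightarrow> L t * dist x y) (at_right 0)"
    by simp
  show ?thesis
  proof (rule tendsto_lowerbound[OF lim])
    show "\<forall>\<^sub>F \<eta> in at_right 0. u t x - u t y \<le> L t * dist x y + \<eta> * (norm x)\<^sup>2 + \<kappa> \<eta> * (t - s)"
      using eventually_at_right_less[of 0] main by (rule eventually_mono)
  qed simp
qed

section \<open>The equation and its exponential transform\<close>

definition outer :: "real ^ 'n \<Rightarrow> real ^ 'n ^ 'n" where
  "outer a = (\<chi> i j. a $ i * a $ j)"

lemma outer_mult_vec: "outer a *v v = (a \<bullet> v) *\<^sub>R a"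
  by (simp add: outer_def matrix_vector_mult_def vec_eq_iff inner_vec_def sum_distrib_left sum_distrib_right mult_ac)

lemma trace_outer: "trace (outer a) = (norm a)\<^sup>2"
  by (simp add: outer_def trace_def power2_norm_eq_inner inner_vec_def)

lemma trace_scaleR: "trace (k *\<^sub>R A) = k * trace A" for A :: "real ^ 'n ^ 'n"
  by (simp add: trace_def sum_distrib_left)

lemma continuous_on_outer [continuous_intros]:
  "continuous_on S f \<Longrightarrow> continuous_on S (\<lambda>x. outer (f x))"
  unfolding outer_def by (intro continuous_intros)

lemma has_derivative_scalar_compose:
  assumes h: "(h has_derivative (\<lambda>v. g x \<bullet> v)) (at x)"
    and \<phi>: "(\<phi> has_real_derivative \<phi>1 (h x)) (at (h x))"
  shows "((\<lambda>x. \<phi> (h x)) has_derivative (\<lambda>v. (\<phi>1 (h x) *\<^sub>R g x) \<bullet> v)) (at x)"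
  using has_derivative_compose[OF h \<phi>[unfolded has_field_derivative_def]] by simp

lemma has_derivative_grad_compose:
  assumes h: "(h has_derivative (\<lambda>v. g x \<bullet> v)) (at x)"
    and g: "(g has_derivative (\<lambda>v. H *v v)) (at x)"
    and \<phi>: "(\<phi>1 has_real_derivative \<phi>2) (at (h x))"
  shows "((\<lambda>x. \<phi>1 (h x) *\<^sub>R g x) has_derivative (\<lambda>v. (\<phi>1 (h x) *\<^sub>R H + \<phi>2 *\<^sub>R outer (g x)) *v v)) (at x)"
  by (rule has_derivative_eq_rhs[OF has_derivative_scaleR[OF has_derivative_compose[OF h \<phi>[unfolded has_field_derivative_def]] g]])
     (simp add: fun_eq_iff matrix_vector_mult_add_rdistrib scaleR_matrix_vector_assoc[symmetric] outer_mult_vec)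

lemma norm_gradient_le_if_lipschitz:
  fixes u :: "'a::real_inner \<Rightarrow> real"
  assumes der: "(u has_derivative (\<lambda>v. g \<bullet> v)) (at x)"
    and lip: "\<And>y. u y - u x \<le> L * dist y x" and L0: "L \<ge> 0"
  shows "norm g \<le> L"
proof (cases "g = 0")
  case True
  thus ?thesis using L0 by simp
next
  case False
  let ?c = "\<lambda>s::real. x + s *\<^sub>R g"
  have 1: "(?c has_derivative (\<lambda>s. s *\<^sub>R g)) (at 0)" by (auto intro!: derivative_eq_intros)
  have "((\<lambda>s. u (?c s)) has_derivative (\<lambda>s. g \<bullet> (s *\<^sub>R g))) (at 0)"
    using has_derivative_compose[OF 1, of u "\<lambda>v. g \<bullet> v"] der by simp
  hence "((\<lambda>s. u (?c s)) has_real_derivative (g \<bullet> g)) (at 0)"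
    unfolding has_field_derivative_def by (rule has_derivative_eq_rhs) (simp add: fun_eq_iff)
  hence lim: "((\<lambda>s. (u (?c s) - u x) / s) \<longlongrightarrow> g \<bullet> g) (at_right 0)"
    by (auto simp: DERIV_def intro: tendsto_mono[OF at_le])
  have "g \<bullet> g \<le> L * norm g"
  proof (rule tendsto_upperbound[OF lim])
    show "\<forall>\<^sub>F s in at_right 0. (u (?c s) - u x) / s \<le> L * norm g"
      using eventually_at_right_less[of "0::real"]
    proof eventually_elim
      case (elim s)
      thus ?case using lip[of "?c s"] by (simp add: dist_norm field_simps)
    qed
  qed simp
  thus ?thesis using False by (simp add: dot_square_norm power2_eq_square)
qed

lemma lipschitz_if_norm_gradient_le:
  fixes u :: "'a::real_inner \<Rightarrow> real"
  assumes der: "\<And>x. (u has_derivative (\<lambda>v. g x \<bullet> v)) (at x)" and le: "\<And>x. norm (g x) \<le> L"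
  shows "u x - u y \<le> L * dist x y"
proof -
  have "norm (u x - u y) \<le> L * norm (x - y)"
  proof (rule differentiable_bound[where S = UNIV])
    show "onorm (\<lambda>v. g z \<bullet> v) \<le> L" for z
    proof (rule onorm_bound)
      show "0 \<le> L" using order_trans[OF norm_ge_zero le] .
      fix v
      have "\<bar>g z \<bullet> v\<bar> \<le> norm (g z) * norm v" by (rule Cauchy_Schwarz_ineq2)
      also have "\<dots> \<le> L * norm v" using le by (intro mult_right_mono) auto
      finally show "norm (g z \<bullet> v) \<le> L * norm v" by simp
    qed
  qed (use der in auto)
  thus ?thesis by (simp add: dist_norm)
qed

text \<open>The bounds \<open>B\<close> and \<open>Bg\<close> are qualitative: they secure
  integrability and compactness, while the estimates are to be expressed through the initial datum
  and the parameters of the equation.\<close>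

locale kpz =
  fixes \<nu> lam c B Bg :: real and V V1 :: "real \<Rightarrow> real"
    and h h' :: "real \<Rightarrow> real ^ 'n \<Rightarrow> real" and g :: "real \<Rightarrow> real ^ 'n \<Rightarrow> real ^ 'n"
    and H :: "real \<Rightarrow> real ^ 'n \<Rightarrow> real ^ 'n ^ 'n"
  assumes nu: "\<nu> > 0" and lam: "lam > 0" and c: "c > 0"
    and V_nonneg: "\<And>y. y \<ge> 0 \<Longrightarrow> V y \<ge> 0" and V_le: "\<And>y. y \<ge> 0 \<Longrightarrow> V y \<le> y\<^sup>2"
    and V1: "\<And>y. y \<ge> 0 \<Longrightarrow> (V has_real_derivative V1 y) (at y within {0..})"
    and cont_V1: "continuous_on {0..} V1"
    and V_c: "\<And>y. y \<ge> 0 \<Longrightarrow> y * V1 y - V y \<ge> c * y\<^sup>2"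
    and cont_h: "continuous_on ({0..} \<times> UNIV) (\<lambda>(t, x). h t x)"
    and bdd_h: "\<And>t x. t \<ge> 0 \<Longrightarrow> \<bar>h t x\<bar> \<le> B"
    and ht: "\<And>t x. t > 0 \<Longrightarrow> ((\<lambda>s. h s x) has_real_derivative h' t x) (at t)"
    and gh: "\<And>t x. t > 0 \<Longrightarrow> (h t has_derivative (\<lambda>v. g t x \<bullet> v)) (at x)"
    and Hh: "\<And>t x. t > 0 \<Longrightarrow> (g t has_derivative (\<lambda>v. H t x *v v)) (at x)"
    and cont_ht: "continuous_on ({0<..} \<times> UNIV) (\<lambda>(t, x). h' t x)"
    and cont_g: "continuous_on ({0<..} \<times> UNIV) (\<lambda>(t, x). g t x)"
    and cont_H: "continuous_on ({0<..} \<times> UNIV) (\<lambda>(t, x). H t x)"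
    and bdd_g: "\<And>t x. t > 0 \<Longrightarrow> norm (g t x) \<le> Bg"
    and pde: "\<And>t x. t > 0 \<Longrightarrow> h' t x = \<nu> * trace (H t x) + lam * V (norm (g t x))"
begin

text \<open>The equation is autonomous; this is what allows the Duhamel estimates to be restarted at
  time \<open>s\<close>.\<close>

lemma shift:
  assumes "s \<ge> 0"
  shows "kpz \<nu> lam c B Bg V V1 (\<lambda>t. h (s + t)) (\<lambda>t. h' (s + t)) (\<lambda>t. g (s + t)) (\<lambda>t. H (s + t))"
proof -
  have sh: "continuous_on ({0<..} \<times> UNIV) (\<lambda>(t, x). w (s + t) x)"
    if "continuous_on ({0<..} \<times> UNIV) (\<lambda>(t, x). w t x)" for w :: "real \<Rightarrow> real^'n \<Rightarrow> 'z::topological_space"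
  proof -
    have "continuous_on ({0<..} \<times> UNIV) (\<lambda>p::real \<times> (real^'n). (s + fst p, snd p))" by (intro continuous_intros)
    moreover have "(\<lambda>p::real \<times> (real^'n). (s + fst p, snd p)) ` ({0<..} \<times> UNIV) \<subseteq> {0<..} \<times> UNIV" using assms by auto
    ultimately show ?thesis
      using continuous_on_compose2[OF that, of "{0<..} \<times> UNIV" "\<lambda>p. (s + fst p, snd p)"] by (simp add: case_prod_beta)
  qed
  have sh0: "continuous_on ({0..} \<times> UNIV) (\<lambda>(t, x). h (s + t) x)"
  proof -
    have "continuous_on ({0..} \<times> UNIV) (\<lambda>p::real \<times> (real^'n). (s + fst p, snd p))" by (intro continuous_intros)
    moreover have "(\<lambda>p::real \<times> (real^'n). (s + fst p, snd p)) ` ({0..} \<times> UNIV) \<subseteq> {0..} \<times> UNIV" using assms by auto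
    ultimately show ?thesis
      using continuous_on_compose2[OF cont_h, of "{0..} \<times> UNIV" "\<lambda>p. (s + fst p, snd p)"] by (simp add: case_prod_beta)
  qed
  have der: "((\<lambda>r. h (s + r) x) has_real_derivative h' (s + t) x) (at t)" if "t > 0" for t x
    using DERIV_shift[of "\<lambda>r. h r x" "h' (s + t) x" t s] ht[of "s + t" x] that assms by (simp add: add.commute)
  show ?thesis
    by standard (use nu lam c V_nonneg V_le V1 cont_V1 V_c sh0 bdd_h der gh Hh sh[OF cont_ht] sh[OF cont_g] sh[OF cont_H] bdd_g pde assms in auto)
qed

lemma Bg_nonneg: "Bg \<ge> 0"
  using bdd_g[of 1] norm_ge_zero order_trans by (metis zero_less_one)

sublocale h: heat_source \<nu> B Bg "lam * Bg\<^sup>2" h h' "\<lambda>t x. lam * V (norm (g t x))" g H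
proof
  fix t :: real and x :: "real^'n" assume t: "t > 0"
  have "V (norm (g t x)) \<le> (norm (g t x))\<^sup>2" by (intro V_le) simp
  also have "\<dots> \<le> Bg\<^sup>2" using bdd_g[OF t] by (intro power_mono) auto
  finally show "\<bar>lam * V (norm (g t x))\<bar> \<le> lam * Bg\<^sup>2"
    using V_nonneg[of "norm (g t x)"] lam by (simp add: abs_mult)
qed (use nu cont_h bdd_h ht gh Hh cont_ht cont_g cont_H bdd_g pde in auto)

text \<open>The Cole-Hopf transform, which linearizes the equation when V(y) = y^2. Subtracting 1
  makes \<open>w\<close> vanish where \<open>h\<close> does, so that its initial values are
  controlled by those of \<open>\<bar>h 0 x\<bar>\<close>.\<close>

definition w :: "real \<Rightarrow> real ^ 'n \<Rightarrow> real" where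
  "w t x = exp (lam / \<nu> * h t x) - 1"

text \<open>The defect of that linearization. It is nonpositive because V(y) \<le> y^2, which makes
  \<open>w\<close> a subsolution of the heat equation.\<close>

definition fw :: "real \<Rightarrow> real ^ 'n \<Rightarrow> real" where
  "fw t x = lam\<^sup>2 / \<nu> * exp (lam / \<nu> * h t x) * (V (norm (g t x)) - (norm (g t x))\<^sup>2)"

sublocale w: heat_source \<nu> "exp (lam / \<nu> * B) + 1" "lam / \<nu> * exp (lam / \<nu> * B) * Bg"
    "lam\<^sup>2 / \<nu> * exp (lam / \<nu> * B) * Bg\<^sup>2" w
    "\<lambda>t x. lam / \<nu> * exp (lam / \<nu> * h t x) * h' t x" fw
    "\<lambda>t x. (lam / \<nu> * exp (lam / \<nu> * h t x)) *\<^sub>R g t x"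
    "\<lambda>t x. (lam / \<nu> * exp (lam / \<nu> * h t x)) *\<^sub>R H t x + ((lam / \<nu>)\<^sup>2 * exp (lam / \<nu> * h t x)) *\<^sub>R outer (g t x)"
proof
  have E_le: "exp (lam / \<nu> * h t x) \<le> exp (lam / \<nu> * B)" if "t \<ge> 0" for t x
    using bdd_h[OF that, of x] lam nu by (simp add: mult_left_mono divide_right_mono)
  show "\<nu> > 0" by (rule nu)
  show "continuous_on ({0..} \<times> UNIV) (\<lambda>(t, x). w t x)"
    unfolding w_def case_prod_beta by (intro continuous_intros cont_h[unfolded case_prod_beta])
  show "\<bar>w t x\<bar> \<le> exp (lam / \<nu> * B) + 1" if "t \<ge> 0" for t x
    using E_le[OF that, of x] exp_gt_zero[of "lam / \<nu> * h t x"] unfolding w_def by linarith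
  have \<phi>: "((\<lambda>y. exp (lam / \<nu> * y) - 1) has_real_derivative lam / \<nu> * exp (lam / \<nu> * y)) (at y)" for y
    using nu by (auto intro!: derivative_eq_intros)
  have \<phi>1: "((\<lambda>y. lam / \<nu> * exp (lam / \<nu> * y)) has_real_derivative (lam / \<nu>)\<^sup>2 * exp (lam / \<nu> * y)) (at y)" for y
    using nu by (auto intro!: derivative_eq_intros simp: power2_eq_square)
  fix t :: real and x :: "real^'n" assume t: "t > 0"
  show "((\<lambda>s. w s x) has_real_derivative lam / \<nu> * exp (lam / \<nu> * h t x) * h' t x) (at t)"
    unfolding w_def by (rule DERIV_chain2[OF \<phi> ht[OF t]])
  show "(w t has_derivative (\<lambda>v. ((lam / \<nu> * exp (lam / \<nu> * h t x)) *\<^sub>R g t x) \<bullet> v)) (at x)"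
    unfolding w_def[abs_def]
    using has_derivative_scalar_compose[of "h t" "g t" x "\<lambda>y. exp (lam / \<nu> * y) - 1"
        "\<lambda>y. lam / \<nu> * exp (lam / \<nu> * y)", OF gh[OF t] \<phi>] by simp
  show "((\<lambda>x. (lam / \<nu> * exp (lam / \<nu> * h t x)) *\<^sub>R g t x) has_derivative
      (\<lambda>v. ((lam / \<nu> * exp (lam / \<nu> * h t x)) *\<^sub>R H t x + ((lam / \<nu>)\<^sup>2 * exp (lam / \<nu> * h t x)) *\<^sub>R outer (g t x)) *v v)) (at x)"
    using has_derivative_grad_compose[of "h t" "g t" x "H t x" "\<lambda>y. lam / \<nu> * exp (lam / \<nu> * y)",
        OF gh[OF t] Hh[OF t] \<phi>1] by simp
  show "norm ((lam / \<nu> * exp (lam / \<nu> * h t x)) *\<^sub>R g t x) \<le> lam / \<nu> * exp (lam / \<nu> * B) * Bg"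
    using lam nu E_le[of t x] bdd_g[OF t, of x] t Bg_nonneg
  proof -
    have "lam / \<nu> * exp (lam / \<nu> * h t x) * norm (g t x) \<le> lam / \<nu> * exp (lam / \<nu> * B) * Bg"
      using lam nu E_le[of t x] bdd_g[OF t, of x] t by (intro mult_mono mult_left_mono) auto
    thus ?thesis using lam nu by simp
  qed
  show "lam / \<nu> * exp (lam / \<nu> * h t x) * h' t x = \<nu> * trace ((lam / \<nu> * exp (lam / \<nu> * h t x)) *\<^sub>R H t x
      + ((lam / \<nu>)\<^sup>2 * exp (lam / \<nu> * h t x)) *\<^sub>R outer (g t x)) + fw t x"
    using nu by (simp add: pde[OF t] trace_add trace_scaleR trace_outer fw_def field_simps power2_eq_square)
  have "V (norm (g t x)) \<le> (norm (g t x))\<^sup>2" "V (norm (g t x)) \<ge> 0" by (auto intro: V_le V_nonneg)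
  moreover have "(norm (g t x))\<^sup>2 \<le> Bg\<^sup>2" using bdd_g[OF t] by (intro power_mono) auto
  ultimately have "\<bar>V (norm (g t x)) - (norm (g t x))\<^sup>2\<bar> \<le> Bg\<^sup>2" by linarith
  hence "lam\<^sup>2 / \<nu> * exp (lam / \<nu> * h t x) * \<bar>V (norm (g t x)) - (norm (g t x))\<^sup>2\<bar> \<le> lam\<^sup>2 / \<nu> * exp (lam / \<nu> * B) * Bg\<^sup>2"
    using nu E_le[of t x] t by (intro mult_mono mult_left_mono) auto
  thus "\<bar>fw t x\<bar> \<le> lam\<^sup>2 / \<nu> * exp (lam / \<nu> * B) * Bg\<^sup>2" using nu by (simp add: fw_def abs_mult)
next
  have ch: "continuous_on ({0<..} \<times> UNIV) (\<lambda>p. h (fst p) (snd p))"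
    by (rule continuous_on_subset[OF cont_h[unfolded case_prod_beta]]) auto
  note ci = ch cont_ht[unfolded case_prod_beta] cont_g[unfolded case_prod_beta] cont_H[unfolded case_prod_beta]
  show "continuous_on ({0<..} \<times> UNIV) (\<lambda>(t, x). lam / \<nu> * exp (lam / \<nu> * h t x) * h' t x)"
    unfolding case_prod_beta by (intro continuous_intros ci)
  show "continuous_on ({0<..} \<times> UNIV) (\<lambda>(t, x). (lam / \<nu> * exp (lam / \<nu> * h t x)) *\<^sub>R g t x)"
    unfolding case_prod_beta by (intro continuous_intros ci)
  show "continuous_on ({0<..} \<times> UNIV) (\<lambda>(t, x). (lam / \<nu> * exp (lam / \<nu> * h t x)) *\<^sub>R H t x
      + ((lam / \<nu>)\<^sup>2 * exp (lam / \<nu> * h t x)) *\<^sub>R outer (g t x))"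
    unfolding case_prod_beta by (intro continuous_intros ci)
qed

end

section \<open>Gradient bounds\<close>

context kpz
begin

lemma V_lipschitz: "\<exists>K\<ge>0. \<forall>p\<in>{0..Q}. \<forall>q\<in>{0..Q}. \<bar>V p - V q\<bar> \<le> K * \<bar>p - q\<bar>"
proof -
  have "compact (V1 ` {0..Q})"
    by (intro compact_continuous_image continuous_on_subset[OF cont_V1]) auto
  then obtain K where K: "\<And>y. y \<in> {0..Q} \<Longrightarrow> \<bar>V1 y\<bar> \<le> K"
    by (metis bounded_real compact_imp_bounded imageI)
  have "norm (V p - V q) \<le> \<bar>K\<bar> * norm (p - q)" if "p \<in> {0..Q}" "q \<in> {0..Q}" for p q
  proof (rule field_differentiable_bound[where S = "{0..Q}"])
    show "(V has_real_derivative V1 z) (at z within {0..Q})" if "z \<in> {0..Q}" for z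
      by (rule DERIV_subset[OF V1]) (use that in auto)
    show "norm (V1 z) \<le> \<bar>K\<bar>" if "z \<in> {0..Q}" for z using K[OF that] by simp
  qed (use that in auto)
  thus ?thesis by (intro exI[of _ "\<bar>K\<bar>"]) auto
qed

text \<open>The nonlinearity depends on the gradient alone, so a constant barrier satisfies the
  monotonicity condition of \<open>doubling_of_variables\<close> with 0 on both sides.\<close>

lemma gradient_le_initial_lipschitz:
  assumes \<Lambda>: "\<Lambda> > 0" and lip: "\<And>x y. h 0 x - h 0 y \<le> \<Lambda> * dist x y" and t: "t > 0"
  shows "norm (g t x) \<le> \<Lambda>"
proof -
  define Q where "Q = max Bg \<Lambda>"
  obtain K where K: "K \<ge> 0" "\<And>p q. p \<in> {0..Q} \<Longrightarrow> q \<in> {0..Q} \<Longrightarrow> \<bar>V p - V q\<bar> \<le> K * \<bar>p - q\<bar>"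
    using V_lipschitz by blast
  have "h t x - h t y \<le> \<Lambda> * dist x y" for x y
  proof (rule doubling_of_variables[where u = h and ut = h' and g = g and H = H and \<nu> = \<nu>
        and F = "\<lambda>a q. lam * V q" and L = "\<lambda>_. \<Lambda>" and L' = "\<lambda>_. 0" and s = 0 and T = t and A = UNIV
        and Q = Q and B = B and \<Lambda> = "lam * K" and l = \<Lambda>])
    show "continuous_on ({0..t} \<times> UNIV) (\<lambda>(t, x). h t x)"
      by (rule continuous_on_subset[OF cont_h]) auto
    show "norm (g r z) \<le> Q" if "0 < r" for r z using bdd_g[OF that, of z] by (simp add: Q_def)
    show "\<bar>lam * V p - lam * V q\<bar> \<le> lam * K * \<bar>p - q\<bar>" if "p \<in> {0..Q}" "q \<in> {0..Q}" for p q
      using mult_left_mono[OF K(2)[OF that], of lam] lam by (simp add: right_diff_distrib[symmetric] abs_mult mult.assoc)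
  qed (use nu t \<Lambda> lip bdd_h ht gh Hh pde in \<open>auto simp: Q_def\<close>)
  thus ?thesis using \<Lambda> by (intro norm_gradient_le_if_lipschitz[OF gh[OF t]]) auto
qed

text \<open>The derivative of V(y) / y - c y is (y V'(y) - V(y)) / y^2 - c, which the growth
  hypothesis makes nonnegative.\<close>

lemma V_quotient_mono:
  assumes "0 < a" "a < b"
  shows "c * (b - a) \<le> V b / b - V a / a"
proof -
  have "V a / a - c * a \<le> V b / b - c * b"
  proof (rule DERIV_nonneg_imp_nondecreasing[where f = "\<lambda>y. V y / y - c * y" and a = a and b = b])
    show "a \<le> b" using assms by simp
    fix y assume y: "a \<le> y" "y \<le> b"
    hence y0: "y > 0" using assms by simp
    have "(V has_real_derivative V1 y) (at y)"
      using DERIV_subset[OF V1[of y], of "{0<..}"] y0 by (simp add: at_within_open[of y "{0<..}"] subset_iff)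
    hence "((\<lambda>y. V y / y - c * y) has_real_derivative (V1 y * y - V y) / (y * y) - c) (at y)"
      using y0 by (auto intro!: derivative_eq_intros)
    moreover have "(V1 y * y - V y) / (y * y) - c \<ge> 0"
      using V_c[of y] y0 by (simp add: field_simps power2_eq_square)
    ultimately show "\<exists>d. ((\<lambda>y. V y / y - c * y) has_real_derivative d) (at y) \<and> 0 \<le> d" by blast
  qed
  thus ?thesis by (simp add: algebra_simps)
qed

lemma gradient_decay_aux:
  assumes M: "\<And>t x. t \<ge> 0 \<Longrightarrow> \<bar>h t x\<bar> \<le> M" and t: "t > 0" and \<delta>: "\<delta> > 0"
  shows "c * lam * t * (norm (g t x))\<^sup>2 \<le> 2 * M + \<delta>"
proof -
  have M0: "M \<ge> 0" using M[of 0 x] by linarith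
  \<comment> \<open>Adding \<open>\<delta>\<close> keeps the radicand at least
    \<open>\<delta>\<close>, so that \<open>u\<close> inherits the regularity of \<open>h\<close>
    and stays away from 0.\<close>
  define u where "u r z = sqrt (M + \<delta> - h r z)" for r z
  define amax where "amax = sqrt (2 * M + \<delta>)"
  have rad: "\<delta> \<le> M + \<delta> - h r z" "M + \<delta> - h r z \<le> 2 * M + \<delta>" if "r \<ge> 0" for r z
    using M[OF that, of z] by linarith+
  have u_bounds: "sqrt \<delta> \<le> u r z" "u r z \<le> amax" if "r \<ge> 0" for r z
    using rad[OF that, of z] by (simp_all add: u_def amax_def)
  have sd: "sqrt \<delta> > 0" using \<delta> by simp
  have u_pos: "u r z > 0" if "r \<ge> 0" for r z using u_bounds(1)[OF that, of z] sd by linarith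
  have usq: "(u r z)\<^sup>2 = M + \<delta> - h r z" if "r \<ge> 0" for r z
    using rad(1)[OF that, of z] \<delta> by (simp add: u_def)
  \<comment> \<open>A solution of L' = - 2 c \<lambda> L^3 that blows up at time 0.\<close>
  define L where "L r = 1 / sqrt (4 * c * lam * r)" for r
  \<comment> \<open>So early that \<open>L \<tau>\<close> is at least the crude Lipschitz bound
    \<open>(Bg + 1) / (2 * sqrt \<delta>)\<close> of \<open>u\<close>; from there the barrier can
    start. Adding 1 to \<open>Bg\<close> keeps the denominator positive.\<close>
  define \<tau> where "\<tau> = min t (\<delta> / (c * lam * (Bg + 1)\<^sup>2))"
  have B1: "Bg + 1 > 0" using Bg_nonneg by simp
  have \<tau>: "0 < \<tau>" "\<tau> \<le> t" using t \<delta> c lam B1 by (auto simp: \<tau>_def)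
  have L\<tau>: "(Bg + 1) / (2 * sqrt \<delta>) \<le> L \<tau>"
  proof -
    have "\<tau> \<le> \<delta> / (c * lam * (Bg + 1)\<^sup>2)" by (simp add: \<tau>_def)
    hence "4 * c * lam * \<tau> \<le> 4 * \<delta> / (Bg + 1)\<^sup>2" using c lam B1 by (simp add: field_simps)
    hence "sqrt (4 * c * lam * \<tau>) \<le> sqrt (4 * \<delta> / (Bg + 1)\<^sup>2)" by (rule real_sqrt_le_mono)
    also have "\<dots> = 2 * sqrt \<delta> / (Bg + 1)" using B1 by (simp add: real_sqrt_divide real_sqrt_mult)
    finally have le: "sqrt (4 * c * lam * \<tau>) \<le> 2 * sqrt \<delta> / (Bg + 1)" .
    have "sqrt (4 * c * lam * \<tau>) > 0" using c lam \<tau> by simp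
    hence "1 / (2 * sqrt \<delta> / (Bg + 1)) \<le> 1 / sqrt (4 * c * lam * \<tau>)"
      using le by (intro divide_left_mono) (auto intro!: mult_pos_pos divide_pos_pos B1 sd)
    thus ?thesis by (simp add: L_def)
  qed
  have Lpos: "L r > 0" if "r > 0" for r using c lam that by (simp add: L_def)
  have Lmono: "L r' \<le> L r" if "0 < r" "r \<le> r'" for r r'
    unfolding L_def using that c lam by (intro divide_left_mono real_sqrt_le_mono mult_left_mono) auto
  have Lsq: "(L r)\<^sup>2 = 1 / (4 * c * lam * r)" if "r > 0" for r
    using that c lam by (simp add: L_def power_divide)
  define Q where "Q = L \<tau>"
  define gu where "gu r z = (- 1 / (2 * sqrt (M + \<delta> - h r z))) *\<^sub>R g r z" for r z
  define Hu where "Hu r z = (- 1 / (2 * sqrt (M + \<delta> - h r z))) *\<^sub>R H r z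
      + (- 1 / (4 * sqrt (M + \<delta> - h r z) ^ 3)) *\<^sub>R outer (g r z)" for r z
  \<comment> \<open>Substituting h = M + \<delta> - u^2, for which |\<nabla>h| = 2 u |\<nabla>u|,
    and dividing the equation by - 2 u gives this nonlinearity for \<open>u\<close>.\<close>
  define F where "F a q = \<nu> * q\<^sup>2 / a - lam * (V (2 * a * q) / (2 * a))" for a q
  have ngu: "norm (gu r z) = norm (g r z) / (2 * u r z)" if "r > 0" for r z
    using u_pos[of r z] that by (simp add: gu_def u_def)
  have gu_le: "norm (gu r z) \<le> (Bg + 1) / (2 * sqrt \<delta>)" if "r > 0" for r z
    unfolding ngu[OF that] using bdd_g[OF that, of z] u_bounds(1)[of r z] that sd Bg_nonneg
    by (intro frac_le) auto
  obtain K where K: "K \<ge> 0" "\<And>p q. p \<in> {0..2 * amax * Q} \<Longrightarrow> q \<in> {0..2 * amax * Q} \<Longrightarrow> \<bar>V p - V q\<bar> \<le> K * \<bar>p - q\<bar>"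
    using V_lipschitz by blast
  have du: "((\<lambda>y. sqrt (M + \<delta> - y)) has_real_derivative - 1 / (2 * sqrt (M + \<delta> - y))) (at y)" if "y < M + \<delta>" for y
    using that by (auto intro!: derivative_eq_intros simp: field_simps)
  have du1: "((\<lambda>y. - 1 / (2 * sqrt (M + \<delta> - y))) has_real_derivative - 1 / (4 * sqrt (M + \<delta> - y) ^ 3)) (at y)" if "y < M + \<delta>" for y
    using that by (auto intro!: derivative_eq_intros simp: field_simps power2_eq_square power3_eq_cube)
  have hlt: "h r z < M + \<delta>" if "r \<ge> 0" for r z using rad(1)[OF that, of z] \<delta> by linarith
  have gu: "(u r has_derivative (\<lambda>v. gu r z \<bullet> v)) (at z)" if "r > 0" for r z
    unfolding u_def[abs_def] gu_def
    using has_derivative_scalar_compose[of "h r" "g r" z "\<lambda>y. sqrt (M + \<delta> - y)" "\<lambda>y. - 1 / (2 * sqrt (M + \<delta> - y))",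
        OF gh[OF that] du] hlt[of r z] that by simp
  have Hu: "(gu r has_derivative (\<lambda>v. Hu r z *v v)) (at z)" if "r > 0" for r z
    unfolding gu_def[abs_def] Hu_def
    using has_derivative_grad_compose[of "h r" "g r" z "H r z" "\<lambda>y. - 1 / (2 * sqrt (M + \<delta> - y))",
        OF gh[OF that] Hh[OF that] du1] hlt[of r z] that by simp
  have ut: "((\<lambda>r. u r z) has_real_derivative \<nu> * trace (Hu r z) + F (u r z) (norm (gu r z))) (at r)" if "r > 0" for r z
  proof -
    have up: "u r z > 0" using u_pos that by simp
    have "((\<lambda>r. u r z) has_real_derivative - 1 / (2 * sqrt (M + \<delta> - h r z)) * h' r z) (at r)"
      unfolding u_def[abs_def] by (rule DERIV_chain2[OF du ht[OF that]]) (use hlt[of r z] that in simp)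
    moreover have "- 1 / (2 * sqrt (M + \<delta> - h r z)) * h' r z = \<nu> * trace (Hu r z) + F (u r z) (norm (gu r z))"
    proof -
      have ng: "norm (g r z) = 2 * u r z * norm (gu r z)" using up by (simp add: ngu[OF that])
      have "trace (Hu r z) = - trace (H r z) / (2 * u r z) - (norm (gu r z))\<^sup>2 / u r z"
        unfolding Hu_def u_def[symmetric] trace_add trace_scaleR trace_outer ng
        using up by (simp add: field_simps power2_eq_square power3_eq_cube)
      hence tr: "trace (H r z) = - 2 * (u r z * trace (Hu r z)) - 2 * (norm (gu r z))\<^sup>2"
        using up by (simp add: field_simps)
      have "\<nu> * trace (Hu r z) + F (u r z) (norm (gu r z))
          = - (\<nu> * trace (H r z) + lam * V (norm (g r z))) / (2 * u r z)"
        unfolding F_def ng[symmetric] tr using up by (simp add: field_simps)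
      thus ?thesis by (simp add: pde[OF that] u_def diff_divide_distrib add_divide_distrib)
    qed
    ultimately show ?thesis by simp
  qed
  have "u t y - u t z \<le> L t * dist y z" for y z
  proof (rule doubling_of_variables[where u = u and ut = "\<lambda>r z. \<nu> * trace (Hu r z) + F (u r z) (norm (gu r z))"
        and g = gu and H = Hu and \<nu> = \<nu> and F = F and L = L and L' = "\<lambda>r. - (2 * c * lam) * (L r)\<^sup>2 * L r"
        and s = \<tau> and T = t and A = "{sqrt \<delta>..amax}" and Q = Q and B = amax
        and \<Lambda> = "\<nu> * (2 * Q) / sqrt \<delta> + lam * K" and l = "L t"])
    show "continuous_on ({\<tau>..t} \<times> UNIV) (\<lambda>(r, z). u r z)"
      unfolding u_def case_prod_beta
      by (intro continuous_intros continuous_on_subset[OF cont_h[unfolded case_prod_beta]]) (use \<tau> in auto)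
    show "\<bar>u r z\<bar> \<le> amax" "u r z \<in> {sqrt \<delta>..amax}" if "r \<in> {\<tau>..t}" for r z
      using u_bounds[of r z] u_pos[of r z] that \<tau> by auto
    show "(L has_real_derivative - (2 * c * lam) * (L r)\<^sup>2 * L r) (at r within {\<tau>..t})" if "r \<in> {\<tau>..t}" for r
    proof -
      have r: "r > 0" using that \<tau> by simp
      have s0: "sqrt (4 * c * lam * r) > 0" using r c lam by simp
      have "((\<lambda>r. sqrt (4 * c * lam * r)) has_real_derivative 4 * c * lam * (inverse (sqrt (4 * c * lam * r)) / 2)) (at r)"
      proof -
        have "((\<lambda>r. 4 * c * lam * r) has_real_derivative 4 * c * lam) (at r)"
          by (auto intro!: derivative_eq_intros)
        from DERIV_chain2[OF DERIV_real_sqrt this] s0 show ?thesis by (simp add: mult.commute)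
      qed
      hence "(L has_real_derivative - (4 * c * lam * (inverse (sqrt (4 * c * lam * r)) / 2)) / (sqrt (4 * c * lam * r) * sqrt (4 * c * lam * r))) (at r)"
        unfolding L_def[abs_def] using DERIV_divide[OF DERIV_const[of 1]] s0 by force
      also have "- (4 * c * lam * (inverse (sqrt (4 * c * lam * r)) / 2)) / (sqrt (4 * c * lam * r) * sqrt (4 * c * lam * r))
          = - (2 * c * lam) * (L r)\<^sup>2 * L r"
        using s0 by (simp add: L_def power2_eq_square field_simps)
      finally show ?thesis by (rule has_field_derivative_at_within)
    qed
    show "L t > 0" using Lpos t by simp
    show "L t \<le> L r \<and> L r \<le> Q" if "r \<in> {\<tau>..t}" for r
      using that \<tau> Lmono[of r t] Lmono[of \<tau> r] by (auto simp: Q_def)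
    show "- (2 * c * lam) * (L r)\<^sup>2 * L r \<le> 0" if "r \<in> {\<tau>..t}" for r
      using Lpos[of r] that \<tau> c lam by (simp add: mult_nonneg_nonneg)
    show "norm (gu r z) \<le> Q" if "\<tau> < r" for r z
      using gu_le[of r z] L\<tau> that \<tau> by (simp add: Q_def)
    show "\<bar>F a p - F a q\<bar> \<le> (\<nu> * (2 * Q) / sqrt \<delta> + lam * K) * \<bar>p - q\<bar>"
      if a: "a \<in> {sqrt \<delta>..amax}" and p: "p \<in> {0..Q}" and q: "q \<in> {0..Q}" for a p q
    proof -
      have a0: "a > 0" using a sd by (meson atLeastAtMost_iff less_le_trans)
      have Q0: "Q > 0" using Lpos[OF \<tau>(1)] by (simp add: Q_def)
      have "\<bar>\<nu> * p\<^sup>2 / a - \<nu> * q\<^sup>2 / a\<bar> = \<nu> / a * ((p + q) * \<bar>p - q\<bar>)"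
      proof -
        have "\<nu> * p\<^sup>2 / a - \<nu> * q\<^sup>2 / a = \<nu> / a * ((p + q) * (p - q))"
          using a0 by (simp add: power2_eq_square field_simps)
        thus ?thesis using nu a0 p q by (simp add: abs_mult)
      qed
      also have "\<dots> \<le> \<nu> / sqrt \<delta> * ((2 * Q) * \<bar>p - q\<bar>)"
        using nu a0 a p q sd by (intro mult_mono mult_right_mono divide_left_mono) auto
      finally have 1: "\<bar>\<nu> * p\<^sup>2 / a - \<nu> * q\<^sup>2 / a\<bar> \<le> \<nu> * (2 * Q) / sqrt \<delta> * \<bar>p - q\<bar>" by simp
      have "2 * a * x \<in> {0..2 * amax * Q}" if "x \<in> {0..Q}" for x
        using that a a0 Q0 by (auto intro!: mult_mono)
      from K(2)[OF this[OF p] this[OF q]]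
      have "\<bar>V (2 * a * p) - V (2 * a * q)\<bar> \<le> K * \<bar>2 * a * p - 2 * a * q\<bar>" .
      also have "\<bar>2 * a * p - 2 * a * q\<bar> = 2 * a * \<bar>p - q\<bar>"
        using a0 by (simp add: right_diff_distrib[symmetric] abs_mult)
      finally have "\<bar>V (2 * a * p) - V (2 * a * q)\<bar> / (2 * a) \<le> K * \<bar>p - q\<bar>"
        using a0 by (simp add: field_simps)
      hence "\<bar>V (2 * a * p) / (2 * a) - V (2 * a * q) / (2 * a)\<bar> \<le> K * \<bar>p - q\<bar>"
        using a0 by (simp add: diff_divide_distrib[symmetric])
      hence "lam * \<bar>V (2 * a * p) / (2 * a) - V (2 * a * q) / (2 * a)\<bar> \<le> lam * (K * \<bar>p - q\<bar>)"
        using lam by (intro mult_left_mono) auto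
      hence 2: "\<bar>lam * (V (2 * a * p) / (2 * a)) - lam * (V (2 * a * q) / (2 * a))\<bar> \<le> lam * K * \<bar>p - q\<bar>"
      proof -
        have "\<bar>lam * X - lam * Y\<bar> = lam * \<bar>X - Y\<bar>" for X Y
          using lam by (simp add: right_diff_distrib[symmetric] abs_mult)
        thus ?thesis using \<open>lam * _ \<le> lam * (K * _)\<close> by (simp only: mult.assoc)
      qed
      show ?thesis unfolding F_def distrib_right using 1 2 by linarith
    qed
    \<comment> \<open>Here the growth hypothesis acts: V(2 a L) / (2 a) is L times V(y) / y at y = 2
      a L, and that quotient grows at least at rate c in y. The term with \<nu> decreases in
      \<open>a\<close> and has the favourable sign.\<close>
    show "F a (L r) - F b (L r) \<le> - (2 * c * lam) * (L r)\<^sup>2 * L r / L r * (a - b)"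
      if r: "\<tau> < r" and a: "a \<in> {sqrt \<delta>..amax}" and b: "b \<in> {sqrt \<delta>..amax}" and ab: "b < a" for r a b
    proof -
      have a0: "a > 0" and b0: "b > 0" using a b sd by (meson atLeastAtMost_iff less_le_trans)+
      have l: "L r > 0" using Lpos r \<tau> by simp
      have 1: "\<nu> * (L r)\<^sup>2 / a \<le> \<nu> * (L r)\<^sup>2 / b"
        using nu ab a0 b0 by (intro divide_left_mono) auto
      have "c * (2 * a * L r - 2 * b * L r) \<le> V (2 * a * L r) / (2 * a * L r) - V (2 * b * L r) / (2 * b * L r)"
        using l a0 b0 ab by (intro V_quotient_mono) auto
      hence "L r * (c * (2 * a * L r - 2 * b * L r)) \<le> L r * (V (2 * a * L r) / (2 * a * L r) - V (2 * b * L r) / (2 * b * L r))"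
        using l by (intro mult_left_mono) auto
      also have "\<dots> = V (2 * a * L r) / (2 * a) - V (2 * b * L r) / (2 * b)"
        using l a0 b0 by (simp add: field_simps)
      finally have "lam * (L r * (c * (2 * a * L r - 2 * b * L r))) \<le> lam * (V (2 * a * L r) / (2 * a) - V (2 * b * L r) / (2 * b))"
        using lam by (intro mult_left_mono) auto
      moreover have "lam * (L r * (c * (2 * a * L r - 2 * b * L r))) = - (- (2 * c * lam) * (L r)\<^sup>2 * L r / L r * (a - b))"
        using l by (simp add: power2_eq_square algebra_simps)
      ultimately show ?thesis unfolding F_def right_diff_distrib using 1 by linarith
    qed
    show "u \<tau> y - u \<tau> z \<le> L \<tau> * dist y z" for y z
      using \<tau> L\<tau> gu_le[of \<tau>] by (intro lipschitz_if_norm_gradient_le[OF gu]) (auto intro: order_trans)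
  qed (use nu \<tau> ut gu Hu in auto)
  hence "norm (gu t x) \<le> L t" using Lpos[OF t] by (intro norm_gradient_le_if_lipschitz[OF gu[OF t]]) auto
  hence "norm (g t x) \<le> 2 * u t x * L t"
    using u_pos[of t x] t by (simp add: ngu field_simps)
  hence "(norm (g t x))\<^sup>2 \<le> (2 * u t x * L t)\<^sup>2" by (intro power_mono) auto
  also have "\<dots> = 4 * (M + \<delta> - h t x) * (1 / (4 * c * lam * t))"
    using t by (simp add: power_mult_distrib usq Lsq)
  also have "\<dots> \<le> 4 * (2 * M + \<delta>) * (1 / (4 * c * lam * t))"
    using rad(2)[of t x] t c lam by (intro mult_right_mono) auto
  finally show ?thesis using t c lam by (simp add: field_simps)
qed

lemma gradient_decay:
  assumes M: "\<And>t x. t \<ge> 0 \<Longrightarrow> \<bar>h t x\<bar> \<le> M" and t: "t > 0"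
  shows "c * lam * t * (norm (g t x))\<^sup>2 \<le> 2 * M"
  by (rule field_le_epsilon) (rule gradient_decay_aux[OF M t])

end

section \<open>Gaussian averages and singular kernels\<close>

lemma nn_integral_inverse_sqrt_le:
  assumes "s < T"
  shows "(\<integral>\<^sup>+r. indicator {s<..<T} r * ennreal (1 / sqrt (r - s)) \<partial>lborel) \<le> ennreal (2 * sqrt (T - s))"
    and "(\<integral>\<^sup>+r. indicator {s<..<T} r * ennreal (1 / sqrt (T - r)) \<partial>lborel) \<le> ennreal (2 * sqrt (T - s))"
proof -
  have 1: "((\<lambda>r. 1 / sqrt (r - s)) has_integral (2 * sqrt (T - s) - 2 * sqrt (s - s))) {s..T}"
  proof (rule fundamental_theorem_of_calculus_interior)
    fix r assume "r \<in> {s<..<T}"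
    thus "((\<lambda>r. 2 * sqrt (r - s)) has_vector_derivative 1 / sqrt (r - s)) (at r)"
      by (auto intro!: derivative_eq_intros simp: has_real_derivative_iff_has_vector_derivative[symmetric] field_simps)
  qed (use assms in \<open>auto intro!: continuous_intros\<close>)
  have 2: "((\<lambda>r. 1 / sqrt (T - r)) has_integral (- 2 * sqrt (T - T) - (- 2 * sqrt (T - s)))) {s..T}"
  proof (rule fundamental_theorem_of_calculus_interior)
    fix r assume "r \<in> {s<..<T}"
    thus "((\<lambda>r. - 2 * sqrt (T - r)) has_vector_derivative 1 / sqrt (T - r)) (at r)"
      by (auto intro!: derivative_eq_intros simp: has_real_derivative_iff_has_vector_derivative[symmetric] field_simps)
  qed (use assms in \<open>auto intro!: continuous_intros\<close>)
  have "(\<integral>\<^sup>+r. indicator {s<..<T} r * ennreal (1 / sqrt (r - s)) \<partial>lborel)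
      \<le> (\<integral>\<^sup>+r. ennreal (1 / sqrt (r - s)) * indicator {s..T} r \<partial>lborel)"
    by (intro nn_integral_mono) (auto simp: indicator_def)
  also have "\<dots> = ennreal (2 * sqrt (T - s))"
    using nn_integral_has_integral_lebesgue'[OF _ 1] by simp
  finally show "(\<integral>\<^sup>+r. indicator {s<..<T} r * ennreal (1 / sqrt (r - s)) \<partial>lborel) \<le> ennreal (2 * sqrt (T - s))" .
  have "(\<integral>\<^sup>+r. indicator {s<..<T} r * ennreal (1 / sqrt (T - r)) \<partial>lborel)
      \<le> (\<integral>\<^sup>+r. ennreal (1 / sqrt (T - r)) * indicator {s..T} r \<partial>lborel)"
    by (intro nn_integral_mono) (auto simp: indicator_def)
  also have "\<dots> = ennreal (2 * sqrt (T - s))"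
    using nn_integral_has_integral_lebesgue'[OF _ 2] by simp
  finally show "(\<integral>\<^sup>+r. indicator {s<..<T} r * ennreal (1 / sqrt (T - r)) \<partial>lborel) \<le> ennreal (2 * sqrt (T - s))" .
qed

abbreviation mean_abs :: "('a::euclidean_space \<Rightarrow> real) \<Rightarrow> ennreal" where
  "mean_abs \<phi> \<equiv> (\<integral>\<^sup>+x. ennreal \<bar>\<phi> x\<bar> \<partial>lborel)"

text \<open>Up to a constant, the fractional integral of order 1/2. Applied twice it is a multiple
  of ordinary integration, which is what \<open>singular_iteration\<close> exploits.\<close>

abbreviation abel :: "real \<Rightarrow> real \<Rightarrow> (real \<Rightarrow> ennreal) \<Rightarrow> ennreal" where
  "abel s t v \<equiv> (\<integral>\<^sup>+r. indicator {s<..<t} r * (ennreal (1 / sqrt (t - r)) * v r) \<partial>lborel)"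

text \<open>The exact value of the integral is \<open>\<pi>\<close>.\<close>

lemma beta_kernel_le:
  assumes "s < T"
  shows "(\<integral>\<^sup>+r. indicator {s<..<T} r * (ennreal (1 / sqrt (T - r)) * ennreal (1 / sqrt (r - s))) \<partial>lborel) \<le> 6"
proof -
  \<comment> \<open>At every point the factor whose singularity is farther away is at most
    \<open>A\<close>. The resulting total is \<open>4 * sqrt 2\<close>, rounded up to 6.\<close>
  define A where "A = 1 / sqrt ((T - s) / 2)"
  have A: "A > 0" using assms by (simp add: A_def)
  have pt: "indicator {s<..<T} r * (ennreal (1 / sqrt (T - r)) * ennreal (1 / sqrt (r - s)))
     \<le> ennreal A * (indicator {s<..<T} r * ennreal (1 / sqrt (r - s)) + indicator {s<..<T} r * ennreal (1 / sqrt (T - r)))" for r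
  proof (cases "r \<in> {s<..<T}")
    case True
    let ?p = "1 / sqrt (T - r)" and ?q = "1 / sqrt (r - s)"
    have pq: "?p \<ge> 0" "?q \<ge> 0" using True by auto
    have "?p * ?q \<le> A * (?q + ?p)"
    proof (cases "r \<le> (s + T) / 2")
      case True': True
      have "(T - s) / 2 \<le> T - r" using True' by (simp add: field_simps)
      hence "?p \<le> A" unfolding A_def using assms True
        by (intro divide_left_mono real_sqrt_le_mono mult_pos_pos) auto
      hence "?p * ?q \<le> A * ?q" using pq by (intro mult_right_mono)
      thus ?thesis using A pq by (simp add: distrib_left add_increasing2)
    next
      case False
      have "(T - s) / 2 \<le> r - s" using False by (simp add: field_simps)
      hence "?q \<le> A" unfolding A_def using assms True
        by (intro divide_left_mono real_sqrt_le_mono mult_pos_pos) auto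
      hence "?p * ?q \<le> ?p * A" using pq by (intro mult_left_mono)
      thus ?thesis using A pq by (simp add: distrib_left add_increasing mult.commute)
    qed
    hence "ennreal (?p * ?q) \<le> ennreal (A * (?q + ?p))" by (rule ennreal_leI)
    moreover have "ennreal (?p * ?q) = ennreal ?p * ennreal ?q" by (rule ennreal_mult[OF pq])
    moreover have "ennreal (A * (?q + ?p)) = ennreal A * (ennreal ?q + ennreal ?p)"
      using A pq by (subst ennreal_mult) (auto simp del: ennreal_plus simp add: ennreal_plus[symmetric])
    ultimately have "ennreal ?p * ennreal ?q \<le> ennreal A * (ennreal ?q + ennreal ?p)" by simp
    moreover have "(indicator {s<..<T} r :: ennreal) = 1" using True by simp
    ultimately show ?thesis by simp
  qed simp
  have "(\<integral>\<^sup>+r. indicator {s<..<T} r * (ennreal (1 / sqrt (T - r)) * ennreal (1 / sqrt (r - s))) \<partial>lborel)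
     \<le> (\<integral>\<^sup>+r. ennreal A * (indicator {s<..<T} r * ennreal (1 / sqrt (r - s)) + indicator {s<..<T} r * ennreal (1 / sqrt (T - r))) \<partial>lborel)"
    by (intro nn_integral_mono pt)
  also have "\<dots> = ennreal A * ((\<integral>\<^sup>+r. indicator {s<..<T} r * ennreal (1 / sqrt (r - s)) \<partial>lborel)
       + (\<integral>\<^sup>+r. indicator {s<..<T} r * ennreal (1 / sqrt (T - r)) \<partial>lborel))"
    by (subst nn_integral_cmult) (measurable, subst nn_integral_add, measurable)
  also have "\<dots> \<le> ennreal A * (ennreal (2 * sqrt (T - s)) + ennreal (2 * sqrt (T - s)))"
    by (intro mult_left_mono add_mono nn_integral_inverse_sqrt_le assms) simp
  also have "\<dots> = ennreal (A * (2 * sqrt (T - s) + 2 * sqrt (T - s)))"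
    using A assms ennreal_plus[of "2 * sqrt (T - s)" "2 * sqrt (T - s)"]
      ennreal_mult[of A "2 * sqrt (T - s) + 2 * sqrt (T - s)"] by (metis add_nonneg_nonneg diff_ge_0_iff_ge less_imp_le mult_nonneg_nonneg real_sqrt_ge_zero zero_le_numeral)
  also have "A * (2 * sqrt (T - s) + 2 * sqrt (T - s)) = 4 * sqrt 2"
    using assms by (simp add: A_def real_sqrt_divide)
  also have "ennreal (4 * sqrt 2) \<le> ennreal 6"
  proof (rule ennreal_leI)
    have "sqrt 2 \<le> (3/2 :: real)" by (rule real_le_lsqrt) (auto simp: power2_eq_square)
    thus "4 * sqrt 2 \<le> (6::real)" by simp
  qed
  finally show ?thesis by simp
qed

text \<open>One substitution of the bound on \<open>N\<close> into itself already removes the singularity: the double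
  kernel is bounded, and what is left is the total mass of \<open>v\<close>.\<close>

lemma singular_iteration:
  fixes N v :: "real \<Rightarrow> ennreal" and \<alpha> \<beta> \<mu> b :: ennreal
  assumes sT: "s < T" and [measurable]: "v \<in> borel_measurable borel"
    and N: "\<And>r. s < r \<Longrightarrow> r < T \<Longrightarrow> N r \<le> \<alpha> * ennreal (1 / sqrt (r - s))
        + \<beta> * abel s r v"
    and v: "\<And>r. s < r \<Longrightarrow> r < T \<Longrightarrow> v r \<le> b * N r"
    and \<mu>: "(\<integral>\<^sup>+r. indicator {s<..<T} r * v r \<partial>lborel) \<le> \<mu>"
  shows "abel s T v \<le> 6 * b * (\<alpha> + \<beta> * \<mu>)"
proof -
  let ?k = "\<lambda>x::real. ennreal (1 / sqrt x)"
  let ?I = "\<lambda>r. \<integral>\<^sup>+\<sigma>. indicator {s<..<r} \<sigma> * (?k (r - \<sigma>) * v \<sigma>) \<partial>lborel"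
  \<comment> \<open>The endpoint of the interval moves with the other variable; jointly this is the
    indicator of an open wedge.\<close>
  have ind_meas: "(\<lambda>p. indicator {s<..<fst p} (snd p) :: ennreal) \<in> borel_measurable (borel \<Otimes>\<^sub>M borel)"
  proof -
    have "(\<lambda>p::real \<times> real. indicator {s<..<fst p} (snd p) :: ennreal) = (\<lambda>p. indicator {p. s < snd p \<and> snd p < fst p} p)"
      by (auto simp: indicator_def fun_eq_iff)
    moreover have "{p::real \<times> real. s < snd p \<and> snd p < fst p} \<in> sets (borel \<Otimes>\<^sub>M borel)"
      unfolding borel_prod by (intro borel_open open_Collect_conj open_Collect_less continuous_intros)
    ultimately show ?thesis by simp
  qed
  have [measurable]: "(\<lambda>(r, \<sigma>). indicator {s<..<r} \<sigma> * (?k (r - \<sigma>) * v \<sigma>)) \<in> borel_measurable (borel \<Otimes>\<^sub>M borel)"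
    unfolding case_prod_beta using ind_meas by measurable
  have I_meas [measurable]: "?I \<in> borel_measurable borel" by measurable
  have "(\<integral>\<^sup>+r. indicator {s<..<T} r * (?k (T - r) * v r) \<partial>lborel)
     \<le> (\<integral>\<^sup>+r. b * (\<alpha> * (indicator {s<..<T} r * (?k (T - r) * ?k (r - s))) + \<beta> * (indicator {s<..<T} r * (?k (T - r) * ?I r))) \<partial>lborel)"
  proof (rule nn_integral_mono)
    fix r
    show "indicator {s<..<T} r * (?k (T - r) * v r)
        \<le> b * (\<alpha> * (indicator {s<..<T} r * (?k (T - r) * ?k (r - s))) + \<beta> * (indicator {s<..<T} r * (?k (T - r) * ?I r)))"
    proof (cases "r \<in> {s<..<T}")
      case True
      have "v r \<le> b * (\<alpha> * ?k (r - s) + \<beta> * ?I r)"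
        by (rule order_trans[OF v mult_left_mono[OF N]]) (use True in auto)
      hence "?k (T - r) * v r \<le> ?k (T - r) * (b * (\<alpha> * ?k (r - s) + \<beta> * ?I r))" by (rule mult_left_mono) simp
      thus ?thesis using True by (simp add: distrib_left mult_ac)
    qed simp
  qed
  also have "\<dots> = b * (\<alpha> * (\<integral>\<^sup>+r. indicator {s<..<T} r * (?k (T - r) * ?k (r - s)) \<partial>lborel)
      + \<beta> * (\<integral>\<^sup>+r. indicator {s<..<T} r * (?k (T - r) * ?I r) \<partial>lborel))"
    by (subst nn_integral_cmult, measurable, subst nn_integral_add, measurable, subst (1 2) nn_integral_cmult, measurable)
  also have "(\<integral>\<^sup>+r. indicator {s<..<T} r * (?k (T - r) * ?I r) \<partial>lborel) \<le> 6 * \<mu>"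
  proof -
    have "(\<integral>\<^sup>+r. indicator {s<..<T} r * (?k (T - r) * ?I r) \<partial>lborel)
       = (\<integral>\<^sup>+r. \<integral>\<^sup>+\<sigma>. indicator {s<..<T} r * (?k (T - r) * (indicator {s<..<r} \<sigma> * (?k (r - \<sigma>) * v \<sigma>))) \<partial>lborel \<partial>lborel)"
    proof (rule nn_integral_cong)
      fix r
      have [measurable]: "(\<lambda>\<sigma>. indicator {s<..<r} \<sigma> * (?k (r - \<sigma>) * v \<sigma>)) \<in> borel_measurable borel" by measurable
      show "indicator {s<..<T} r * (?k (T - r) * ?I r)
        = (\<integral>\<^sup>+\<sigma>. indicator {s<..<T} r * (?k (T - r) * (indicator {s<..<r} \<sigma> * (?k (r - \<sigma>) * v \<sigma>))) \<partial>lborel)"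
        by (subst nn_integral_cmult, measurable, subst nn_integral_cmult, measurable)
    qed
    \<comment> \<open>After the exchange, the inner integral over \<open>r\<close> from
      \<open>\<sigma>\<close> to \<open>T\<close> is the one bounded in
      \<open>beta_kernel_le\<close>.\<close>
    also have "\<dots> = (\<integral>\<^sup>+\<sigma>. \<integral>\<^sup>+r. indicator {s<..<T} r * (?k (T - r) * (indicator {s<..<r} \<sigma> * (?k (r - \<sigma>) * v \<sigma>))) \<partial>lborel \<partial>lborel)"
    proof (rule lborel_pair.Fubini'[symmetric])
      have "(\<lambda>p. indicator {s<..<T} (fst p) * (?k (T - fst p) * (indicator {s<..<fst p} (snd p) * (?k (fst p - snd p) * v (snd p))))) \<in> borel_measurable (borel \<Otimes>\<^sub>M borel)"
        using ind_meas by measurable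
      thus "(\<lambda>(r, \<sigma>). indicator {s<..<T} r * (?k (T - r) * (indicator {s<..<r} \<sigma> * (?k (r - \<sigma>) * v \<sigma>)))) \<in> borel_measurable (lborel \<Otimes>\<^sub>M lborel)"
        by (simp add: case_prod_beta)
    qed
    also have "\<dots> \<le> (\<integral>\<^sup>+\<sigma>. (indicator {s<..<T} \<sigma> * v \<sigma>) * 6 \<partial>lborel)"
    proof (rule nn_integral_mono)
      fix \<sigma>
      show "(\<integral>\<^sup>+r. indicator {s<..<T} r * (?k (T - r) * (indicator {s<..<r} \<sigma> * (?k (r - \<sigma>) * v \<sigma>))) \<partial>lborel) \<le> (indicator {s<..<T} \<sigma> * v \<sigma>) * 6"
      proof (cases "\<sigma> \<in> {s<..<T}")
        case True
        have "(\<integral>\<^sup>+r. indicator {s<..<T} r * (?k (T - r) * (indicator {s<..<r} \<sigma> * (?k (r - \<sigma>) * v \<sigma>))) \<partial>lborel)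
           = (\<integral>\<^sup>+r. v \<sigma> * (indicator {\<sigma><..<T} r * (?k (T - r) * ?k (r - \<sigma>))) \<partial>lborel)"
          using True by (intro nn_integral_cong) (auto simp: indicator_def mult_ac)
        also have "\<dots> = v \<sigma> * (\<integral>\<^sup>+r. indicator {\<sigma><..<T} r * (?k (T - r) * ?k (r - \<sigma>)) \<partial>lborel)"
          by (rule nn_integral_cmult) measurable
        also have "\<dots> \<le> v \<sigma> * 6" using True by (intro mult_left_mono beta_kernel_le) auto
        finally show ?thesis using True by simp
      next
        case False
        hence "indicator {s<..<T} r * (?k (T - r) * (indicator {s<..<r} \<sigma> * (?k (r - \<sigma>) * v \<sigma>))) = 0" for r
          by (auto simp: indicator_def)
        thus ?thesis by (simp only: nn_integral_0_iff_AE nn_integral_const) simp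
      qed
    qed
    also have "\<dots> = (\<integral>\<^sup>+\<sigma>. indicator {s<..<T} \<sigma> * v \<sigma> \<partial>lborel) * 6" by (rule nn_integral_multc) measurable
    also have "\<dots> \<le> \<mu> * 6" by (intro mult_right_mono \<mu>) simp
    finally show ?thesis by (simp add: mult.commute)
  qed
  also have "(\<integral>\<^sup>+r. indicator {s<..<T} r * (?k (T - r) * ?k (r - s)) \<partial>lborel) \<le> 6" by (rule beta_kernel_le[OF sT])
  also have "b * (\<alpha> * 6 + \<beta> * (6 * \<mu>)) = 6 * b * (\<alpha> + \<beta> * \<mu>)" by (simp add: algebra_simps)
  finally show ?thesis by (simp add: add_mono mult_left_mono)
qed

section \<open>Gaussian averages and their increments in the mean\<close>

lemma integrable_gauss_times_bounded:
  assumes [measurable]: "\<phi> \<in> borel_measurable borel" and "\<And>z. \<bar>\<phi> z\<bar> \<le> C"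
  shows "integrable lborel (\<lambda>z::real^'n. gauss z * \<phi> z)"
proof (rule Bochner_Integration.integrable_bound)
  show "integrable lborel (\<lambda>z::real^'n. gauss z * C)" by simp
  show "AE z::real^'n in lborel. norm (gauss z * \<phi> z) \<le> norm (gauss z * C)"
  proof (rule AE_I2)
    fix z :: "real^'n"
    have "\<bar>\<phi> z\<bar> \<le> \<bar>C\<bar>" using assms(2)[of z] by linarith
    thus "norm (gauss z * \<phi> z) \<le> norm (gauss z * C)" by (simp add: abs_mult mult_left_mono)
  qed
qed measurable

lemma nn_integral_gauss_average:
  fixes \<phi> :: "real ^ 'n \<Rightarrow> ennreal"
  assumes [measurable]: "\<phi> \<in> borel_measurable borel"
  shows "(\<integral>\<^sup>+x. \<integral>\<^sup>+z. ennreal (gauss z) * \<phi> (x + a *\<^sub>R z) \<partial>lborel \<partial>lborel) = (\<integral>\<^sup>+x. \<phi> x \<partial>lborel)"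
proof -
  have "(\<integral>\<^sup>+x. \<integral>\<^sup>+z. ennreal (gauss z) * \<phi> (x + a *\<^sub>R z) \<partial>lborel \<partial>lborel)
     = (\<integral>\<^sup>+z. \<integral>\<^sup>+x. ennreal (gauss z) * \<phi> (x + a *\<^sub>R z) \<partial>lborel \<partial>lborel)"
    by (rule lborel_pair.Fubini'[symmetric]) measurable
  also have "\<dots> = (\<integral>\<^sup>+z. ennreal (gauss (z::real^'n)) * (\<integral>\<^sup>+x. \<phi> x \<partial>lborel) \<partial>lborel)"
    by (intro nn_integral_cong) (simp add: nn_integral_cmult nn_integral_shift)
  also have "\<dots> = (\<integral>\<^sup>+x. \<phi> x \<partial>lborel)" by (simp add: nn_integral_multc nn_integral_gauss)
  finally show ?thesis .
qed

lemma abs_gauss_average_le: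
  assumes [measurable]: "\<phi> \<in> borel_measurable borel" and "\<And>z. \<bar>\<phi> z\<bar> \<le> C"
  shows "ennreal \<bar>LINT z|lborel. gauss (z::real^'n) * \<phi> z\<bar> \<le> (\<integral>\<^sup>+z. ennreal (gauss z) * ennreal \<bar>\<phi> z\<bar> \<partial>lborel)"
  using integral_norm_bound_ennreal[OF integrable_gauss_times_bounded[OF assms]]
  by (simp add: abs_mult ennreal_mult)

lemma nn_integral_abs_gauss_average_le:
  assumes [measurable]: "\<phi> \<in> borel_measurable borel" and bd: "\<And>z. \<bar>\<phi> z\<bar> \<le> C"
  shows "(\<integral>\<^sup>+x. ennreal \<bar>LINT z|lborel. gauss (z::real^'n) * \<phi> (x + a *\<^sub>R z)\<bar> \<partial>lborel) \<le> mean_abs \<phi>"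
proof -
  have "(\<integral>\<^sup>+x. ennreal \<bar>LINT z|lborel. gauss (z::real^'n) * \<phi> (x + a *\<^sub>R z)\<bar> \<partial>lborel)
     \<le> (\<integral>\<^sup>+x. \<integral>\<^sup>+z. ennreal (gauss z) * ennreal \<bar>\<phi> (x + a *\<^sub>R z)\<bar> \<partial>lborel \<partial>lborel)"
    by (intro nn_integral_mono abs_gauss_average_le[where C = C] bd) measurable
  also have "\<dots> = mean_abs \<phi>"
    by (rule nn_integral_gauss_average[of "\<lambda>x. ennreal \<bar>\<phi> x\<bar>"]) measurable
  finally show ?thesis .
qed

lemma borel_measurable_vec_nth [measurable (raw)]:
  assumes "f \<in> borel_measurable M"
  shows "(\<lambda>x. (f x :: real^'n) $ i) \<in> borel_measurable M"
  by (rule measurable_compose[OF assms borel_measurable_continuous_onI]) (intro continuous_intros)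

text \<open>The increment is the integral of the derivative along a segment. After exchanging the
  integrals every slice is a translate with the same integral \<open>gauss_moment i\<close>.\<close>

lemma nn_integral_gauss_difference_le:
  assumes \<delta>: "\<delta> > 0"
  shows "(\<integral>\<^sup>+z. ennreal \<bar>gauss (z - \<delta> *\<^sub>R axis i 1) - gauss (z::real^'n)\<bar> \<partial>lborel)
     \<le> ennreal \<delta> * gauss_moment i"
proof -
  let ?e = "axis i 1 :: real^'n"
  let ?d = "\<lambda>z \<theta>. gauss (z - \<theta> *\<^sub>R ?e) * ((z - \<theta> *\<^sub>R ?e) $ i)"
  have pt: "ennreal \<bar>gauss (z - \<delta> *\<^sub>R ?e) - gauss z\<bar> \<le> (\<integral>\<^sup>+\<theta>. indicator {0..\<delta>} \<theta> * ennreal \<bar>?d z \<theta>\<bar> \<partial>lborel)" for z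
  proof -
    have der: "((\<lambda>\<theta>. gauss (z - \<theta> *\<^sub>R ?e)) has_real_derivative ?d z \<theta>) (at \<theta>)" for \<theta>
    proof -
      have 1: "((\<lambda>\<theta>. z - \<theta> *\<^sub>R ?e) has_derivative (\<lambda>h. - (h *\<^sub>R ?e))) (at \<theta>)"
        by (auto intro!: derivative_eq_intros)
      have "((\<lambda>\<theta>. gauss (z - \<theta> *\<^sub>R ?e)) has_derivative (\<lambda>h. - (gauss (z - \<theta> *\<^sub>R ?e) * ((z - \<theta> *\<^sub>R ?e) \<bullet> - (h *\<^sub>R ?e))))) (at \<theta>)"
        by (rule has_derivative_compose[OF 1 has_derivative_gauss])
      thus ?thesis unfolding has_field_derivative_def
        by (rule has_derivative_eq_rhs) (auto simp: fun_eq_iff)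
    qed
    have ftc: "(?d z has_integral (gauss (z - \<delta> *\<^sub>R ?e) - gauss (z - 0 *\<^sub>R ?e))) {0..\<delta>}"
      using \<delta> der by (intro fundamental_theorem_of_calculus)
        (auto simp: has_real_derivative_iff_has_vector_derivative intro: has_vector_derivative_at_within)
    have int: "set_integrable lborel {0..\<delta>} (?d z)"
      unfolding set_integrable_def by (rule borel_integrable_compact) (auto intro!: continuous_intros)
    have "gauss (z - \<delta> *\<^sub>R ?e) - gauss z = (LINT \<theta>|lborel. indicator {0..\<delta>} \<theta> *\<^sub>R ?d z \<theta>)"
      using set_borel_integral_eq_integral(2)[OF int] integral_unique[OF ftc] by (simp add: set_lebesgue_integral_def)
    hence "ennreal \<bar>gauss (z - \<delta> *\<^sub>R ?e) - gauss z\<bar> \<le> (\<integral>\<^sup>+\<theta>. ennreal (norm (indicator {0..\<delta>} \<theta> *\<^sub>R ?d z \<theta>)) \<partial>lborel)"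
      using integral_norm_bound_ennreal[OF int[unfolded set_integrable_def]] by simp
    also have "\<dots> = (\<integral>\<^sup>+\<theta>. indicator {0..\<delta>} \<theta> * ennreal \<bar>?d z \<theta>\<bar> \<partial>lborel)"
      by (intro nn_integral_cong) (auto simp: indicator_def)
    finally show ?thesis .
  qed
  have "(\<integral>\<^sup>+z. ennreal \<bar>gauss (z - \<delta> *\<^sub>R ?e) - gauss z\<bar> \<partial>lborel)
     \<le> (\<integral>\<^sup>+z. \<integral>\<^sup>+\<theta>. indicator {0..\<delta>} \<theta> * ennreal \<bar>?d z \<theta>\<bar> \<partial>lborel \<partial>lborel)"
    by (intro nn_integral_mono pt)
  also have "\<dots> = (\<integral>\<^sup>+\<theta>. \<integral>\<^sup>+z. indicator {0..\<delta>} \<theta> * ennreal \<bar>?d z \<theta>\<bar> \<partial>lborel \<partial>lborel)"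
    by (rule lborel_pair.Fubini') measurable
  also have "\<dots> = (\<integral>\<^sup>+\<theta>. indicator {0..\<delta>} \<theta> * gauss_moment i \<partial>lborel)"
  proof (rule nn_integral_cong)
    fix \<theta>
    have "(\<integral>\<^sup>+z. ennreal \<bar>?d z \<theta>\<bar> \<partial>lborel) = gauss_moment i"
      using nn_integral_shift[of "\<lambda>z::real^'n. ennreal (gauss z * \<bar>z $ i\<bar>)" "- (\<theta> *\<^sub>R ?e)"]
      by (simp add: abs_mult)
    thus "(\<integral>\<^sup>+z. indicator {0..\<delta>} \<theta> * ennreal \<bar>?d z \<theta>\<bar> \<partial>lborel) = indicator {0..\<delta>} \<theta> * gauss_moment i"
      by (simp add: nn_integral_cmult)
  qed
  also have "\<dots> = ennreal \<delta> * gauss_moment i"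
    using \<delta> by (simp add: nn_integral_multc)
  finally show ?thesis .
qed

text \<open>A step \<open>\<epsilon>\<close> in \<open>x\<close> equals a step
  \<open>\<epsilon> / a\<close> in \<open>z\<close>, and the latter is moved from
  \<open>\<phi>\<close> to the Gaussian. Thus \<open>\<phi>\<close> need not be smooth, and the
  price is the factor \<open>1 / a\<close>.\<close>

lemma nn_integral_gauss_average_difference_le:
  assumes [measurable]: "\<phi> \<in> borel_measurable borel" and bd: "\<And>z. \<bar>\<phi> z\<bar> \<le> C" and a: "a > 0" and \<epsilon>: "\<epsilon> > 0"
    and \<kappa>: "gauss_moment i \<le> ennreal \<kappa>"
  shows "(\<integral>\<^sup>+x. ennreal \<bar>(LINT z|lborel. gauss (z::real^'n) * \<phi> (x + \<epsilon> *\<^sub>R axis i 1 + a *\<^sub>R z))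
        - (LINT z|lborel. gauss z * \<phi> (x + a *\<^sub>R z))\<bar> \<partial>lborel)
     \<le> ennreal (\<epsilon> * (1 / a)) * (ennreal \<kappa> * mean_abs \<phi>)"
proof -
  let ?e = "axis i 1 :: real^'n"
  define \<delta> where "\<delta> = \<epsilon> / a"
  have \<delta>: "\<delta> > 0" using a \<epsilon> by (simp add: \<delta>_def)
  let ?D = "\<lambda>z. gauss (z - \<delta> *\<^sub>R ?e) - gauss z"
  have pt: "ennreal \<bar>(LINT z|lborel. gauss (z::real^'n) * \<phi> (x + \<epsilon> *\<^sub>R ?e + a *\<^sub>R z)) - (LINT z|lborel. gauss z * \<phi> (x + a *\<^sub>R z))\<bar>
     \<le> (\<integral>\<^sup>+z. ennreal \<bar>?D z\<bar> * ennreal \<bar>\<phi> (x + a *\<^sub>R z)\<bar> \<partial>lborel)" for x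
  proof -
    have int1: "integrable lborel (\<lambda>z. gauss z * \<phi> (x + a *\<^sub>R (z + \<delta> *\<^sub>R ?e)))"
      by (rule integrable_gauss_times_bounded[where C = C]) (simp_all add: bd)
    have int2: "integrable lborel (\<lambda>z. gauss z * \<phi> (x + a *\<^sub>R z))"
      by (rule integrable_gauss_times_bounded[where C = C]) (simp_all add: bd)
    have int1': "integrable lborel (\<lambda>z. gauss (z - \<delta> *\<^sub>R ?e) * \<phi> (x + a *\<^sub>R z))"
    proof -
      let ?G = "\<lambda>z. gauss (z - \<delta> *\<^sub>R ?e) * \<phi> (x + a *\<^sub>R z)"
      have "integrable lborel (\<lambda>z. ?G (z + \<delta> *\<^sub>R ?e))" using int1 by simp
      hence "integrable (distr lborel borel ((+) (\<delta> *\<^sub>R ?e))) ?G"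
        by (subst integrable_distr_eq) (simp_all add: add.commute)
      thus ?thesis by (simp add: lborel_distr_plus)
    qed
    have "(LINT z|lborel. gauss z * \<phi> (x + \<epsilon> *\<^sub>R ?e + a *\<^sub>R z)) = (LINT z|lborel. gauss (z - \<delta> *\<^sub>R ?e) * \<phi> (x + a *\<^sub>R z))"
      using lborel_integral_shift[of "\<lambda>z. gauss (z - \<delta> *\<^sub>R ?e) * \<phi> (x + a *\<^sub>R z)" "\<delta> *\<^sub>R ?e"] a
      by (simp add: \<delta>_def scaleR_add_right add_ac)
    hence "(LINT z|lborel. gauss z * \<phi> (x + \<epsilon> *\<^sub>R ?e + a *\<^sub>R z)) - (LINT z|lborel. gauss z * \<phi> (x + a *\<^sub>R z))
       = (LINT z|lborel. ?D z * \<phi> (x + a *\<^sub>R z))"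
      using int1' int2 by (simp add: left_diff_distrib)
    moreover have "integrable lborel (\<lambda>z. ?D z * \<phi> (x + a *\<^sub>R z))"
      using int1' int2 by (simp add: left_diff_distrib)
    ultimately show ?thesis
      using integral_norm_bound_ennreal[of lborel "\<lambda>z. ?D z * \<phi> (x + a *\<^sub>R z)"] by (simp add: abs_mult ennreal_mult)
  qed
  have "(\<integral>\<^sup>+x. ennreal \<bar>(LINT z|lborel. gauss (z::real^'n) * \<phi> (x + \<epsilon> *\<^sub>R ?e + a *\<^sub>R z)) - (LINT z|lborel. gauss z * \<phi> (x + a *\<^sub>R z))\<bar> \<partial>lborel)
     \<le> (\<integral>\<^sup>+x. \<integral>\<^sup>+z. ennreal \<bar>?D z\<bar> * ennreal \<bar>\<phi> (x + a *\<^sub>R z)\<bar> \<partial>lborel \<partial>lborel)"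
    by (intro nn_integral_mono pt)
  also have "\<dots> = (\<integral>\<^sup>+z. \<integral>\<^sup>+x. ennreal \<bar>?D z\<bar> * ennreal \<bar>\<phi> (x + a *\<^sub>R z)\<bar> \<partial>lborel \<partial>lborel)"
    by (rule lborel_pair.Fubini'[symmetric]) measurable
  also have "\<dots> = (\<integral>\<^sup>+z. ennreal \<bar>?D z\<bar> * mean_abs \<phi> \<partial>lborel)"
  proof (rule nn_integral_cong)
    fix z
    have "(\<integral>\<^sup>+x. ennreal \<bar>\<phi> (x + a *\<^sub>R z)\<bar> \<partial>lborel) = mean_abs \<phi>"
      by (rule nn_integral_shift[of "\<lambda>x. ennreal \<bar>\<phi> x\<bar>"]) measurable
    thus "(\<integral>\<^sup>+x. ennreal \<bar>?D z\<bar> * ennreal \<bar>\<phi> (x + a *\<^sub>R z)\<bar> \<partial>lborel) = ennreal \<bar>?D z\<bar> * mean_abs \<phi>"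
      by (simp add: nn_integral_cmult)
  qed
  also have "\<dots> = (\<integral>\<^sup>+z. ennreal \<bar>?D z\<bar> \<partial>lborel) * mean_abs \<phi>"
    by (rule nn_integral_multc) measurable
  also have "\<dots> \<le> (ennreal \<delta> * ennreal \<kappa>) * mean_abs \<phi>"
    using order_trans[OF nn_integral_gauss_difference_le[OF \<delta>] mult_left_mono[OF \<kappa>]]
    by (intro mult_right_mono) simp_all
  finally show ?thesis by (simp add: \<delta>_def mult.assoc)
qed

lemma gauss_moment_bound:
  obtains \<kappa> :: real where "\<kappa> > 0" "\<And>i::'n::finite. gauss_moment i \<le> ennreal \<kappa>"
proof -
  let ?m = "\<lambda>i::'n. gauss_moment i"
  define \<kappa> where "\<kappa> = 1 + (\<Sum>i\<in>(UNIV::'n set). enn2real (?m i))"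
  have "?m i \<le> ennreal \<kappa>" for i
  proof -
    have "?m i = ennreal (enn2real (?m i))" using nn_integral_gauss_moment_finite[of i] by simp
    also have "enn2real (?m i) \<le> (\<Sum>i\<in>(UNIV::'n set). enn2real (?m i))"
      by (rule member_le_sum) auto
    hence "ennreal (enn2real (?m i)) \<le> ennreal \<kappa>" by (intro ennreal_leI) (simp add: \<kappa>_def)
    finally show ?thesis .
  qed
  moreover have "\<kappa> > 0" unfolding \<kappa>_def by (intro add_pos_nonneg sum_nonneg) auto
  ultimately show ?thesis using that by blast
qed

section \<open>Estimates in the mean\<close>

context heat_source
begin

text \<open>Nothing is known about \<open>f\<close> at times \<open>r \<le> 0\<close>; extending it by \<open>0\<close> makes it Borel measurable.\<close>

definition fb :: "real \<Rightarrow> real ^ 'n \<Rightarrow> real" where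
  "fb r x = indicator {0<..} r * f r x"

lemma borel_measurable_fb [measurable (raw)]:
  assumes [measurable]: "p \<in> borel_measurable M" "q \<in> borel_measurable M"
  shows "(\<lambda>y. fb (p y) (q y)) \<in> borel_measurable M"
proof -
  have "open ({0<..} \<times> (UNIV :: (real^'n) set) :: (real \<times> (real^'n)) set)" by (intro open_Times) auto
  hence "(\<lambda>p. indicator ({0<..} \<times> UNIV) p *\<^sub>R (case p of (t, x) \<Rightarrow> f t x)) \<in> borel_measurable borel"
    by (intro borel_measurable_continuous_on_indicator cont_f) auto
  also have "(\<lambda>p. indicator ({0<..} \<times> UNIV) p *\<^sub>R (case p of (t, x) \<Rightarrow> f t x)) = (\<lambda>p. fb (fst p) (snd p))"
    by (auto simp: fb_def indicator_def fun_eq_iff)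
  finally have m: "(\<lambda>p. fb (fst p) (snd p)) \<in> borel_measurable (borel \<Otimes>\<^sub>M borel)" by (simp add: borel_prod)
  have "(\<lambda>y. (p y, q y)) \<in> M \<rightarrow>\<^sub>M borel \<Otimes>\<^sub>M borel" by measurable
  from measurable_compose[OF this m] show ?thesis by simp
qed

lemma Bf_nonneg: "Bf \<ge> 0"
  using order_trans[OF abs_ge_zero bdd_f[of 1]] by simp

lemma bdd_fb: "\<bar>fb r x\<bar> \<le> Bf"
  using bdd_f[of r x] Bf_nonneg by (auto simp: fb_def indicator_def)

lemma cont_u_at: "t \<ge> 0 \<Longrightarrow> continuous_on UNIV (u t)"
proof -
  assume "t \<ge> 0"
  moreover have "continuous_on UNIV (\<lambda>x. (t, x))" by (intro continuous_intros)
  ultimately show ?thesis using continuous_on_compose2[OF cont_u, of UNIV "\<lambda>x. (t, x)"] by auto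
qed

lemma borel_measurable_u: "t \<ge> 0 \<Longrightarrow> u t \<in> borel_measurable borel"
  by (intro borel_measurable_continuous_onI cont_u_at)

definition heat :: "real \<Rightarrow> real ^ 'n \<Rightarrow> real" where
  "heat t x = (LINT z|lborel. gauss z * u 0 (x + sqrt (2 * \<nu> * t) *\<^sub>R z))"

definition src :: "real \<Rightarrow> real \<Rightarrow> real ^ 'n \<Rightarrow> real" where
  "src t r x = (LINT z|lborel. gauss z * fb r (x + sqrt (2 * \<nu> * (t - r)) *\<^sub>R z))"

lemma borel_measurable_src [measurable (raw)]:
  assumes [measurable]: "p \<in> borel_measurable M" "q \<in> borel_measurable M"
  shows "(\<lambda>y. src t (p y) (q y)) \<in> borel_measurable M"
  unfolding src_def by measurable

lemma borel_measurable_heat [measurable]: "heat t \<in> borel_measurable borel"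
proof -
  have [measurable]: "u 0 \<in> borel_measurable borel" by (simp add: borel_measurable_u)
  show ?thesis unfolding heat_def[abs_def] by measurable
qed

lemma bdd_src: "\<bar>src t r x\<bar> \<le> Bf"
proof -
  have int: "integrable lborel (\<lambda>z. gauss z * fb r (x + sqrt (2 * \<nu> * (t - r)) *\<^sub>R z))"
    by (rule integrable_gauss_times_bounded[where C = Bf]) (simp_all add: bdd_fb)
  have "\<bar>src t r x\<bar> \<le> (LINT z|lborel. gauss (z::real^'n) * Bf)"
    unfolding src_def
  proof (rule order_trans[OF integral_abs_bound integral_mono])
    show "\<bar>gauss z * fb r (x + sqrt (2 * \<nu> * (t - r)) *\<^sub>R z)\<bar> \<le> gauss z * Bf" for z
      using bdd_fb by (simp add: abs_mult mult_left_mono)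
  qed (use int in auto)
  thus ?thesis by (simp add: integral_gauss)
qed

lemma duhamel_src:
  assumes "t > 0"
  shows "u t x = heat t x + (LINT r|lborel. indicator {0<..<t} r * src t r x)"
proof -
  have "indicator {0<..<t} r * src t r x
     = indicator {0<..<t} r * (LINT z|lborel. gauss z * f r (x + sqrt (2 * \<nu> * (t - r)) *\<^sub>R z))" for r
    by (auto simp: src_def fb_def indicator_def)
  thus ?thesis unfolding duhamel[OF assms] heat_def by (simp only:)
qed

lemma integrable_src: "integrable lborel (\<lambda>r. indicator {0<..<t} r * src t r x)"
proof (rule Bochner_Integration.integrable_bound)
  show "integrable lborel (\<lambda>r. indicator {0..t} r *\<^sub>R Bf)" by (rule borel_integrable_compact) auto
  show "AE r in lborel. norm (indicator {0<..<t} r * src t r x) \<le> norm (indicator {0..t} r *\<^sub>R Bf)"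
    using bdd_src Bf_nonneg by (intro AE_I2) (auto simp: indicator_def)
qed measurable

lemma nn_integral_heat_le: "(\<integral>\<^sup>+x. ennreal \<bar>heat t x\<bar> \<partial>lborel) \<le> mean_abs (u 0)"
  unfolding heat_def
  by (rule nn_integral_abs_gauss_average_le[where C = B]) (simp_all add: borel_measurable_u bdd_u)

text \<open>For the equation itself this is the L^1 norm of the nonlinear term at time
  \<open>r\<close>, the quantity v of the overview.\<close>

definition mass :: "real \<Rightarrow> ennreal" where
  "mass r = (\<integral>\<^sup>+x. ennreal \<bar>fb r x\<bar> \<partial>lborel)"

lemma borel_measurable_mass [measurable]: "mass \<in> borel_measurable borel"
  unfolding mass_def by measurable

text \<open>Gaussian averages preserve the integral of a nonnegative function, so integrating
  Duhamel's formula over space turns the source term into its total mass.\<close>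

lemma mass_integral_le:
  assumes t: "t > 0" and nn: "\<And>r x. r > 0 \<Longrightarrow> f r x \<ge> 0"
  shows "(\<integral>\<^sup>+r. indicator {0<..<t} r * mass r \<partial>lborel) \<le> mean_abs (u t) + mean_abs (u 0)"
proof -
  have fb_nn: "fb r x \<ge> 0" for r x using nn[of r x] by (auto simp: fb_def indicator_def)
  have src_nn: "src t r x \<ge> 0" for r x unfolding src_def by (intro integral_nonneg_AE AE_I2) (simp add: fb_nn)
  have [measurable]: "u t \<in> borel_measurable borel" using t by (simp add: borel_measurable_u)
  have src_eq: "ennreal (src t r x) = (\<integral>\<^sup>+z. ennreal (gauss z) * ennreal \<bar>fb r (x + sqrt (2 * \<nu> * (t - r)) *\<^sub>R z)\<bar> \<partial>lborel)" for r x
  proof -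
    have "integrable lborel (\<lambda>z. gauss z * fb r (x + sqrt (2 * \<nu> * (t - r)) *\<^sub>R z))"
      by (rule integrable_gauss_times_bounded[where C = Bf]) (simp_all add: bdd_fb)
    hence "ennreal (src t r x) = (\<integral>\<^sup>+z. ennreal (gauss z * fb r (x + sqrt (2 * \<nu> * (t - r)) *\<^sub>R z)) \<partial>lborel)"
      unfolding src_def by (subst nn_integral_eq_integral) (auto simp: fb_nn)
    thus ?thesis by (simp add: ennreal_mult fb_nn)
  qed
  have diff: "ennreal (u t x - heat t x) = (\<integral>\<^sup>+r. indicator {0<..<t} r * ennreal (src t r x) \<partial>lborel)" for x
  proof -
    have "u t x - heat t x = (LINT r|lborel. indicator {0<..<t} r * src t r x)" using duhamel_src[OF t, of x] by simp
    hence "ennreal (u t x - heat t x) = (\<integral>\<^sup>+r. ennreal (indicator {0<..<t} r * src t r x) \<partial>lborel)"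
      by (subst nn_integral_eq_integral[OF integrable_src]) (auto simp: src_nn)
    also have "\<dots> = (\<integral>\<^sup>+r. indicator {0<..<t} r * ennreal (src t r x) \<partial>lborel)"
      by (intro nn_integral_cong) (auto simp: indicator_def)
    finally show ?thesis .
  qed
  have "(\<integral>\<^sup>+r. indicator {0<..<t} r * mass r \<partial>lborel) = (\<integral>\<^sup>+r. \<integral>\<^sup>+x. indicator {0<..<t} r * ennreal (src t r x) \<partial>lborel \<partial>lborel)"
  proof (rule nn_integral_cong)
    fix r
    have "(\<integral>\<^sup>+x. ennreal (src t r x) \<partial>lborel) = mass r"
      unfolding src_eq mass_def
      by (rule nn_integral_gauss_average[of "\<lambda>x. ennreal \<bar>fb r x\<bar>"]) measurable
    thus "indicator {0<..<t} r * mass r = (\<integral>\<^sup>+x. indicator {0<..<t} r * ennreal (src t r x) \<partial>lborel)"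
      by (subst nn_integral_cmult) auto
  qed
  also have "\<dots> = (\<integral>\<^sup>+x. \<integral>\<^sup>+r. indicator {0<..<t} r * ennreal (src t r x) \<partial>lborel \<partial>lborel)"
    by (rule lborel_pair.Fubini'[symmetric]) measurable
  also have "\<dots> = (\<integral>\<^sup>+x. ennreal (u t x - heat t x) \<partial>lborel)" by (simp add: diff)
  also have "\<dots> \<le> (\<integral>\<^sup>+x. ennreal \<bar>u t x\<bar> + ennreal \<bar>heat t x\<bar> \<partial>lborel)"
    by (intro nn_integral_mono) (simp add: ennreal_plus[symmetric] ennreal_leI del: ennreal_plus)
  also have "\<dots> = mean_abs (u t) + (\<integral>\<^sup>+x. ennreal \<bar>heat t x\<bar> \<partial>lborel)"
    by (rule nn_integral_add) measurable
  also have "\<dots> \<le> mean_abs (u t) + mean_abs (u 0)"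
    by (intro add_left_mono nn_integral_heat_le)
  finally show ?thesis .
qed

text \<open>Each time slice of Duhamel's formula is estimated for difference quotients, and Fatou's
  lemma carries the bound to the derivative. \<open>I0\<close> is kept as a parameter because the
  heat flow of the initial datum is estimated in two ways.\<close>

lemma partial_derivative_L1:
  assumes t: "t > 0"
    and \<kappa>: "gauss_moment i \<le> ennreal \<kappa>"
    and I0: "\<And>\<epsilon>. \<epsilon> > 0 \<Longrightarrow> (\<integral>\<^sup>+x. ennreal \<bar>heat t (x + \<epsilon> *\<^sub>R axis i 1) - heat t x\<bar> \<partial>lborel) \<le> ennreal \<epsilon> * I0"
  shows "(\<integral>\<^sup>+x. ennreal \<bar>g t x $ i\<bar> \<partial>lborel)
     \<le> I0 + (\<integral>\<^sup>+r. indicator {0<..<t} r * (ennreal (1 / sqrt (2 * \<nu> * (t - r))) * (ennreal \<kappa> * mass r)) \<partial>lborel)"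
proof -
  let ?e = "axis i 1 :: real^'n"
  let ?RHS = "I0 + (\<integral>\<^sup>+r. indicator {0<..<t} r * (ennreal (1 / sqrt (2 * \<nu> * (t - r))) * (ennreal \<kappa> * mass r)) \<partial>lborel)"
  have [measurable]: "u t \<in> borel_measurable borel" using t by (simp add: borel_measurable_u)
  have D: "(\<integral>\<^sup>+x. ennreal \<bar>u t (x + \<epsilon> *\<^sub>R ?e) - u t x\<bar> \<partial>lborel) \<le> ennreal \<epsilon> * ?RHS" if \<epsilon>: "\<epsilon> > 0" for \<epsilon>
  proof -
    let ?S = "\<lambda>r x. src t r (x + \<epsilon> *\<^sub>R ?e) - src t r x"
    have pt: "ennreal \<bar>u t (x + \<epsilon> *\<^sub>R ?e) - u t x\<bar>
       \<le> ennreal \<bar>heat t (x + \<epsilon> *\<^sub>R ?e) - heat t x\<bar> + (\<integral>\<^sup>+r. indicator {0<..<t} r * ennreal \<bar>?S r x\<bar> \<partial>lborel)" for x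
    proof -
      have int: "integrable lborel (\<lambda>r. indicator {0<..<t} r * ?S r x)"
        using integrable_src[of t "x + \<epsilon> *\<^sub>R ?e"] integrable_src[of t x] by (simp add: right_diff_distrib)
      have "u t (x + \<epsilon> *\<^sub>R ?e) - u t x = (heat t (x + \<epsilon> *\<^sub>R ?e) - heat t x) + (LINT r|lborel. indicator {0<..<t} r * ?S r x)"
        unfolding duhamel_src[OF t] using integrable_src[of t "x + \<epsilon> *\<^sub>R ?e"] integrable_src[of t x]
        by (simp add: right_diff_distrib)
      hence "\<bar>u t (x + \<epsilon> *\<^sub>R ?e) - u t x\<bar> \<le> \<bar>heat t (x + \<epsilon> *\<^sub>R ?e) - heat t x\<bar> + \<bar>LINT r|lborel. indicator {0<..<t} r * ?S r x\<bar>"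
        by simp
      hence "ennreal \<bar>u t (x + \<epsilon> *\<^sub>R ?e) - u t x\<bar> \<le> ennreal \<bar>heat t (x + \<epsilon> *\<^sub>R ?e) - heat t x\<bar> + ennreal \<bar>LINT r|lborel. indicator {0<..<t} r * ?S r x\<bar>"
        by (simp add: ennreal_plus[symmetric] ennreal_leI del: ennreal_plus)
      also have "ennreal \<bar>LINT r|lborel. indicator {0<..<t} r * ?S r x\<bar> \<le> (\<integral>\<^sup>+r. ennreal (norm (indicator {0<..<t} r * ?S r x)) \<partial>lborel)"
        using integral_norm_bound_ennreal[OF int] by simp
      also have "\<dots> = (\<integral>\<^sup>+r. indicator {0<..<t} r * ennreal \<bar>?S r x\<bar> \<partial>lborel)"
        by (intro nn_integral_cong) (auto simp: indicator_def)
      finally show ?thesis by (simp add: add_left_mono)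
    qed
    have inner: "(\<integral>\<^sup>+x. indicator {0<..<t} r * ennreal \<bar>?S r x\<bar> \<partial>lborel)
       \<le> ennreal \<epsilon> * (indicator {0<..<t} r * (ennreal (1 / sqrt (2 * \<nu> * (t - r))) * (ennreal \<kappa> * mass r)))" for r
    proof (cases "r \<in> {0<..<t}")
      case True
      define a where "a = sqrt (2 * \<nu> * (t - r))"
      have a: "a > 0" using True nu by (simp add: a_def)
      have "(\<integral>\<^sup>+x. ennreal \<bar>?S r x\<bar> \<partial>lborel) \<le> ennreal (\<epsilon> * (1 / a)) * (ennreal \<kappa> * mass r)"
        unfolding src_def mass_def a_def[symmetric]
        by (rule nn_integral_gauss_average_difference_le[OF _ bdd_fb a \<epsilon> \<kappa>]) measurable
      also have "ennreal (\<epsilon> * (1 / a)) = ennreal \<epsilon> * ennreal (1 / a)" using a \<epsilon> by (intro ennreal_mult) auto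
      finally show ?thesis using True by (simp add: a_def mult.assoc)
    qed simp
    have "(\<integral>\<^sup>+x. ennreal \<bar>u t (x + \<epsilon> *\<^sub>R ?e) - u t x\<bar> \<partial>lborel)
       \<le> (\<integral>\<^sup>+x. ennreal \<bar>heat t (x + \<epsilon> *\<^sub>R ?e) - heat t x\<bar> + (\<integral>\<^sup>+r. indicator {0<..<t} r * ennreal \<bar>?S r x\<bar> \<partial>lborel) \<partial>lborel)"
      by (intro nn_integral_mono pt)
    also have "\<dots> = (\<integral>\<^sup>+x. ennreal \<bar>heat t (x + \<epsilon> *\<^sub>R ?e) - heat t x\<bar> \<partial>lborel)
        + (\<integral>\<^sup>+x. \<integral>\<^sup>+r. indicator {0<..<t} r * ennreal \<bar>?S r x\<bar> \<partial>lborel \<partial>lborel)"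
      by (rule nn_integral_add) measurable
    also have "(\<integral>\<^sup>+x. \<integral>\<^sup>+r. indicator {0<..<t} r * ennreal \<bar>?S r x\<bar> \<partial>lborel \<partial>lborel)
       = (\<integral>\<^sup>+r. \<integral>\<^sup>+x. indicator {0<..<t} r * ennreal \<bar>?S r x\<bar> \<partial>lborel \<partial>lborel)"
      by (rule lborel_pair.Fubini') measurable
    also have "\<dots> \<le> (\<integral>\<^sup>+r. ennreal \<epsilon> * (indicator {0<..<t} r * (ennreal (1 / sqrt (2 * \<nu> * (t - r))) * (ennreal \<kappa> * mass r))) \<partial>lborel)"
      by (intro nn_integral_mono inner)
    also have "\<dots> = ennreal \<epsilon> * (\<integral>\<^sup>+r. indicator {0<..<t} r * (ennreal (1 / sqrt (2 * \<nu> * (t - r))) * (ennreal \<kappa> * mass r)) \<partial>lborel)"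
      by (rule nn_integral_cmult) measurable
    finally have "(\<integral>\<^sup>+x. ennreal \<bar>u t (x + \<epsilon> *\<^sub>R ?e) - u t x\<bar> \<partial>lborel)
       \<le> (\<integral>\<^sup>+x. ennreal \<bar>heat t (x + \<epsilon> *\<^sub>R ?e) - heat t x\<bar> \<partial>lborel)
        + ennreal \<epsilon> * (\<integral>\<^sup>+r. indicator {0<..<t} r * (ennreal (1 / sqrt (2 * \<nu> * (t - r))) * (ennreal \<kappa> * mass r)) \<partial>lborel)"
      by (simp add: add_left_mono)
    also have "\<dots> \<le> ennreal \<epsilon> * I0 + ennreal \<epsilon> * (\<integral>\<^sup>+r. indicator {0<..<t} r * (ennreal (1 / sqrt (2 * \<nu> * (t - r))) * (ennreal \<kappa> * mass r)) \<partial>lborel)"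
      by (intro add_right_mono I0 \<epsilon>)
    finally show ?thesis by (simp add: distrib_left)
  qed
  define q where "q n x = ennreal (real (Suc n)) * ennreal \<bar>u t (x + (1 / real (Suc n)) *\<^sub>R ?e) - u t x\<bar>" for n x
  have [measurable]: "q n \<in> borel_measurable borel" for n unfolding q_def[abs_def] by measurable
  have lim: "(\<lambda>n. q n x) \<longlonglongrightarrow> ennreal \<bar>g t x $ i\<bar>" for x
  proof -
    have "((\<lambda>s. u t (x + s *\<^sub>R ?e)) has_real_derivative g t (x + 0 *\<^sub>R ?e) \<bullet> ?e) (at 0)"
      by (rule has_real_derivative_along_line[OF gu[OF t]])
    hence "((\<lambda>s. (u t (x + s *\<^sub>R ?e) - u t x) / s) \<longlongrightarrow> g t x $ i) (at 0)"
      by (simp add: DERIV_def)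
    moreover have "filterlim (\<lambda>n. 1 / real (Suc n)) (at 0) sequentially"
    proof (rule filterlim_atI)
      show "(\<lambda>n. 1 / real (Suc n)) \<longlonglongrightarrow> 0" by real_asymp
    qed simp
    ultimately have "(\<lambda>n. (u t (x + (1 / real (Suc n)) *\<^sub>R ?e) - u t x) / (1 / real (Suc n))) \<longlonglongrightarrow> g t x $ i"
      by (rule filterlim_compose)
    hence "(\<lambda>n. ennreal \<bar>(u t (x + (1 / real (Suc n)) *\<^sub>R ?e) - u t x) / (1 / real (Suc n))\<bar>) \<longlonglongrightarrow> ennreal \<bar>g t x $ i\<bar>"
      by (intro tendsto_ennrealI tendsto_rabs)
    moreover have "ennreal \<bar>(u t (x + (1 / real (Suc n)) *\<^sub>R ?e) - u t x) / (1 / real (Suc n))\<bar> = q n x" for n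
      unfolding q_def by (subst ennreal_mult[symmetric]) (auto simp: abs_mult mult.commute)
    ultimately show ?thesis by (simp only:)
  qed
  have qle: "(\<integral>\<^sup>+x. q n x \<partial>lborel) \<le> ?RHS" for n
  proof -
    have "(\<integral>\<^sup>+x. q n x \<partial>lborel) = ennreal (real (Suc n)) * (\<integral>\<^sup>+x. ennreal \<bar>u t (x + (1 / real (Suc n)) *\<^sub>R ?e) - u t x\<bar> \<partial>lborel)"
      unfolding q_def by (rule nn_integral_cmult) measurable
    also have "\<dots> \<le> ennreal (real (Suc n)) * (ennreal (1 / real (Suc n)) * ?RHS)"
      by (intro mult_left_mono D) auto
    also have "\<dots> = ennreal (real (Suc n) * (1 / real (Suc n))) * ?RHS"
      by (subst ennreal_mult) (auto simp: mult.assoc)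
    also have "\<dots> = ?RHS" by simp
    finally show ?thesis .
  qed
  have "(\<integral>\<^sup>+x. ennreal \<bar>g t x $ i\<bar> \<partial>lborel) = (\<integral>\<^sup>+x. liminf (\<lambda>n. q n x) \<partial>lborel)"
    by (intro nn_integral_cong lim_imp_Liminf[symmetric] lim) simp
  also have "\<dots> \<le> liminf (\<lambda>n. \<integral>\<^sup>+x. q n x \<partial>lborel)" by (rule nn_integral_liminf) measurable
  also have "\<dots> \<le> liminf (\<lambda>n. ?RHS)" by (intro Liminf_mono always_eventually allI qle)
  also have "\<dots> = ?RHS" by (rule Liminf_const) simp
  finally show ?thesis .
qed

text \<open>One choice of \<open>I0\<close>, by smoothing: only the L^1 norm of \<open>u 0\<close>
  enters, at the price of a singularity at \<open>t = 0\<close>.\<close>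

lemma heat_difference_smoothing:
  assumes t: "t > 0" and \<epsilon>: "\<epsilon> > 0"
    and \<kappa>: "gauss_moment i \<le> ennreal \<kappa>"
  shows "(\<integral>\<^sup>+x. ennreal \<bar>heat t (x + \<epsilon> *\<^sub>R axis i 1) - heat t x\<bar> \<partial>lborel)
     \<le> ennreal \<epsilon> * (ennreal (1 / sqrt (2 * \<nu> * t)) * (ennreal \<kappa> * mean_abs (u 0)))"
proof -
  define a where "a = sqrt (2 * \<nu> * t)"
  have a: "a > 0" using t nu by (simp add: a_def)
  have "(\<integral>\<^sup>+x. ennreal \<bar>heat t (x + \<epsilon> *\<^sub>R axis i 1) - heat t x\<bar> \<partial>lborel)
     \<le> ennreal (\<epsilon> * (1 / a)) * (ennreal \<kappa> * mean_abs (u 0))"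
    unfolding heat_def a_def[symmetric]
    by (rule nn_integral_gauss_average_difference_le[OF _ bdd_u a \<epsilon> \<kappa>]) (simp_all add: borel_measurable_u)
  also have "ennreal (\<epsilon> * (1 / a)) = ennreal \<epsilon> * ennreal (1 / a)" using a \<epsilon> by (intro ennreal_mult) auto
  finally show ?thesis by (simp add: a_def mult.assoc)
qed

text \<open>The other choice of \<open>I0\<close>, without a singularity: translations commute with
  the heat flow, which does not increase the L^1 norm of the increment of
  \<open>u 0\<close>.\<close>

lemma heat_difference_le:
  assumes I0: "(\<integral>\<^sup>+x. ennreal \<bar>u 0 (x + \<epsilon> *\<^sub>R axis i 1) - u 0 x\<bar> \<partial>lborel) \<le> I0"
  shows "(\<integral>\<^sup>+x. ennreal \<bar>heat t (x + \<epsilon> *\<^sub>R axis i 1) - heat t x\<bar> \<partial>lborel) \<le> I0"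
proof -
  let ?e = "axis i 1 :: real^'n"
  define \<phi> where "\<phi> x = u 0 (x + \<epsilon> *\<^sub>R ?e) - u 0 x" for x
  have [measurable]: "u 0 \<in> borel_measurable borel" by (simp add: borel_measurable_u)
  have \<phi>b: "\<bar>\<phi> x\<bar> \<le> 2 * B" for x
    using bdd_u[of 0 x] bdd_u[of 0 "x + \<epsilon> *\<^sub>R ?e"] unfolding \<phi>_def by simp
  have "heat t (x + \<epsilon> *\<^sub>R ?e) - heat t x = (LINT z|lborel. gauss z * \<phi> (x + sqrt (2 * \<nu> * t) *\<^sub>R z))" for x
  proof -
    have "integrable lborel (\<lambda>z. gauss z * u 0 (y + sqrt (2 * \<nu> * t) *\<^sub>R z))" for y
      by (rule integrable_gauss_times_bounded[where C = B]) (simp_all add: bdd_u)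
    from this[of x] this[of "x + \<epsilon> *\<^sub>R ?e"] show ?thesis
      unfolding heat_def \<phi>_def by (simp add: right_diff_distrib add_ac)
  qed
  hence "(\<integral>\<^sup>+x. ennreal \<bar>heat t (x + \<epsilon> *\<^sub>R ?e) - heat t x\<bar> \<partial>lborel) \<le> mean_abs \<phi>"
    by (simp only:) (rule nn_integral_abs_gauss_average_le[OF _ \<phi>b], unfold \<phi>_def, measurable)
  thus ?thesis using I0 by (simp add: \<phi>_def)
qed

end

text \<open>Bounds the initial values of \<open>w\<close> linearly in those of \<open>h\<close>. For
  y \<ge> 0 it is 1 - y \<le> exp (- y) multiplied by exp y.\<close>

lemma exp_minus_one_le: "exp y - 1 \<le> \<bar>y\<bar> * exp \<bar>y\<bar>" for y :: real
proof (cases "y \<ge> 0")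
  case True
  have "1 + - y \<le> exp (- y)" by (rule exp_ge_add_one_self)
  hence "(1 - y) * exp y \<le> exp (- y) * exp y" by (intro mult_right_mono) auto
  thus ?thesis using True by (simp add: exp_minus algebra_simps)
next
  case False
  hence "exp y \<le> 1" by simp
  moreover have "0 \<le> \<bar>y\<bar> * exp \<bar>y\<bar>" by simp
  ultimately show ?thesis by linarith
qed

section \<open>Comparison with the heat flows of h and of its exponential transform\<close>

context kpz
begin

lemma source_nonneg: "h.fb r x \<ge> 0"
  using V_nonneg[of "norm (g r x)"] lam by (simp add: h.fb_def indicator_def)

lemma heat_le: "t > 0 \<Longrightarrow> h.heat t x \<le> h t x"
proof -
  assume t: "t > 0"
  have "0 \<le> (LINT r|lborel. indicator {0<..<t} r * h.src t r x)"
    unfolding h.src_def by (intro integral_nonneg_AE AE_I2 mult_nonneg_nonneg) (simp_all add: source_nonneg)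
  thus ?thesis using h.duhamel_src[OF t, of x] by linarith
qed

lemma w_le_heat: "t > 0 \<Longrightarrow> w t x \<le> w.heat t x"
proof -
  assume t: "t > 0"
  have "w.fb r z \<le> 0" for r z
  proof -
    have "lam\<^sup>2 / \<nu> * exp (lam / \<nu> * h r z) * (V (norm (g r z)) - (norm (g r z))\<^sup>2) \<le> 0"
      using V_le[of "norm (g r z)"] nu by (intro mult_nonneg_nonpos) auto
    thus ?thesis unfolding w.fb_def fw_def by (auto simp: indicator_def)
  qed
  hence "0 \<le> (LINT z|lborel. - (gauss z * w.fb r (x + sqrt (2 * \<nu> * (t - r)) *\<^sub>R z)))" for r
    by (intro integral_nonneg_AE AE_I2) (simp add: mult_nonneg_nonpos)
  hence "w.src t r x \<le> 0" for r unfolding w.src_def by simp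
  hence "0 \<le> (LINT r|lborel. - (indicator {0<..<t} r * w.src t r x))"
    by (intro integral_nonneg_AE AE_I2) (simp add: mult_nonneg_nonpos)
  thus ?thesis using w.duhamel_src[OF t, of x] by simp
qed

definition avg_abs :: "real \<Rightarrow> real ^ 'n \<Rightarrow> real" where
  "avg_abs t x = (LINT z|lborel. gauss z * \<bar>h 0 (x + sqrt (2 * \<nu> * t) *\<^sub>R z)\<bar>)"

lemma measurable_h0 [measurable]: "h 0 \<in> borel_measurable borel"
  by (simp add: h.borel_measurable_u)

lemma integrable_avg_abs: "integrable lborel (\<lambda>z. gauss z * \<bar>h 0 (x + a *\<^sub>R z)\<bar>)"
  by (rule integrable_gauss_times_bounded[where C = B]) (simp_all add: bdd_h)

lemma integrable_heat: "integrable lborel (\<lambda>z. gauss z * h 0 (x + a *\<^sub>R z))"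
  by (rule integrable_gauss_times_bounded[where C = B]) (simp_all add: bdd_h)

lemma integrable_w_heat: "integrable lborel (\<lambda>z. gauss z * w 0 (x + a *\<^sub>R z))"
proof (rule integrable_gauss_times_bounded[OF _ w.bdd_u[of 0]])
  have [measurable]: "w 0 \<in> borel_measurable borel" by (simp add: w.borel_measurable_u)
  show "(\<lambda>z. w 0 (x + a *\<^sub>R z)) \<in> borel_measurable borel" by measurable
qed simp

lemma initial_bound_nonneg:
  assumes M: "\<And>x. \<bar>h 0 x\<bar> \<le> M"
  shows "M \<ge> 0"
  using order_trans[OF abs_ge_zero M[of 0]] .

text \<open>From below \<open>h\<close> is compared with its heat flow. From above \<open>w\<close>
  is compared with its own, and the exponential is inverted.\<close>

lemma sup_bound:
  assumes M: "\<And>x. \<bar>h 0 x\<bar> \<le> M" and t: "t \<ge> 0"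
  shows "\<bar>h t x\<bar> \<le> M"
proof (cases "t = 0")
  case True thus ?thesis using M by simp
next
  case False
  hence t: "t > 0" using t by simp
  let ?a = "sqrt (2 * \<nu> * t)"
  have "(LINT z|lborel. gauss (z::real^'n) * (- M)) \<le> h.heat t x"
    unfolding h.heat_def
  proof (rule integral_mono)
    show "gauss z * (- M) \<le> gauss z * h 0 (x + ?a *\<^sub>R z)" for z
      using M[of "x + ?a *\<^sub>R z"] by (intro mult_left_mono) auto
  qed (use integrable_heat in auto)
  hence lower: "- M \<le> h t x" using heat_le[OF t, of x] by (simp add: integral_gauss)
  have "w.heat t x \<le> (LINT z|lborel. gauss (z::real^'n) * (exp (lam / \<nu> * M) - 1))"
    unfolding w.heat_def
  proof (rule integral_mono)
    show "gauss z * w 0 (x + ?a *\<^sub>R z) \<le> gauss z * (exp (lam / \<nu> * M) - 1)" for z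
    proof (rule mult_left_mono)
      have "h 0 (x + ?a *\<^sub>R z) \<le> M" using M[of "x + ?a *\<^sub>R z"] by simp
      hence "lam / \<nu> * h 0 (x + ?a *\<^sub>R z) \<le> lam / \<nu> * M" using lam nu by (intro mult_left_mono) auto
      thus "w 0 (x + ?a *\<^sub>R z) \<le> exp (lam / \<nu> * M) - 1" by (simp add: w_def)
    qed simp
  qed (use integrable_w_heat in auto)
  hence "w t x \<le> exp (lam / \<nu> * M) - 1" using w_le_heat[OF t, of x] by (simp add: integral_gauss)
  hence "lam / \<nu> * h t x \<le> lam / \<nu> * M" by (simp add: w_def)
  hence "h t x \<le> M" using lam nu by (simp add: mult_le_cancel_left_pos field_simps)
  with lower show ?thesis by simp
qed

text \<open>For the upper bound, \<lambda> h / \<nu> \<le> w, and \<open>w\<close> lies below its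
  heat flow; \<open>exp_minus_one_le\<close> bounds \<open>w 0\<close> by \<lambda> / \<nu> times
  exp (\<lambda> M / \<nu>) times the modulus of \<open>h 0\<close>. The factor \<lambda> / \<nu>
  cancels.\<close>

lemma abs_le_avg_abs:
  assumes M: "\<And>x. \<bar>h 0 x\<bar> \<le> M" and t: "t > 0"
  shows "\<bar>h t x\<bar> \<le> exp (lam / \<nu> * M) * avg_abs t x"
proof -
  let ?a = "sqrt (2 * \<nu> * t)" and ?E = "exp (lam / \<nu> * M)"
  have M0: "M \<ge> 0" by (rule initial_bound_nonneg[OF M])
  have E1: "?E \<ge> 1" using M0 lam nu by simp
  have A0: "avg_abs t x \<ge> 0" unfolding avg_abs_def by (intro integral_nonneg_AE AE_I2) simp
  have "- avg_abs t x = (LINT z|lborel. - (gauss z * \<bar>h 0 (x + ?a *\<^sub>R z)\<bar>))" by (simp add: avg_abs_def)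
  also have "\<dots> \<le> h.heat t x"
    unfolding h.heat_def
  proof (rule integral_mono)
    show "- (gauss z * \<bar>h 0 (x + ?a *\<^sub>R z)\<bar>) \<le> gauss z * h 0 (x + ?a *\<^sub>R z)" for z
      using mult_left_mono[of "- \<bar>h 0 (x + ?a *\<^sub>R z)\<bar>" "h 0 (x + ?a *\<^sub>R z)" "gauss z"] by simp
  qed (use integrable_heat integrable_avg_abs in auto)
  finally have "- avg_abs t x \<le> h t x" using heat_le[OF t, of x] by linarith
  moreover have "avg_abs t x \<le> ?E * avg_abs t x" using mult_right_mono[OF E1 A0] by simp
  ultimately have lower: "- (?E * avg_abs t x) \<le> h t x" by linarith
  have "w.heat t x \<le> (LINT z|lborel. (lam / \<nu> * ?E) * (gauss z * \<bar>h 0 (x + ?a *\<^sub>R z)\<bar>))"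
    unfolding w.heat_def
  proof (rule integral_mono)
    show "gauss z * w 0 (x + ?a *\<^sub>R z) \<le> (lam / \<nu> * ?E) * (gauss z * \<bar>h 0 (x + ?a *\<^sub>R z)\<bar>)" for z
    proof -
      let ?y = "h 0 (x + ?a *\<^sub>R z)"
      have "w 0 (x + ?a *\<^sub>R z) \<le> \<bar>lam / \<nu> * ?y\<bar> * exp \<bar>lam / \<nu> * ?y\<bar>"
        unfolding w_def by (rule exp_minus_one_le)
      also have "\<bar>lam / \<nu> * ?y\<bar> = lam / \<nu> * \<bar>?y\<bar>" using lam nu by (simp add: abs_mult)
      also have "lam / \<nu> * \<bar>?y\<bar> * exp (lam / \<nu> * \<bar>?y\<bar>) \<le> lam / \<nu> * \<bar>?y\<bar> * ?E"
      proof (rule mult_left_mono)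
        have "lam / \<nu> * \<bar>?y\<bar> \<le> lam / \<nu> * M" using M lam nu by (intro mult_left_mono) auto
        thus "exp (lam / \<nu> * \<bar>?y\<bar>) \<le> ?E" by simp
      qed (use lam nu in auto)
      finally have "gauss z * w 0 (x + ?a *\<^sub>R z) \<le> gauss z * (lam / \<nu> * \<bar>?y\<bar> * ?E)" by (intro mult_left_mono) auto
      thus ?thesis by (simp add: mult_ac)
    qed
    show "integrable lborel (\<lambda>z. (lam / \<nu> * ?E) * (gauss z * \<bar>h 0 (x + ?a *\<^sub>R z)\<bar>))"
      using integrable_avg_abs by (rule integrable_mult_right)
  qed (rule integrable_w_heat)
  also have "\<dots> = lam / \<nu> * (?E * avg_abs t x)" by (simp add: avg_abs_def)
  finally have "w t x \<le> lam / \<nu> * (?E * avg_abs t x)" using w_le_heat[OF t, of x] by linarith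
  moreover have "lam / \<nu> * h t x \<le> w t x"
    using exp_ge_add_one_self[of "lam / \<nu> * h t x"] unfolding w_def by linarith
  ultimately have "lam / \<nu> * h t x \<le> lam / \<nu> * (?E * avg_abs t x)" by linarith
  moreover have "lam / \<nu> > 0" using lam nu by simp
  ultimately have "h t x \<le> ?E * avg_abs t x" by (simp only: mult_le_cancel_left_pos)
  with lower show ?thesis by linarith
qed

lemma L1_bound:
  assumes M: "\<And>x. \<bar>h 0 x\<bar> \<le> M" and t: "t \<ge> 0"
  shows "mean_abs (h t) \<le> ennreal (exp (lam / \<nu> * M)) * mean_abs (h 0)"
proof (cases "t = 0")
  case True
  have "1 \<le> ennreal (exp (lam / \<nu> * M))"
    using initial_bound_nonneg[OF M] lam nu by (simp add: ennreal_1[symmetric] del: ennreal_1)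
  thus ?thesis using True mult_right_mono[of 1 "ennreal (exp (lam / \<nu> * M))"] by simp
next
  case False
  hence t: "t > 0" using t by simp
  have A0: "avg_abs t x \<ge> 0" for x unfolding avg_abs_def by (intro integral_nonneg_AE AE_I2) simp
  have [measurable]: "avg_abs t \<in> borel_measurable borel" unfolding avg_abs_def[abs_def] by measurable
  have "mean_abs (h t) \<le> (\<integral>\<^sup>+x. ennreal (exp (lam / \<nu> * M)) * ennreal \<bar>avg_abs t x\<bar> \<partial>lborel)"
    using abs_le_avg_abs[OF M t] A0
    by (intro nn_integral_mono) (simp add: ennreal_mult[symmetric] ennreal_leI)
  also have "\<dots> = ennreal (exp (lam / \<nu> * M)) * (\<integral>\<^sup>+x. ennreal \<bar>avg_abs t x\<bar> \<partial>lborel)"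
    by (rule nn_integral_cmult) measurable
  also have "(\<integral>\<^sup>+x. ennreal \<bar>avg_abs t x\<bar> \<partial>lborel) \<le> (\<integral>\<^sup>+x. ennreal \<bar>\<bar>h 0 x\<bar>\<bar> \<partial>lborel)"
    unfolding avg_abs_def by (rule nn_integral_abs_gauss_average_le[where C = B]) (simp_all add: bdd_h)
  finally show ?thesis by (simp add: mult_left_mono)
qed

text \<open>Coordinates are summed because the estimates concern one partial derivative at a time;
  the sum dominates the L^1 norm of the gradient.\<close>

definition N :: "real \<Rightarrow> ennreal" where
  "N t = (\<Sum>i\<in>UNIV. \<integral>\<^sup>+x. ennreal \<bar>g t x $ i\<bar> \<partial>lborel)"

lemma measurable_g: "t > 0 \<Longrightarrow> g t \<in> borel_measurable borel"
proof -
  assume "t > 0"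
  moreover have "continuous_on UNIV (\<lambda>x. (t, x))" by (intro continuous_intros)
  ultimately show ?thesis
    using continuous_on_compose2[OF cont_g, of UNIV "\<lambda>x. (t, x)"] by (auto intro: borel_measurable_continuous_onI)
qed

lemma nn_integral_norm_g_le:
  assumes "t > 0"
  shows "(\<integral>\<^sup>+x. ennreal (norm (g t x)) \<partial>lborel) \<le> N t"
proof -
  have [measurable]: "g t \<in> borel_measurable borel" by (rule measurable_g[OF assms])
  have "(\<integral>\<^sup>+x. ennreal (norm (g t x)) \<partial>lborel) \<le> (\<integral>\<^sup>+x. (\<Sum>i\<in>UNIV. ennreal \<bar>g t x $ i\<bar>) \<partial>lborel)"
    by (intro nn_integral_mono) (simp add: sum_ennreal norm_le_l1_cart ennreal_leI)
  also have "\<dots> = N t" unfolding N_def by (rule nn_integral_sum) measurable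
  finally show ?thesis .
qed

lemma mass_le:
  assumes t: "t > 0" and G: "\<And>x. norm (g t x) \<le> G"
  shows "h.mass t \<le> ennreal (lam * G) * N t"
proof -
  have [measurable]: "g t \<in> borel_measurable borel" by (rule measurable_g[OF t])
  have G0: "G \<ge> 0" using order_trans[OF norm_ge_zero G] .
  have "h.mass t \<le> (\<integral>\<^sup>+x. ennreal (lam * G) * ennreal (norm (g t x)) \<partial>lborel)"
    unfolding h.mass_def
  proof (rule nn_integral_mono)
    fix x
    have "V (norm (g t x)) \<le> norm (g t x) * norm (g t x)" using V_le[of "norm (g t x)"] by (simp add: power2_eq_square)
    also have "\<dots> \<le> G * norm (g t x)" using G by (intro mult_right_mono) auto
    finally have "lam * V (norm (g t x)) \<le> lam * G * norm (g t x)" using lam by simp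
    hence "\<bar>h.fb t x\<bar> \<le> lam * G * norm (g t x)" using source_nonneg[of t x] t by (simp add: h.fb_def)
    thus "ennreal \<bar>h.fb t x\<bar> \<le> ennreal (lam * G) * ennreal (norm (g t x))"
      using lam G0 by (simp add: ennreal_mult[symmetric] ennreal_leI)
  qed
  also have "\<dots> = ennreal (lam * G) * (\<integral>\<^sup>+x. ennreal (norm (g t x)) \<partial>lborel)" by (rule nn_integral_cmult) measurable
  also have "\<dots> \<le> ennreal (lam * G) * N t" by (intro mult_left_mono nn_integral_norm_g_le t) simp
  finally show ?thesis .
qed

lemma kernel_scaling:
  "ennreal (1 / sqrt (2 * \<nu> * y)) * (ennreal \<kappa> * m) = ennreal (\<kappa> / sqrt (2 * \<nu>)) * (ennreal (1 / sqrt y) * m)"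
  if "\<kappa> \<ge> 0" "y \<ge> 0"
proof -
  have "1 / sqrt (2 * \<nu> * y) * \<kappa> = \<kappa> / sqrt (2 * \<nu>) * (1 / sqrt y)" by (simp add: real_sqrt_mult)
  hence "ennreal (1 / sqrt (2 * \<nu> * y)) * ennreal \<kappa> = ennreal (\<kappa> / sqrt (2 * \<nu>)) * ennreal (1 / sqrt y)"
    using that nu by (simp only: ennreal_mult[symmetric] divide_nonneg_nonneg real_sqrt_ge_zero zero_le_one mult_nonneg_nonneg
      less_imp_le zero_le_numeral)
  thus ?thesis by (simp add: mult.assoc[symmetric])
qed

lemma partial_L1_from_0:
  assumes t: "t > 0" and \<kappa>0: "\<kappa> \<ge> 0"
    and \<kappa>: "gauss_moment i \<le> ennreal \<kappa>"
  shows "(\<integral>\<^sup>+x. ennreal \<bar>g t x $ i\<bar> \<partial>lborel)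
     \<le> ennreal (\<kappa> / sqrt (2 * \<nu>)) * (ennreal (1 / sqrt t) * mean_abs (h 0))
      + ennreal (\<kappa> / sqrt (2 * \<nu>)) * abel 0 t h.mass"
    and "(\<And>\<epsilon>. \<epsilon> > 0 \<Longrightarrow> (\<integral>\<^sup>+x. ennreal \<bar>h 0 (x + \<epsilon> *\<^sub>R axis i 1) - h 0 x\<bar> \<partial>lborel) \<le> ennreal \<epsilon> * I0) \<Longrightarrow>
     (\<integral>\<^sup>+x. ennreal \<bar>g t x $ i\<bar> \<partial>lborel)
     \<le> I0 + ennreal (\<kappa> / sqrt (2 * \<nu>)) * abel 0 t h.mass"
proof -
  have src: "(\<integral>\<^sup>+r. indicator {0<..<t} r * (ennreal (1 / sqrt (2 * \<nu> * (t - r))) * (ennreal \<kappa> * h.mass r)) \<partial>lborel)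
     = ennreal (\<kappa> / sqrt (2 * \<nu>)) * abel 0 t h.mass"
  proof -
    have "(\<integral>\<^sup>+r. indicator {0<..<t} r * (ennreal (1 / sqrt (2 * \<nu> * (t - r))) * (ennreal \<kappa> * h.mass r)) \<partial>lborel)
      = (\<integral>\<^sup>+r. ennreal (\<kappa> / sqrt (2 * \<nu>)) * (indicator {0<..<t} r * (ennreal (1 / sqrt (t - r)) * h.mass r)) \<partial>lborel)"
    proof (rule nn_integral_cong)
      fix r
      show "indicator {0<..<t} r * (ennreal (1 / sqrt (2 * \<nu> * (t - r))) * (ennreal \<kappa> * h.mass r))
        = ennreal (\<kappa> / sqrt (2 * \<nu>)) * (indicator {0<..<t} r * (ennreal (1 / sqrt (t - r)) * h.mass r))"
        using kernel_scaling[of \<kappa> "t - r" "h.mass r"] \<kappa>0 by (cases "r \<in> {0<..<t}") auto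
    qed
    also have "\<dots> = ennreal (\<kappa> / sqrt (2 * \<nu>)) * abel 0 t h.mass"
      by (rule nn_integral_cmult) measurable
    finally show ?thesis .
  qed
  show "(\<integral>\<^sup>+x. ennreal \<bar>g t x $ i\<bar> \<partial>lborel)
     \<le> ennreal (\<kappa> / sqrt (2 * \<nu>)) * (ennreal (1 / sqrt t) * mean_abs (h 0))
      + ennreal (\<kappa> / sqrt (2 * \<nu>)) * abel 0 t h.mass"
    using h.partial_derivative_L1[OF t \<kappa> h.heat_difference_smoothing[OF t _ \<kappa>]] t \<kappa>0
    unfolding src by (simp only: kernel_scaling less_imp_le)
  assume I0: "\<And>\<epsilon>. \<epsilon> > 0 \<Longrightarrow> (\<integral>\<^sup>+x. ennreal \<bar>h 0 (x + \<epsilon> *\<^sub>R axis i 1) - h 0 x\<bar> \<partial>lborel) \<le> ennreal \<epsilon> * I0"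
  show "(\<integral>\<^sup>+x. ennreal \<bar>g t x $ i\<bar> \<partial>lborel)
     \<le> I0 + ennreal (\<kappa> / sqrt (2 * \<nu>)) * abel 0 t h.mass"
    using h.partial_derivative_L1[OF t \<kappa> h.heat_difference_le[OF I0]] unfolding src .
qed

lemma partial_L1_from:
  assumes s: "0 \<le> s" "s < t" and \<kappa>0: "\<kappa> \<ge> 0"
    and \<kappa>: "gauss_moment i \<le> ennreal \<kappa>"
  shows "(\<integral>\<^sup>+x. ennreal \<bar>g t x $ i\<bar> \<partial>lborel)
     \<le> ennreal (\<kappa> / sqrt (2 * \<nu>)) * (ennreal (1 / sqrt (t - s)) * mean_abs (h s))
      + ennreal (\<kappa> / sqrt (2 * \<nu>)) * abel s t h.mass"
proof -
  interpret S: kpz \<nu> lam c B Bg V V1 "\<lambda>t. h (s + t)" "\<lambda>t. h' (s + t)" "\<lambda>t. g (s + t)" "\<lambda>t. H (s + t)"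
    by (rule shift[OF s(1)])
  \<comment> \<open>Stated for positive \<open>r\<close> only: the shifted instance sets its source
    to 0 for \<open>r \<le> 0\<close>, whereas the original source at time \<open>s + r\<close> need
    not vanish there.\<close>
  have mass: "S.h.mass r = h.mass (s + r)" if "r > 0" for r
    using that s by (simp add: S.h.mass_def h.mass_def S.h.fb_def h.fb_def)
  have "(\<integral>\<^sup>+r. indicator {0<..<t - s} r * (ennreal (1 / sqrt (t - s - r)) * S.h.mass r) \<partial>lborel)
     = (\<integral>\<^sup>+r. indicator {s<..<t} (r + s) * (ennreal (1 / sqrt (t - (r + s))) * h.mass (r + s)) \<partial>lborel)"
  proof (rule nn_integral_cong)
    fix r
    show "indicator {0<..<t - s} r * (ennreal (1 / sqrt (t - s - r)) * S.h.mass r)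
      = indicator {s<..<t} (r + s) * (ennreal (1 / sqrt (t - (r + s))) * h.mass (r + s))"
    proof (cases "r \<in> {0<..<t - s}")
      case True
      hence "S.h.mass r = h.mass (r + s)" unfolding add.commute[of r s] by (intro mass) simp
      moreover have "r + s \<in> {s<..<t}" "t - s - r = t - (r + s)" using True by auto
      ultimately show ?thesis using True by (simp only: indicator_simps)
    next
      case False
      hence "r + s \<notin> {s<..<t}" by auto
      hence "indicator {0<..<t - s} r = (0::ennreal)" "indicator {s<..<t} (r + s) = (0::ennreal)"
        using False by (auto simp: indicator_def)
      thus ?thesis by (simp only: mult_zero_left)
    qed
  qed
  also have "\<dots> = abel s t h.mass"
    by (rule nn_integral_shift[of "\<lambda>r. indicator {s<..<t} r * (ennreal (1 / sqrt (t - r)) * h.mass r)"]) measurable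
  finally show ?thesis using S.partial_L1_from_0(1)[OF _ \<kappa>0 \<kappa>, of "t - s"] s by simp
qed

lemma N_le:
  assumes s: "0 \<le> s" "s < t" and \<kappa>0: "\<kappa> \<ge> 0"
    and \<kappa>: "\<And>i::'n. gauss_moment i \<le> ennreal \<kappa>"
    and q: "q = real CARD('n) * (\<kappa> / sqrt (2 * \<nu>))"
  shows "N t \<le> ennreal q * (ennreal (1 / sqrt (t - s)) * mean_abs (h s))
      + ennreal q * abel s t h.mass"
proof -
  have qe: "ennreal q = of_nat CARD('n) * ennreal (\<kappa> / sqrt (2 * \<nu>))"
    unfolding q using \<kappa>0 nu by (subst ennreal_mult) (auto simp: ennreal_of_nat_eq_real_of_nat)
  have "N t \<le> (\<Sum>i\<in>(UNIV::'n set). ennreal (\<kappa> / sqrt (2 * \<nu>)) * (ennreal (1 / sqrt (t - s)) * mean_abs (h s))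
      + ennreal (\<kappa> / sqrt (2 * \<nu>)) * abel s t h.mass)"
    unfolding N_def by (intro sum_mono partial_L1_from[OF s \<kappa>0 \<kappa>])
  thus ?thesis by (simp add: qe distrib_left mult.assoc)
qed

lemma N_le_initial:
  assumes t: "t > 0" and \<kappa>0: "\<kappa> \<ge> 0"
    and \<kappa>: "\<And>i::'n. gauss_moment i \<le> ennreal \<kappa>"
    and q: "q = real CARD('n) * (\<kappa> / sqrt (2 * \<nu>))"
    and I0: "\<And>\<epsilon> i. \<epsilon> > 0 \<Longrightarrow> (\<integral>\<^sup>+x. ennreal \<bar>h 0 (x + \<epsilon> *\<^sub>R axis i 1) - h 0 x\<bar> \<partial>lborel) \<le> ennreal \<epsilon> * I0"
  shows "N t \<le> of_nat CARD('n) * I0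
      + ennreal q * abel 0 t h.mass"
proof -
  have qe: "ennreal q = of_nat CARD('n) * ennreal (\<kappa> / sqrt (2 * \<nu>))"
    unfolding q using \<kappa>0 nu by (subst ennreal_mult) (auto simp: ennreal_of_nat_eq_real_of_nat)
  have "N t \<le> (\<Sum>i\<in>(UNIV::'n set). I0
      + ennreal (\<kappa> / sqrt (2 * \<nu>)) * abel 0 t h.mass)"
    unfolding N_def by (intro sum_mono partial_L1_from_0(2)[OF t \<kappa>0 \<kappa> I0])
  thus ?thesis by (simp add: qe distrib_left mult.assoc)
qed

text \<open>The constant 18 is 6 from the iterated kernel times 3: the bound on the L^1 norm of
  \<open>h\<close> is used once for the initial term and twice for the total mass of the
  source.\<close>

lemma kernel_mass_le:
  assumes s: "0 \<le> s" "s < T" and \<kappa>0: "\<kappa> \<ge> 0"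
    and \<kappa>: "\<And>i::'n. gauss_moment i \<le> ennreal \<kappa>"
    and q: "q = real CARD('n) * (\<kappa> / sqrt (2 * \<nu>))"
    and M: "\<And>x. \<bar>h 0 x\<bar> \<le> M"
    and G: "\<And>r x. s < r \<Longrightarrow> r < T \<Longrightarrow> norm (g r x) \<le> G"
  shows "abel s T h.mass
     \<le> ennreal (18 * (lam * G) * q) * (ennreal (exp (lam / \<nu> * M)) * mean_abs (h 0))"
proof -
  define m where "m = ennreal (exp (lam / \<nu> * M)) * mean_abs (h 0)"
  have m: "mean_abs (h t) \<le> m" if "t \<ge> 0" for t
    unfolding m_def by (rule L1_bound[OF M that])
  have G0: "G \<ge> 0"
  proof -
    have "norm (g ((s + T) / 2) 0) \<le> G" using s by (intro G) auto
    thus ?thesis using norm_ge_zero order_trans by blast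
  qed
  have q0: "q \<ge> 0" unfolding q using \<kappa>0 nu by simp
  have "abel s T h.mass
     \<le> 6 * ennreal (lam * G) * (ennreal q * m + ennreal q * (m + m))"
  proof (rule singular_iteration[OF s(2) h.borel_measurable_mass, where N = N])
    fix r assume r: "s < r" "r < T"
    have "N r \<le> ennreal q * (ennreal (1 / sqrt (r - s)) * mean_abs (h s))
      + ennreal q * abel s r h.mass"
      by (rule N_le[OF s(1) r(1) \<kappa>0 \<kappa> q])
    also have "\<dots> \<le> ennreal q * (ennreal (1 / sqrt (r - s)) * m)
      + ennreal q * abel s r h.mass"
      by (intro add_right_mono mult_left_mono m s) auto
    finally show "N r \<le> ennreal q * m * ennreal (1 / sqrt (r - s))
      + ennreal q * abel s r h.mass"
      by (simp add: mult_ac)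
    show "h.mass r \<le> ennreal (lam * G) * N r" using r s G by (intro mass_le) auto
  next
    have "(\<integral>\<^sup>+r. indicator {s<..<T} r * h.mass r \<partial>lborel) \<le> (\<integral>\<^sup>+r. indicator {0<..<T} r * h.mass r \<partial>lborel)"
      using s by (intro nn_integral_mono) (auto simp: indicator_def)
    also have "\<dots> \<le> mean_abs (h T) + mean_abs (h 0)"
      using s lam V_nonneg by (intro h.mass_integral_le) auto
    also have "\<dots> \<le> m + m" using s by (intro add_mono m) auto
    finally show "(\<integral>\<^sup>+r. indicator {s<..<T} r * h.mass r \<partial>lborel) \<le> m + m" .
  qed
  also have "\<dots> = 18 * (ennreal (lam * G) * ennreal q) * m"
  proof -
    have "ennreal q * m + ennreal q * (m + m) = 3 * (ennreal q * m)"
    proof -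
      have "(3 :: ennreal) = 1 + (1 + 1)" by simp
      thus ?thesis by (simp only: distrib_right distrib_left mult_1_left add.assoc)
    qed
    moreover have "6 * ennreal (lam * G) * (3 * (ennreal q * m)) = (6 * 3) * (ennreal (lam * G) * ennreal q) * m"
      by (simp only: mult_ac)
    ultimately show ?thesis by simp
  qed
  also have "18 * (ennreal (lam * G) * ennreal q) = ennreal (18 * (lam * G) * q)"
    using lam G0 q0 by (simp add: ennreal_mult mult.assoc)
  finally show ?thesis by (simp add: m_def)
qed

end

section \<open>Decay of the gradient\<close>

context kpz
begin

lemma N_decay:
  assumes T: "T > 0" and \<kappa>0: "\<kappa> \<ge> 0"
    and \<kappa>: "\<And>i::'n. gauss_moment i \<le> ennreal \<kappa>"
    and q: "q = real CARD('n) * (\<kappa> / sqrt (2 * \<nu>))"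
    and M: "\<And>x. \<bar>h 0 x\<bar> \<le> M"
  shows "N T \<le> ennreal ((2 * q + 18 * q\<^sup>2 * (1 + 4 / c)) * exp (lam * M) * (1 / sqrt T))
      * (ennreal (exp (lam / \<nu> * M)) * mean_abs (h 0))"
proof -
  define m where "m = ennreal (exp (lam / \<nu> * M)) * mean_abs (h 0)"
  \<comment> \<open>The bound of \<open>gradient_decay\<close> at times after \<open>T / 2\<close>,
    where 1 / r is below 2 / T.\<close>
  define G where "G = sqrt (4 * M / (c * lam * T))"
  have M0: "M \<ge> 0" by (rule initial_bound_nonneg[OF M])
  have q0: "q \<ge> 0" unfolding q using \<kappa>0 nu by simp
  have G0: "G \<ge> 0" using M0 c lam T by (simp add: G_def)
  have G: "norm (g r x) \<le> G" if r: "T / 2 < r" "r < T" for r x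
  proof -
    have r0: "r > 0" using r T by simp
    have "c * lam * r * (norm (g r x))\<^sup>2 \<le> 2 * M"
      by (rule gradient_decay[OF sup_bound[OF M] r0])
    moreover have "c * lam * (T / 2) * (norm (g r x))\<^sup>2 \<le> c * lam * r * (norm (g r x))\<^sup>2"
      using r c lam by (intro mult_right_mono mult_left_mono) auto
    ultimately have "c * lam * T * (norm (g r x))\<^sup>2 \<le> 4 * M" by simp
    hence "(norm (g r x))\<^sup>2 \<le> 4 * M / (c * lam * T)" using c lam T by (simp add: field_simps)
    thus ?thesis unfolding G_def by (rule real_le_rsqrt)
  qed
  \<comment> \<open>\<lambda> survives only in the product \<open>lam * M\<close>, which an
    exponential can absorb.\<close>
  have lamG: "lam * G = sqrt (4 * (lam * M) / c) * (1 / sqrt T)"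
  proof -
    have "lam * G = sqrt (lam\<^sup>2 * (4 * M / (c * lam * T)))"
      by (simp only: G_def real_sqrt_mult real_sqrt_abs abs_of_pos[OF lam])
    also have "lam\<^sup>2 * (4 * M / (c * lam * T)) = 4 * (lam * M) / c * (1 / T)"
      using lam by (simp add: power2_eq_square field_simps)
    finally show ?thesis by (simp only: real_sqrt_mult real_sqrt_divide real_sqrt_one)
  qed
  have "N T \<le> ennreal q * (ennreal (1 / sqrt (T - T / 2)) * mean_abs (h (T / 2)))
      + ennreal q * abel (T / 2) T h.mass"
    using T by (intro N_le[OF _ _ \<kappa>0 \<kappa> q]) auto
  also have "\<dots> \<le> ennreal q * (ennreal (1 / sqrt (T - T / 2)) * m) + ennreal q * (ennreal (18 * (lam * G) * q) * m)"
    unfolding m_def using T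
    by (intro add_mono mult_left_mono L1_bound[OF M] kernel_mass_le[OF _ _ \<kappa>0 \<kappa> q M G]) auto
  also have "\<dots> = ennreal (q * (1 / sqrt (T - T / 2)) + q * (18 * (lam * G) * q)) * m"
  proof -
    have "ennreal q * (ennreal X * m) + ennreal q * (ennreal Y * m) = ennreal (q * X + q * Y) * m"
      if "X \<ge> 0" "Y \<ge> 0" for X Y
      using that q0 by (simp add: ennreal_mult distrib_right mult.assoc)
    thus ?thesis using T lam G0 q0 by simp
  qed
  also have "\<dots> \<le> ennreal ((2 * q + 18 * q\<^sup>2 * (1 + 4 / c)) * exp (lam * M) * (1 / sqrt T)) * m"
  proof (intro mult_right_mono ennreal_leI)
    have e1: "1 \<le> exp (lam * M)" using lam M0 by simp
    have "1 / sqrt (T - T / 2) = sqrt 2 * (1 / sqrt T)" by (simp add: real_sqrt_divide)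
    moreover have "sqrt 2 \<le> 2" by (rule real_le_lsqrt) auto
    ultimately have "q * (1 / sqrt (T - T / 2)) \<le> q * (2 * (1 / sqrt T))"
      using q0 T by (simp add: mult_left_mono divide_right_mono)
    also have "\<dots> \<le> 2 * q * exp (lam * M) * (1 / sqrt T)"
      using mult_left_mono[OF e1, of "2 * q * (1 / sqrt T)"] q0 T by (simp add: mult_ac)
    finally have 1: "q * (1 / sqrt (T - T / 2)) \<le> 2 * q * exp (lam * M) * (1 / sqrt T)" .
    \<comment> \<open>The root of \<open>lam * M\<close> is now absorbed into
      \<open>exp (lam * M)\<close>, so that the remaining constant depends on \<open>q\<close> and
      \<open>c\<close> only.\<close>
    have "sqrt y \<le> 1 + y" if "y \<ge> 0" for y :: real
      by (rule real_le_lsqrt) (use that in \<open>auto simp: power2_eq_square algebra_simps\<close>)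
    hence "sqrt (4 * (lam * M) / c) \<le> 1 + 4 * (lam * M) / c" using M0 lam c by simp
    also have "\<dots> \<le> (1 + 4 / c) * (1 + lam * M)" using M0 lam c by (simp add: field_simps)
    also have "\<dots> \<le> (1 + 4 / c) * exp (lam * M)"
      using c exp_ge_add_one_self[of "lam * M"] by (intro mult_left_mono) auto
    finally have "18 * q\<^sup>2 * (1 / sqrt T) * sqrt (4 * (lam * M) / c) \<le> 18 * q\<^sup>2 * (1 / sqrt T) * ((1 + 4 / c) * exp (lam * M))"
      using T by (intro mult_left_mono) auto
    hence 2: "q * (18 * (lam * G) * q) \<le> 18 * q\<^sup>2 * (1 + 4 / c) * exp (lam * M) * (1 / sqrt T)"
      unfolding lamG by (simp add: power2_eq_square mult_ac)
    show "q * (1 / sqrt (T - T / 2)) + q * (18 * (lam * G) * q) \<le> (2 * q + 18 * q\<^sup>2 * (1 + 4 / c)) * exp (lam * M) * (1 / sqrt T)"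
      unfolding distrib_right using 1 2 by linarith
  qed simp
  finally show ?thesis by (simp add: m_def)
qed

lemma N_short_time:
  assumes t: "t > 0" and \<kappa>0: "\<kappa> \<ge> 0"
    and \<kappa>: "\<And>i::'n. gauss_moment i \<le> ennreal \<kappa>"
    and q: "q = real CARD('n) * (\<kappa> / sqrt (2 * \<nu>))"
    and M: "\<And>x. \<bar>h 0 x\<bar> \<le> M"
    and I0: "\<And>\<epsilon> i. \<epsilon> > 0 \<Longrightarrow> (\<integral>\<^sup>+x. ennreal \<bar>h 0 (x + \<epsilon> *\<^sub>R axis i 1) - h 0 x\<bar> \<partial>lborel) \<le> ennreal \<epsilon> * I0"
    and lip: "\<And>x y. \<bar>h 0 x - h 0 y\<bar> \<le> \<Lambda> * dist x y" and \<Lambda>: "\<Lambda> \<ge> 0"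
  shows "N t \<le> of_nat CARD('n) * I0
      + ennreal (18 * q\<^sup>2 * (lam * \<Lambda>)) * (ennreal (exp (lam / \<nu> * M)) * mean_abs (h 0))"
proof -
  have q0: "q \<ge> 0" unfolding q using \<kappa>0 nu by simp
  \<comment> \<open>The constant barrier has to be positive, while \<open>\<Lambda>\<close> may be
    0; hence the detour through \<open>\<Lambda> + e\<close>.\<close>
  have G: "norm (g r x) \<le> \<Lambda>" if "r > 0" for r x
  proof (rule field_le_epsilon)
    fix e :: real assume e: "e > 0"
    show "norm (g r x) \<le> \<Lambda> + e"
    proof (rule gradient_le_initial_lipschitz[OF _ _ that])
      show "\<Lambda> + e > 0" using \<Lambda> e by simp
      show "h 0 x - h 0 y \<le> (\<Lambda> + e) * dist x y" for x y
      proof -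
        have "0 \<le> e * dist x y" using e by simp
        thus ?thesis using lip[of x y] unfolding distrib_right by linarith
      qed
    qed
  qed
  have "N t \<le> of_nat CARD('n) * I0
      + ennreal q * abel 0 t h.mass"
    by (rule N_le_initial[OF t \<kappa>0 \<kappa> q I0])
  also have "\<dots> \<le> of_nat CARD('n) * I0 + ennreal q * (ennreal (18 * (lam * \<Lambda>) * q)
       * (ennreal (exp (lam / \<nu> * M)) * mean_abs (h 0)))"
    using t by (intro add_left_mono mult_left_mono kernel_mass_le[OF _ _ \<kappa>0 \<kappa> q M G]) auto
  also have "ennreal q * (ennreal (18 * (lam * \<Lambda>) * q) * (ennreal (exp (lam / \<nu> * M)) * mean_abs (h 0)))
     = ennreal (q * (18 * (lam * \<Lambda>) * q)) * (ennreal (exp (lam / \<nu> * M)) * mean_abs (h 0))"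
    using q0 lam \<Lambda> by (subst ennreal_mult[of q]) (auto simp: mult.assoc)
  also have "q * (18 * (lam * \<Lambda>) * q) = 18 * q\<^sup>2 * (lam * \<Lambda>)" by (simp add: power2_eq_square mult_ac)
  finally show ?thesis .
qed

end

section \<open>From the decay estimates to the theorem\<close>

lemma dV_eq:
  assumes "(V has_real_derivative D) (at y within {0..})" and "y \<ge> 0"
  shows "dV V y = D"
proof (rule vector_derivative_within)
  show "at y within {0..} \<noteq> bot"
  proof (cases "y = 0")
    case True
    thus ?thesis using at_within_Ici_at_right[of "0::real"] by simp
  next
    case False
    hence "at y within {0..} = at y" using assms(2) by (intro at_within_interior) auto
    thus ?thesis by simp
  qed
  show "(V has_vector_derivative D) (at y within {0..})"
    using assms(1) by (simp add: has_real_derivative_iff_has_vector_derivative)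
qed

text \<open>1 + t is at most 4 t for t \<ge> 1 and at most 4 for t \<le> 1; the factor 2 is the root
  of 4.\<close>

lemma sqrt_decay:
  fixes t :: real
  assumes "t \<ge> 0"
  shows "t \<ge> 1 \<Longrightarrow> 1 / sqrt t \<le> 2 * (1 + t) powr (- 1 / 2)" "t \<le> 1 \<Longrightarrow> 1 \<le> 2 * (1 + t) powr (- 1 / 2)"
proof -
  have p: "(1 + t) powr (- 1 / 2) = 1 / sqrt (1 + t)"
    using assms by (simp add: powr_minus_divide powr_half_sqrt)
  have s: "sqrt (1 + t) > 0" using assms by simp
  have 4: "sqrt 4 = (2::real)" by simp
  {
    assume t: "t \<ge> 1"
    hence "sqrt (1 + t) \<le> sqrt (4 * t)" by (intro real_sqrt_le_mono) simp
    hence "sqrt (1 + t) \<le> 2 * sqrt t" by (simp only: real_sqrt_mult 4)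
    thus "1 / sqrt t \<le> 2 * (1 + t) powr (- 1 / 2)" unfolding p using t s by (simp add: field_simps)
  next
    assume "t \<le> 1"
    hence "sqrt (1 + t) \<le> sqrt 4" by (intro real_sqrt_le_mono) simp
    thus "1 \<le> 2 * (1 + t) powr (- 1 / 2)" unfolding p using s by (simp add: field_simps 4)
  }
qed

theorem theorem3p1:
  fixes \<nu> c\<^sub>V :: real
  assumes "\<nu> > 0" and "c\<^sub>V > 0"
  shows "\<exists>C K K' :: real. C > 0 \<and> K > 0 \<and> K' > 0 \<and>
    (\<forall>(lam::real) (V :: real \<Rightarrow> real) (h0 :: real ^ 'n \<Rightarrow> real) (h :: real \<Rightarrow> real ^ 'n \<Rightarrow> real).
       lam > 0 \<longrightarrow>
       standing_assumptions V \<longrightarrow>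
       (\<forall>y\<ge>0. y * dV V y - V y \<ge> c\<^sub>V * y\<^sup>2) \<longrightarrow>
       h0 \<in> W1_inf \<longrightarrow>
       integrable lebesgue h0 \<longrightarrow>
       \<not> (AE x in lebesgue. h0 x = 0) \<longrightarrow>
       is_solution \<nu> lam V h0 h \<longrightarrow>
       (\<forall>t\<ge>0. norm_L1 (weak_grad (h t))
          \<le> ennreal K
            * max (J_inf C K' lam h0) (ennpow (J_inf C K' lam h0) (1 + 1 / real CARD('n)))
            * ennreal ((1 + t) powr (- 1 / 2))))"
proof -
  obtain \<kappa> where \<kappa>: "\<kappa> > 0" "\<And>i::'n. gauss_moment i \<le> ennreal \<kappa>"
    using gauss_moment_bound[where 'n = 'n] by blast
  define d where "d = real CARD('n)"
  define q where "q = real CARD('n) * (\<kappa> / sqrt (2 * \<nu>))"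
  \<comment> \<open>The summand \<open>1 / \<nu>\<close> pays for the exponential of
    \<open>L1_bound\<close>, the summand 1 for the additional one in \<open>N_decay\<close>.\<close>
  define C where "C = 1 + 1 / \<nu>"
  \<comment> \<open>\<open>C1\<close> and \<open>C2\<close> are the constants of
    \<open>N_decay\<close> and \<open>N_short_time\<close>. In \<open>C2\<close> the first
    \<open>d\<close> comes from summing the partial derivatives, the second from the Lipschitz
    constant \<open>d * Gi\<close> of the initial datum.\<close>
  define C1 where "C1 = 2 * q + 18 * q\<^sup>2 * (1 + 4 / c\<^sub>V)"
  define C2 where "C2 = d + 18 * q\<^sup>2 * d"
  \<comment> \<open>The factor 2 is lost in \<open>sqrt_decay\<close>; the summand 1 gives
    \<open>K \<ge> 1\<close>, which settles \<open>t = 0\<close>.\<close>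
  define K where "K = 2 * (C1 + C2) + 1"
  have d: "d \<ge> 1" by (simp add: d_def Suc_leI)
  have q0: "q \<ge> 0" using \<kappa>(1) assms(1) by (simp add: q_def)
  have C1: "C1 \<ge> 0" and C2: "C2 \<ge> 0" using q0 assms(2) d by (auto simp: C1_def C2_def)
  have K: "K > 0" "K \<ge> 1" "2 * C1 \<le> K" "2 * C2 \<le> K" using C1 C2 by (auto simp: K_def)
  show ?thesis
  proof (rule exI[of _ C], rule exI[of _ K], rule exI[of _ "1::real"], intro conjI allI impI)
    show "C > 0" using assms(1) by (simp add: C_def add_pos_pos)
    show "K > 0" by (rule K)
    fix lam :: real and V and h0 :: "real^'n \<Rightarrow> real" and h :: "real \<Rightarrow> real^'n \<Rightarrow> real" and t :: real
    assume lam: "lam > 0" and sa: "standing_assumptions V"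
      and Vc: "\<forall>y\<ge>0. y * dV V y - V y \<ge> c\<^sub>V * y\<^sup>2" and W1: "h0 \<in> W1_inf" and int: "integrable lebesgue h0"
      and nz: "\<not> (AE x in lebesgue. h0 x = 0)" and sol: "is_solution \<nu> lam V h0 h" and t: "t \<ge> 0"
    obtain V1 V2 where V1: "\<And>y. y \<ge> 0 \<Longrightarrow> (V has_real_derivative V1 y) (at y within {0..})"
      and V2: "\<And>y. y \<ge> 0 \<Longrightarrow> (V1 has_real_derivative V2 y) (at y within {0..})"
      using sa unfolding standing_assumptions_def C2_halfline_def by blast
    have cont_V1: "continuous_on {0..} V1"
      using V2 by (meson DERIV_continuous atLeast_iff continuous_on_eq_continuous_within)
    note sol' = sol[unfolded is_solution_def]
    have cont_h: "continuous_on ({0..} \<times> UNIV) (\<lambda>(t, x). h t x)" and h00: "AE x in lebesgue. h 0 x = h0 x"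
      by (rule sol'[THEN conjunct1], rule sol'[THEN conjunct2, THEN conjunct1])
    obtain B where "\<forall>t\<ge>0. \<forall>x. \<bar>h t x\<bar> \<le> B"
      by (rule exE[OF sol'[THEN conjunct2, THEN conjunct2, THEN conjunct1]])
    hence B: "\<And>t x. t \<ge> 0 \<Longrightarrow> \<bar>h t x\<bar> \<le> B" by simp
    obtain h' :: "real \<Rightarrow> real^'n \<Rightarrow> real" and g :: "real \<Rightarrow> real^'n \<Rightarrow> real^'n" and H :: "real \<Rightarrow> real^'n \<Rightarrow> real^'n^'n" and Bg :: real
      where der_all: "\<forall>t>0. \<forall>x. ((\<lambda>s. h s x) has_real_derivative h' t x) (at t) \<and>
                  (h t has_derivative (\<lambda>v. g t x \<bullet> v)) (at x) \<and>
                  (g t has_derivative (\<lambda>v. H t x *v v)) (at x)"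
      and cont: "continuous_on ({0<..} \<times> UNIV) (\<lambda>(t, x). h' t x)"
        "continuous_on ({0<..} \<times> UNIV) (\<lambda>(t, x). g t x)"
        "continuous_on ({0<..} \<times> UNIV) (\<lambda>(t, x). H t x)"
      and Bg_all: "\<forall>t>0. \<forall>x. norm (g t x) \<le> Bg"
      and pde_all: "\<forall>t>0. \<forall>x. h' t x = \<nu> * trace (H t x) + lam * V (norm (g t x))"
      using sol'[THEN conjunct2, THEN conjunct2, THEN conjunct2] by (elim exE conjE) (rule that)
    have Bg: "\<And>t x. t > 0 \<Longrightarrow> norm (g t x) \<le> Bg" using Bg_all by simp
    have der: "((\<lambda>s. h s x) has_real_derivative h' t x) (at t)"
        "(h t has_derivative (\<lambda>v. g t x \<bullet> v)) (at x)"
        "(g t has_derivative (\<lambda>v. H t x *v v)) (at x)" if "t > 0" for t x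
      using der_all[rule_format, OF that, of x] by simp_all
    have pde: "\<And>t x. t > 0 \<Longrightarrow> h' t x = \<nu> * trace (H t x) + lam * V (norm (g t x))"
      using pde_all by simp
    have Vc': "y * V1 y - V y \<ge> c\<^sub>V * y\<^sup>2" if "y \<ge> 0" for y
      using Vc that dV_eq[OF V1[OF that] that] by auto
    have Vb: "V y \<ge> 0" "V y \<le> y\<^sup>2" if "y \<ge> 0" for y
      using sa that unfolding standing_assumptions_def by auto
    interpret kpz \<nu> lam "c\<^sub>V" B Bg V V1 h h' g H
      by standard (fact assms lam Vb V1 cont_V1 Vc' cont_h B der cont Bg pde)+

    define M where "M = enn2real (norm_Linf h0)"
    have Linf: "norm_Linf h0 = ennreal M" using W1 by (simp add: M_def W1_inf_def)
    have M0: "M \<ge> 0" by (simp add: M_def)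
    have c0: "continuous_on UNIV (h 0)" by (rule h.cont_u_at) simp
    have ae0: "AE x in lborel. h 0 x = h0 x" using h00 by (simp add: AE_completion_iff)
    \<comment> \<open>\<open>h0\<close> obeys its bound only almost everywhere; continuity of
      \<open>h 0\<close> makes it hold at every point.\<close>
    have M: "\<bar>h 0 x\<bar> \<le> M" for x
    proof (rule continuous_AE_le_imp_le[where k = "\<lambda>x. \<bar>h 0 x\<bar>"])
      show "continuous_on UNIV (\<lambda>x. \<bar>h 0 x\<bar>)" by (intro continuous_intros c0)
      have "AE x in lebesgue. ennreal (norm (h0 x)) \<le> norm_Linf h0" unfolding norm_Linf_def by (rule esssup_AE)
      hence "AE x in lborel. \<bar>h0 x\<bar> \<le> M" unfolding Linf AE_completion_iff using M0 by simp
      with ae0 show "AE x in lborel. \<bar>h 0 x\<bar> \<le> M" by eventually_elim simp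
    qed

    define m0 where "m0 = mean_abs (h 0)"
    have m0_eq: "norm_L1 h0 = m0"
      unfolding norm_L1_def m0_def nn_integral_completion
      by (rule nn_integral_cong_AE) (use ae0 in eventually_elim, simp)
    have m0_fin: "m0 \<noteq> \<infinity>" using int unfolding m0_eq[symmetric] norm_L1_def by (auto simp: integrable_iff_bounded)
    have m0_nz: "m0 \<noteq> 0"
    proof
      assume "m0 = 0"
      hence "AE x in lborel. ennreal \<bar>h 0 x\<bar> = 0" unfolding m0_def by (subst (asm) nn_integral_0_iff_AE) auto
      with ae0 have "AE x in lborel. h0 x = 0" by eventually_elim simp
      thus False using nz by (simp add: AE_completion_iff)
    qed

    define W where "W = weak_grad h0"
    obtain G0 where "has_weak_gradient h0 G0" using W1 unfolding W1_inf_def by blast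
    hence W0: "has_weak_gradient h0 W" unfolding W_def by (rule weak_grad_AE(2))
    have W: "has_weak_gradient (h 0) W" "weak_grad (h 0) = W"
      using W0 weak_grad_cong[OF h00] by (simp_all add: W_def)
    define I0 where "I0 = norm_L1 W"
    define E where "E = ennreal (exp (C * lam * M))"
    define S where "S = Sup {1, I0 / m0, ennreal lam * norm_Linf W * (1 + ennreal (1 * lam) * norm_Linf h0)}"
    define J where "J = J_inf C 1 lam h0"
    have J_eq: "J = S * m0 * E"
      by (simp add: J_def J_inf_def S_def E_def I0_def W_def m0_eq Linf M0)
    have E1: "1 \<le> E" using lam M0 assms(1) by (simp add: E_def C_def ennreal_1[symmetric] del: ennreal_1)
    have E_nz: "E \<noteq> 0" using E1 by auto
    have S_ge: "1 \<le> S" "I0 / m0 \<le> S" "ennreal lam * norm_Linf W * (1 + ennreal (1 * lam) * norm_Linf h0) \<le> S"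
      unfolding S_def by (intro Sup_upper; simp)+
    have J1: "m0 * E \<le> J"
      unfolding J_eq using mult_right_mono[OF S_ge(1), of "m0 * E"] by (simp add: mult.assoc)
    \<comment> \<open>Multiplying the second entry of the supremum by \<open>m0\<close> recovers
      \<open>I0\<close>, because \<open>m0\<close> is neither 0 nor infinite.\<close>
    have J2: "I0 \<le> J"
    proof -
      have "I0 = I0 / m0 * m0" using m0_nz m0_fin by (simp add: ennreal_divide_times ennreal_divide_self less_top[symmetric])
      also have "\<dots> \<le> S * m0" by (intro mult_right_mono S_ge) simp
      also have "\<dots> \<le> S * m0 * E" using mult_left_mono[OF E1, of "S * m0"] by simp
      finally show ?thesis by (simp add: J_eq)
    qed
    \<comment> \<open>This is the third entry of the supremum, whose bracket is at least 1.\<close>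
    have J3: "ennreal lam * norm_Linf W * (m0 * E) \<le> J"
    proof -
      have "ennreal lam * norm_Linf W * 1 \<le> ennreal lam * norm_Linf W * (1 + ennreal (1 * lam) * norm_Linf h0)"
        by (intro mult_left_mono) auto
      hence "ennreal lam * norm_Linf W \<le> S" using S_ge(3) by simp
      hence "ennreal lam * norm_Linf W * (m0 * E) \<le> S * (m0 * E)" by (intro mult_right_mono) auto
      thus ?thesis by (simp add: J_eq mult.assoc)
    qed
    define s where "s = (1 + t) powr (- 1 / 2)"
    have s0: "s > 0" using t by (simp add: s_def)
    have KE: "ennreal (exp (lam * M)) * ennreal (exp (lam / \<nu> * M)) = E"
      unfolding E_def C_def by (simp add: ennreal_mult[symmetric] exp_add[symmetric] algebra_simps)

    have "norm_L1 (weak_grad (h t)) \<le> ennreal K * J * ennreal s"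
    proof (cases "norm_Linf W = \<infinity>")
      \<comment> \<open>An infinite third entry makes \<open>J\<close> infinite, as
        \<open>m0 * E\<close> is not 0, and the bound is trivial.\<close>
      case True
      have "ennreal lam * norm_Linf W * (m0 * E) = \<infinity>"
        using True lam m0_nz E_nz by (simp add: ennreal_mult_eq_top_iff)
      hence "J = \<infinity>" using J3 by (simp add: top_unique)
      thus ?thesis using K s0 by (simp add: ennreal_mult_eq_top_iff)
    next
      case False
      define Gi where "Gi = enn2real (norm_Linf W)"
      have Gi: "norm_Linf W = ennreal Gi" "Gi \<ge> 0" using False by (auto simp: Gi_def less_top)
      have aeW: "AE x in lborel. norm (W x) \<le> Gi"
      proof -
        have "AE x in lebesgue. ennreal (norm (W x)) \<le> norm_Linf W" unfolding norm_Linf_def by (rule esssup_AE)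
        thus ?thesis unfolding Gi(1) AE_completion_iff using Gi(2) by simp
      qed
      have lip: "\<bar>h 0 x - h 0 y\<bar> \<le> d * Gi * dist x y" for x y
        unfolding d_def by (rule lipschitz_if_coordinate_differences[OF difference_le[OF W(1) c0 aeW] Gi(2)])
      have diffs: "(\<integral>\<^sup>+x. ennreal \<bar>h 0 (x + \<epsilon> *\<^sub>R axis i 1) - h 0 x\<bar> \<partial>lborel) \<le> ennreal \<epsilon> * I0" if "\<epsilon> > 0" for \<epsilon> i
        unfolding I0_def by (rule nn_integral_difference_le[OF W(1) c0 that])
      have grad: "norm_L1 (weak_grad (h t)) \<le> N t" if "t > 0"
      proof -
        have "continuous_on UNIV (g t)"
        proof -
          have "continuous_on UNIV (\<lambda>x::real^'n. (t, x))" by (intro continuous_intros)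
          thus ?thesis using continuous_on_compose2[OF cont(2), of UNIV "\<lambda>x. (t, x)"] that by auto
        qed
        hence "has_weak_gradient (h t) (g t)" by (rule has_weak_gradient_if_C1[OF der(2)[OF that]])
        thus ?thesis using nn_integral_norm_g_le[OF that] by (simp add: norm_L1_weak_grad)
      qed
      consider "t = 0" | "0 < t" "t \<le> 1" | "t > 1" using t by linarith
      thus ?thesis
      proof cases
        case 1
        have "1 * J \<le> ennreal K * J" using K(2) by (intro mult_right_mono) (simp_all add: ennreal_1[symmetric] del: ennreal_1)
        thus ?thesis using 1 J2 W(2) by (simp add: I0_def s_def)
      next
        case 2
        have "ennreal (18 * q\<^sup>2 * (lam * (d * Gi))) * (ennreal (exp (lam / \<nu> * M)) * m0)
           \<le> ennreal (18 * q\<^sup>2 * d) * J"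
        proof -
          have "ennreal (exp (lam / \<nu> * M)) \<le> E"
            unfolding E_def C_def using lam M0 by (intro ennreal_leI) (simp add: algebra_simps)
          hence "ennreal (lam * Gi) * (ennreal (exp (lam / \<nu> * M)) * m0) \<le> ennreal (lam * Gi) * (E * m0)"
            by (intro mult_left_mono mult_right_mono) auto
          also have "\<dots> = ennreal lam * norm_Linf W * (m0 * E)"
            using lam Gi by (simp add: ennreal_mult mult_ac)
          also have "\<dots> \<le> J" by (rule J3)
          finally have "ennreal (18 * q\<^sup>2 * d) * (ennreal (lam * Gi) * (ennreal (exp (lam / \<nu> * M)) * m0)) \<le> ennreal (18 * q\<^sup>2 * d) * J"
            by (intro mult_left_mono) auto
          moreover have "ennreal (18 * q\<^sup>2 * (lam * (d * Gi))) = ennreal (18 * q\<^sup>2 * d) * ennreal (lam * Gi)"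
          proof -
            have "18 * q\<^sup>2 * (lam * (d * Gi)) = 18 * q\<^sup>2 * d * (lam * Gi)" by simp
            thus ?thesis using d lam Gi by (simp only:) (intro ennreal_mult; simp)
          qed
          ultimately show ?thesis by (simp add: mult.assoc)
        qed
        moreover have "of_nat CARD('n) * I0 \<le> ennreal d * J"
          unfolding d_def ennreal_of_nat_eq_real_of_nat using J2 by (intro mult_left_mono) auto
        moreover have "N t \<le> of_nat CARD('n) * I0
            + ennreal (18 * q\<^sup>2 * (lam * (d * Gi))) * (ennreal (exp (lam / \<nu> * M)) * m0)"
          unfolding m0_def using \<kappa>(1) d Gi
          by (intro N_short_time[OF 2(1) _ \<kappa>(2) q_def M diffs lip]) auto
        ultimately have "N t \<le> ennreal d * J + ennreal (18 * q\<^sup>2 * d) * J"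
          by (meson add_mono order_trans)
        also have "\<dots> = ennreal C2 * J" unfolding C2_def using d by (simp add: distrib_right)
        also have "\<dots> \<le> ennreal (K * s) * J"
        proof (intro mult_right_mono ennreal_leI)
          have "C2 \<le> C2 * (2 * s)" using sqrt_decay(2)[OF t 2(2)] C2 mult_left_mono[of 1 "2 * s" C2] by (simp add: s_def)
          also have "\<dots> \<le> K * s" using K(4) s0 by (simp add: mult.assoc[symmetric] mult.commute[of C2] mult_right_mono)
          finally show "C2 \<le> K * s" .
        qed simp
        also have "\<dots> = ennreal K * J * ennreal s" using K(1) s0 by (simp add: ennreal_mult mult_ac)
        finally show ?thesis using grad[OF 2(1)] by (rule order_trans[rotated])
      next
        case 3
        hence t0: "t > 0" by simp
        have "N t \<le> ennreal (C1 * exp (lam * M) * (1 / sqrt t)) * (ennreal (exp (lam / \<nu> * M)) * m0)"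
          unfolding C1_def m0_def using \<kappa>(1) by (intro N_decay[OF t0 _ \<kappa>(2) q_def M]) simp
        also have "\<dots> = ennreal (C1 * (1 / sqrt t)) * (m0 * E)"
        proof -
          have "ennreal (C1 * exp (lam * M) * (1 / sqrt t)) = ennreal (C1 * (1 / sqrt t)) * ennreal (exp (lam * M))"
            using C1 t0 by (subst ennreal_mult[symmetric]) (auto simp: mult_ac)
          thus ?thesis unfolding KE[symmetric] by (simp only: mult_ac)
        qed
        also have "\<dots> \<le> ennreal (K * s) * J"
        proof (rule mult_mono[OF ennreal_leI J1])
          have "C1 * (1 / sqrt t) \<le> C1 * (2 * s)" using sqrt_decay(1)[OF t] 3 C1 by (intro mult_left_mono) (auto simp: s_def)
          also have "\<dots> \<le> K * s" using K(3) s0 by (simp add: mult.assoc[symmetric] mult.commute[of C1] mult_right_mono)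
          finally show "C1 * (1 / sqrt t) \<le> K * s" .
        qed simp_all
        also have "\<dots> = ennreal K * J * ennreal s" using K(1) s0 by (simp add: ennreal_mult mult_ac)
        finally show ?thesis using grad[OF t0] by (rule order_trans[rotated])
      qed
    qed
    also have "\<dots> \<le> ennreal K * max J (ennpow J (1 + 1 / real CARD('n))) * ennreal s"
      by (intro mult_right_mono mult_left_mono) auto
    finally show "norm_L1 (weak_grad (h t))
          \<le> ennreal K
            * max (J_inf C 1 lam h0) (ennpow (J_inf C 1 lam h0) (1 + 1 / real CARD('n)))
            * ennreal ((1 + t) powr (- 1 / 2))"
      by (simp add: J_def s_def)
  qed simp
qed

end
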